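(* Let $n\ge 2$, $k_1,k_2\ge0$ and $0\le\alpha\le n-1$. The number of NBC bases of the gain graph $K_n^{[-k_2,k_1+k_2]}$ with activity $\alpha$ equals the number of $(k_1+1,k_2)$-decreasing $(k_1+1+k_2)$-colored rooted trees on $[n]$ having exactly $\alpha$ edges of the form $(n,i)$ colored $1$. In particular, the number of bounded regions of the arrangement associated with $K_n^{[-k_2,k_1+k_2]}$ (taken in the hyperplane $x_1+\cdots+x_n=0$) equals the number of such trees with no edge of the form $(n,i)$ colored $1$.
   Context: For integers $a\le b$, $K_n^{[a,b]}$ is the gain graph (over $\mathbb Z$) with vertex set $[n]$ and, for every $1\le i<j\le n$ and every integer $g\in[a,b]$, one edge from $i$ to $j$ with gain $g$ (gain $-g$ in the reverse direction), corresponding to the hyperplane $x_j-x_i=g$ in $\mathbb R^n$; the associated arrangement consists of all these hyperplanes. A circle is balanced if the sum of the gains along it, in a fixed direction, is $0$. Fix a linear order on the edges. A broken circuit is a balanced circle minus its smallest edge. An NBC set is an edge set forming a forest of the underlying multigraph (no circles, no two parallel edges) containing no broken circuit; an NBC basis is an NBC set which is a spanning tree. For an NBC basis $B$, $e\in B$ is active if $e$ is the smallest edge among all $f$ with $(B\setminus\{e\})\cup\{f\}$ a spanning tree; the activity of $B$ is the number of active edges (the counts do not depend on the order). A $k$-colored rooted tree on $[n]$ is a set of $n-1$ triples $(u,w,c)$, $u\neq w\in[n]$, $c\in[k]$ (edge from parent $u$ to child $w$ with color $c$), each vertex a child at most once, with no cycle. For a vertex $v$ with at least one child let $c_v$ be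 the minimal color of edges from $v$ to its children. With $k=k_1'+k_2'$, the tree is $(k_1',k_2')$-decreasing if for every vertex $v$ with a child and $c_v\le k_1'$, every child $w$ joined to $v$ by an edge of color $c_v$ satisfies $w<v$. An edge of the form $(n,i)$ is one whose parent is $n$. *)

theory Defs
  imports "HOL-Analysis.Analysis"
begin

type_synonym gedge = "nat \<times> nat \<times> int"
  (* (i,j,g) with i < j : edge from i to j with gain g, i.e. hyperplane x_j - x_i = g *)

definition gain_edges :: "nat \<Rightarrow> int \<Rightarrow> int \<Rightarrow> gedge set" where
  "gain_edges n a b = {(i,j,g). 1 \<le> i \<and> i < j \<and> j \<le> n \<and> a \<le> g \<and> g \<le> b}"

definition ends :: "gedge \<Rightarrow> nat set" where
  "ends e = {fst e, fst (snd e)}"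

(* gain of edge e traversed starting at vertex u *)
definition dgain :: "gedge \<Rightarrow> nat \<Rightarrow> int" where
  "dgain e u = (if fst e = u then snd (snd e) else - snd (snd e))"

(* a closed walk v_0 e_0 v_1 ... v_{m-1} e_{m-1} v_0 with distinct vertices and distinct edges *)
definition circle_seq :: "nat list \<Rightarrow> gedge list \<Rightarrow> bool" where
  "circle_seq vs es \<longleftrightarrow> 2 \<le> length vs \<and> length es = length vs \<and> distinct vs \<and> distinct es \<and>
     (\<forall>t < length vs. ends (es ! t) = {vs ! t, vs ! ((t + 1) mod length vs)})"

definition is_circle :: "gedge set \<Rightarrow> gedge set \<Rightarrow> bool" where
  "is_circle E C \<longleftrightarrow> C \<subseteq> E \<and> (\<exists>vs es. circle_seq vs es \<and> set es = C)"

definition balanced_circle :: "gedge set \<Rightarrow> gedge set \<Rightarrow> bool" where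
  "balanced_circle E C \<longleftrightarrow> C \<subseteq> E \<and>
     (\<exists>vs es. circle_seq vs es \<and> set es = C \<and> (\<Sum>t < length vs. dgain (es ! t) (vs ! t)) = 0)"

(* circle minus its smallest edge w.r.t. the (injective) ranking ord *)
definition broken_circuit :: "(gedge \<Rightarrow> nat) \<Rightarrow> gedge set \<Rightarrow> gedge set" where
  "broken_circuit ord C = {e \<in> C. \<exists>f \<in> C. ord f < ord e}"

definition is_forest :: "gedge set \<Rightarrow> gedge set \<Rightarrow> bool" where
  "is_forest E S \<longleftrightarrow> S \<subseteq> E \<and> \<not> (\<exists>C \<subseteq> S. is_circle E C)"

definition adj :: "gedge set \<Rightarrow> (nat \<times> nat) set" where
  "adj S = {(i,j). \<exists>g. (i,j,g) \<in> S \<or> (j,i,g) \<in> S}"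

definition spanning_tree :: "nat \<Rightarrow> gedge set \<Rightarrow> gedge set \<Rightarrow> bool" where
  "spanning_tree n E S \<longleftrightarrow> is_forest E S \<and> (\<forall>u \<in> {1..n}. \<forall>v \<in> {1..n}. (u,v) \<in> (adj S)\<^sup>*)"

definition nbc_set :: "gedge set \<Rightarrow> (gedge \<Rightarrow> nat) \<Rightarrow> gedge set \<Rightarrow> bool" where
  "nbc_set E ord S \<longleftrightarrow> is_forest E S \<and>
     (\<forall>C. balanced_circle E C \<longrightarrow> \<not> broken_circuit ord C \<subseteq> S)"

definition nbc_basis :: "nat \<Rightarrow> gedge set \<Rightarrow> (gedge \<Rightarrow> nat) \<Rightarrow> gedge set \<Rightarrow> bool" where
  "nbc_basis n E ord B \<longleftrightarrow> nbc_set E ord B \<and> spanning_tree n E B"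

definition active :: "nat \<Rightarrow> gedge set \<Rightarrow> (gedge \<Rightarrow> nat) \<Rightarrow> gedge set \<Rightarrow> gedge \<Rightarrow> bool" where
  "active n E ord B e \<longleftrightarrow> e \<in> B \<and>
     (\<forall>f \<in> E. spanning_tree n E ((B - {e}) \<union> {f}) \<longrightarrow> ord e \<le> ord f)"

definition activity :: "nat \<Rightarrow> gedge set \<Rightarrow> (gedge \<Rightarrow> nat) \<Rightarrow> gedge set \<Rightarrow> nat" where
  "activity n E ord B = card {e \<in> B. active n E ord B e}"

(* k-colored rooted trees: triples (parent, child, color) *)
definition colored_rooted_tree :: "nat \<Rightarrow> nat \<Rightarrow> (nat \<times> nat \<times> nat) set \<Rightarrow> bool" where
  "colored_rooted_tree n k T \<longleftrightarrow>
     T \<subseteq> {(u,w,c). u \<in> {1..n} \<and> w \<in> {1..n} \<and> u \<noteq> w \<and> c \<in> {1..k}} \<and>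
     card T = n - 1 \<and>
     (\<forall>u w c u' c'. (u,w,c) \<in> T \<longrightarrow> (u',w,c') \<in> T \<longrightarrow> u = u' \<and> c = c') \<and>
     acyclic {(u,w). \<exists>c. (u,w,c) \<in> T}"

definition min_child_color :: "(nat \<times> nat \<times> nat) set \<Rightarrow> nat \<Rightarrow> nat" where
  "min_child_color T v = Min {c. \<exists>w. (v,w,c) \<in> T}"

definition decreasing_tree :: "nat \<Rightarrow> nat \<Rightarrow> nat \<Rightarrow> (nat \<times> nat \<times> nat) set \<Rightarrow> bool" where
  "decreasing_tree n k1' k2' T \<longleftrightarrow> colored_rooted_tree n (k1' + k2') T \<and>
     (\<forall>v. (\<exists>w c. (v,w,c) \<in> T) \<longrightarrow> min_child_color T v \<le> k1' \<longrightarrow>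
        (\<forall>w. (v, w, min_child_color T v) \<in> T \<longrightarrow> w < v))"

definition n_root_color1_edges :: "nat \<Rightarrow> (nat \<times> nat \<times> nat) set \<Rightarrow> nat" where
  "n_root_color1_edges n T = card {(u,w,c) \<in> T. u = n \<and> c = 1}"

(* hyperplane arrangement in R^n; coordinates indexed via a bijection idx : {1..n} -> 'n *)
definition arr_hyperplanes :: "(nat \<Rightarrow> 'n::finite) \<Rightarrow> gedge set \<Rightarrow> (real^'n) set set" where
  "arr_hyperplanes idx E = {{x. x $ idx j - x $ idx i = of_int g} | i j g. (i,j,g) \<in> E}"

definition sum_zero_space :: "(real^'n::finite) set" where
  "sum_zero_space = {x. (\<Sum>i\<in>UNIV. x $ i) = 0}"

(* regions of the arrangement inside the ambient set V *)
definition arr_regions :: "(real^'n::finite) set \<Rightarrow> (real^'n) set set \<Rightarrow> (real^'n) set set" where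
  "arr_regions V H = {connected_component_set (V - \<Union>H) x | x. x \<in> V - \<Union>H}"

definition num_bounded_regions :: "(nat \<Rightarrow> 'n::finite) \<Rightarrow> gedge set \<Rightarrow> nat" where
  "num_bounded_regions idx E =
     card {R \<in> arr_regions (sum_zero_space :: (real^'n) set) (arr_hyperplanes idx E). bounded R}"

end

theory Submission
  imports Defs "HOL-Combinatorics.Multiset_Permutations" "HOL-Combinatorics.Stirling"
    "HOL-Computational_Algebra.Polynomial"
begin

text \<open>
  Write \<open>q\<close> for a large integer and \<open>y = 1 - q\<close>. Deletion--contraction of the largest edge shows that the
  generating polynomial of NBC bases by activity at \<open>y\<close> is, up to the factor \<open>q (-1)^(n-1)\<close>, the number of
  colourings of the vertices by integers modulo \<open>q\<close> that avoid all hyperplanes; the same recursion shows that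
  its value at \<open>0\<close> is the number of bounded regions. In a colouring two cyclically consecutive vertices
  are at distance more than \<open>k2\<close>, and more than \<open>k1 + k2\<close> at an ascent, so the colourings are counted by a sum of
  binomial coefficients over permutations of \<open>{1..n-1}\<close> that depends only on the number of ascents.

  On the other side, rooted trees in which the weight of an edge depends only on the parent and on whether the
  child is smaller or larger have a product formula, obtained by removing the smallest vertex. The colour
  condition of decreasing trees is a signed sum of such weights. Both sides expand into
  \<open>\<Sum>r. Stirling (n-1) r * (rising factorials of length r)\<close>, so the two polynomials agree at infinitely
  many points.
\<close>

section \<open>Ascents of permutations and rising factorials\<close>

text \<open>No bijection between bases and trees is built. Activity exchanges edges among all
  spanning trees, while the NBC condition sees only balanced circles, so contraction must track
  gains as well as connectivity: an edge whose ends are already joined by contracted edges either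
  follows from them or contradicts them. The modulus is large for two reasons: a nonzero gain of a
  circle must stay nonzero modulo \<open>q\<close>, and the counts of colourings must lie where a
  binomial coefficient is a polynomial in its upper argument. The point \<open>1 - q\<close> comes
  from an isthmus: without it there are \<open>q\<close> times as many colourings as after its
  contraction, so forbidding it leaves the factor \<open>q - 1\<close>, whose sign is reversed by
  the extra contracted edge. Vertex \<open>n\<close> is special on both sides. Rotation puts it at
  position 0 and cuts the cycle there; in a tree all its children are smaller, so it escapes the
  colour condition and can carry the variable \<open>y\<close>.\<close>

fun asc :: "nat list \<Rightarrow> nat" where
  "asc (x # y # zs) = (if x < y then 1 else 0) + asc (y # zs)"
| "asc xs = 0"

lemma asc_le_length: "asc xs \<le> length xs"
  by (induction xs rule: asc.induct) auto

text \<open>A new maximum creates no ascent at the front or inside an existing ascent, which it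
  merely splits; inside a non-ascent or at the end it creates one. \<open>F\<close> is arbitrary
  because the induction replaces it by a shifted copy.\<close>

lemma sum_asc_insert_max:
  fixes F :: "nat \<Rightarrow> real"
  assumes "\<forall>x\<in>set xs. x < m"
  shows "(\<Sum>i\<le>length xs. F (asc (take i xs @ m # drop i xs)))
       = real (asc xs + 1) * F (asc xs) + (real (length xs) - real (asc xs)) * F (asc xs + 1)"
  using assms
proof (induction xs arbitrary: F rule: asc.induct)
  case (1 x y zs)
  define c where "c = (if x < y then 1 else 0::nat)"
  let ?a = "asc (y # zs)" and ?l = "length (y # zs)"
  let ?G = "\<lambda>i. asc (take i (y # zs) @ m # drop i (y # zs))"
  have m: "x < m" "y < m" "\<forall>x\<in>set zs. x < m" using 1(2) by auto
  have IH: "(\<Sum>i\<le>?l. F (c + ?G i)) = real (?a + 1) * F (c + ?a) + (real ?l - real ?a) * F (c + (?a + 1))"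
    using 1(1)[of "\<lambda>i. F (c + i)"] m by auto
  have G0: "?G 0 = ?a" using m by simp
  have "(\<Sum>i\<le>length (x # y # zs). F (asc (take i (x # y # zs) @ m # drop i (x # y # zs))))
     = F (asc (m # x # y # zs)) + (\<Sum>i\<le>?l. F (asc (x # take i (y # zs) @ m # drop i (y # zs))))"
    using sum.atMost_Suc_shift[of "\<lambda>i. F (asc (take i (x # y # zs) @ m # drop i (x # y # zs)))" ?l] by simp
  also have "(\<Sum>i\<le>?l. F (asc (x # take i (y # zs) @ m # drop i (y # zs))))
     = F (asc (x # m # y # zs)) + (\<Sum>i\<le>length zs. F (asc (x # take (Suc i) (y # zs) @ m # drop (Suc i) (y # zs))))"
    using sum.atMost_Suc_shift[of "\<lambda>i. F (asc (x # take i (y # zs) @ m # drop i (y # zs)))" "length zs"] by simp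
  also have "(\<Sum>i\<le>length zs. F (asc (x # take (Suc i) (y # zs) @ m # drop (Suc i) (y # zs))))
     = (\<Sum>i\<le>length zs. F (c + ?G (Suc i)))"
    by (intro sum.cong) (auto simp: c_def)
  also have "\<dots> = (\<Sum>i\<le>?l. F (c + ?G i)) - F (c + ?G 0)"
    using sum.atMost_Suc_shift[of "\<lambda>i. F (c + ?G i)" "length zs"] by simp
  finally show ?case using IH G0 m by (auto simp: c_def algebra_simps)
qed auto

text \<open>The Eulerian recurrence for an arbitrary weight of the number of ascents: every
  permutation of the larger set arises exactly once by inserting its maximum.\<close>

lemma sum_permutations_insert_max:
  fixes F :: "nat \<Rightarrow> real"
  assumes fin: "finite A" and less: "\<forall>x\<in>A. x < m"
  shows "(\<Sum>xs\<in>permutations_of_set (insert m A). F (asc xs))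
       = (\<Sum>xs\<in>permutations_of_set A. real (asc xs + 1) * F (asc xs)
            + (real (card A) - real (asc xs)) * F (asc xs + 1))"
proof -
  define ins where "ins = (\<lambda>(xs::nat list, i::nat). take i xs @ m # drop i xs)"
  have mA: "m \<notin> A" using less by auto
  have "bij_betw ins (permutations_of_set A \<times> {..card A}) (permutations_of_set (insert m A))"
  proof (rule bij_betw_byWitness[where f' = "\<lambda>ys. (remove1 m ys, length (takeWhile (\<lambda>y. y \<noteq> m) ys))"])
    show "\<forall>a\<in>permutations_of_set A \<times> {..card A}.
        (remove1 m (ins a), length (takeWhile (\<lambda>y. y \<noteq> m) (ins a))) = a"
    proof
      fix a assume a: "a \<in> permutations_of_set A \<times> {..card A}"
      obtain xs i where ai: "a = (xs, i)" by (cases a)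
      have xs: "xs \<in> permutations_of_set A" and i: "i \<le> card A" using a ai by auto
      have m: "m \<notin> set xs" using xs mA by (auto simp: permutations_of_set_def)
      have len: "length xs = card A" using xs by (auto simp: permutations_of_set_def distinct_card)
      have mt: "m \<notin> set (take i xs)" using m by (meson in_set_takeD)
      have "remove1 m (ins (xs, i)) = xs" using mt by (simp add: ins_def remove1_append)
      moreover have "takeWhile (\<lambda>y. y \<noteq> m) (ins (xs, i)) = take i xs"
        unfolding ins_def prod.case using mt by (subst takeWhile_append2) auto
      ultimately show "(remove1 m (ins a), length (takeWhile (\<lambda>y. y \<noteq> m) (ins a))) = a"
        using i len ai by simp
    qed
    show "\<forall>a'\<in>permutations_of_set (insert m A).
       ins (remove1 m a', length (takeWhile (\<lambda>y. y \<noteq> m) a')) = a'"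
    proof safe
      fix ys assume ys: "ys \<in> permutations_of_set (insert m A)"
      then obtain as bs where s: "ys = as @ m # bs" "m \<notin> set as" 
        by (metis insertI1 permutations_of_setD(1) split_list_first)
      have "takeWhile (\<lambda>y. y \<noteq> m) ys = as" using s by (subst s(1), subst takeWhile_append2) auto
      then show "ins (remove1 m ys, length (takeWhile (\<lambda>y. y \<noteq> m) ys)) = ys"
        using s by (simp add: ins_def remove1_append)
    qed
    show "ins ` (permutations_of_set A \<times> {..card A}) \<subseteq> permutations_of_set (insert m A)"
    proof safe
      fix xs i assume xs: "xs \<in> permutations_of_set A" and i: "i \<le> card A"
      have xd: "distinct xs" "set xs = A" using xs by (auto simp: permutations_of_set_def)
      have "set (take i xs) \<union> set (drop i xs) = A"
        by (metis append_take_drop_id set_append xd(2))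
      moreover have "set (take i xs) \<inter> set (drop i xs) = {}" "distinct (take i xs)" "distinct (drop i xs)"
        using xd(1) set_take_disj_set_drop_if_distinct by auto
      ultimately have d: "set (take i xs) \<union> set (drop i xs) = A"
        "set (take i xs) \<inter> set (drop i xs) = {}" "distinct (take i xs)" "distinct (drop i xs)" by blast+
      then show "ins (xs, i) \<in> permutations_of_set (insert m A)"
        using mA unfolding ins_def permutations_of_set_def by auto
    qed
    show "(\<lambda>ys. (remove1 m ys, length (takeWhile (\<lambda>y. y \<noteq> m) ys))) ` permutations_of_set (insert m A)
       \<subseteq> permutations_of_set A \<times> {..card A}"
    proof safe
      fix ys assume ys: "ys \<in> permutations_of_set (insert m A)"
      then obtain as bs where s: "ys = as @ m # bs" "m \<notin> set as" 
        by (metis insertI1 permutations_of_setD(1) split_list_first)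
      have "distinct ys" "set ys = insert m A" using ys by (auto simp: permutations_of_set_def)
      then have st: "distinct (as @ bs)" "set (as @ bs) = A" using s mA by auto
      have "takeWhile (\<lambda>y. y \<noteq> m) ys = as" using s by (subst s(1), subst takeWhile_append2) auto
      then show "remove1 m ys \<in> permutations_of_set A" "length (takeWhile (\<lambda>y. y \<noteq> m) ys) \<le> card A"
        using s st distinct_card[OF st(1)] by (auto simp: permutations_of_set_def remove1_append)
    qed
  qed
  then have "(\<Sum>xs\<in>permutations_of_set (insert m A). F (asc xs))
     = (\<Sum>a\<in>permutations_of_set A \<times> {..card A}. F (asc (ins a)))"
    by (rule sum.reindex_bij_betw[symmetric])
  also have "\<dots> = (\<Sum>xs\<in>permutations_of_set A. \<Sum>i\<le>card A. F (asc (take i xs @ m # drop i xs)))"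
    unfolding sum.cartesian_product by (intro sum.cong) (auto simp: ins_def)
  also have "\<dots> = (\<Sum>xs\<in>permutations_of_set A. real (asc xs + 1) * F (asc xs)
            + (real (card A) - real (asc xs)) * F (asc xs + 1))"
  proof (intro sum.cong refl)
    fix xs assume xs: "xs \<in> permutations_of_set A"
    have "length xs = card A" "set xs = A" using xs by (auto simp: permutations_of_set_def distinct_card)
    then show "(\<Sum>i\<le>card A. F (asc (take i xs @ m # drop i xs))) = real (asc xs + 1) * F (asc xs)
            + (real (card A) - real (asc xs)) * F (asc xs + 1)"
      using sum_asc_insert_max[of xs m F] less by simp
  qed
  finally show ?thesis .
qed

text \<open>Marking \<open>i\<close> ascents and gluing the list at them yields an ordered set
  partition into \<open>j - i\<close> increasing blocks, and each arises once. This is Frobenius'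
  identity; the proof matches the Eulerian recurrence with that of \<open>Stirling\<close>.\<close>

lemma sum_asc_choose:
  assumes "i \<le> j"
  shows "(\<Sum>xs\<in>permutations_of_set {1..j}. real (asc xs choose i)) = fact (j - i) * real (Stirling j (j - i))"
  using assms
proof (induction j arbitrary: i)
  case 0
  then show ?case by simp
next
  case (Suc j)
  have ins: "{1..Suc j} = insert (Suc j) {1..j}" by auto
  have rec: "(\<Sum>xs\<in>permutations_of_set {1..Suc j}. real (asc xs choose i))
    = (\<Sum>xs\<in>permutations_of_set {1..j}. real (asc xs + 1) * real (asc xs choose i)
            + (real j - real (asc xs)) * real ((asc xs + 1) choose i))"
    unfolding ins by (subst sum_permutations_insert_max) auto
  show ?case
  proof (cases i)
    case 0
    have "(\<Sum>xs\<in>permutations_of_set {1..j}. real (asc xs + 1) * real (asc xs choose i)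
            + (real j - real (asc xs)) * real ((asc xs + 1) choose i)) = (\<Sum>xs\<in>permutations_of_set {1..j}. real j + 1)"
      by (intro sum.cong) (auto simp: 0 algebra_simps)
    then show ?thesis using rec 0 by (simp add: algebra_simps)
  next
    case (Suc i')
    \<comment> \<open>This rewrites the product of \<open>a\<close> and a binomial coefficient with
      coefficients free of \<open>a\<close>, so that the recurrence closes on sums of
      binomials.\<close>
    have ch: "real a * real (a choose i') = real i * real (a choose i) + real i' * real (a choose i')" for a
    proof (cases "a < i'")
      case True
      then show ?thesis using Suc by (simp add: binomial_eq_0)
    next
      case False
      have "i * (a choose i) = (a - i') * (a choose i')"
        using Suc by (simp add: binomial_absorb_comp binomial_absorption mult.commute)
          (metis Suc_times_binomial_add binomial_absorb_comp binomial_absorption diff_Suc_1' mult.commute mult_Suc)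
      then have "real i * real (a choose i) = real (a - i') * real (a choose i')" by (metis of_nat_mult)
      then show ?thesis using False by (simp add: of_nat_diff algebra_simps)
    qed
    \<comment> \<open>The number of ascents survives only inside binomials; the remaining factor is
      the number of blocks of the larger permutation and extends the factorial by one step.\<close>
    have ptw: "real (a + 1) * real (a choose i) + (real j - real a) * real ((a + 1) choose i)
        = (real j + 1 - real i) * (real (a choose i) + real (a choose i'))" for a
    proof -
      have pas: "real ((a + 1) choose i) = real (a choose i') + real (a choose i)" using Suc by simp
      have "real (a + 1) * real (a choose i) + (real j - real a) * (real (a choose i') + real (a choose i))
        = (real j + 1) * real (a choose i) + real j * real (a choose i') - real a * real (a choose i')"
        by (simp add: algebra_simps)
      also have "\<dots> = (real j + 1) * real (a choose i) + real j * real (a choose i')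
           - (real i * real (a choose i) + real i' * real (a choose i'))" by (simp only: ch)
      also have "\<dots> = (real j + 1 - real i) * (real (a choose i) + real (a choose i'))"
        using Suc by (simp add: algebra_simps)
      finally show ?thesis using pas by simp
    qed
    have E: "(\<Sum>xs\<in>permutations_of_set {1..Suc j}. real (asc xs choose i))
      = (real j + 1 - real i) * ((\<Sum>xs\<in>permutations_of_set {1..j}. real (asc xs choose i))
         + (\<Sum>xs\<in>permutations_of_set {1..j}. real (asc xs choose i')))"
      unfolding rec ptw sum.distrib[symmetric] sum_distrib_left ..
    show ?thesis
    proof (cases "i = Suc j")
      case True
      then show ?thesis using E by simp
    next
      case False
      then have le: "i \<le> j" "i' \<le> j" using Suc.prems Suc by auto
      define r where "r = j - i"
      have r: "j - i = r" "j = r + i" using le by (auto simp: r_def)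
      have r': "Suc j - i = Suc r" "j - i' = Suc r" using r Suc by auto
      show ?thesis unfolding E Suc.IH[OF le(1)] Suc.IH[OF le(2)] r' r(1)
        using r by (simp add: algebra_simps)
    qed
  qed
qed

text \<open>Sums of \<open>\<Psi>\<close> over all \<open>m\<^sub>1 + \<dots> + m\<^sub>i\<close> with every \<open>m\<close> in \<open>{1..k}\<close>, that is, the \<open>i\<close>-th power of a sum of shift operators.\<close>

primrec bsum :: "nat \<Rightarrow> nat \<Rightarrow> (nat \<Rightarrow> real) \<Rightarrow> real" where
  "bsum k 0 \<Psi> = \<Psi> 0"
| "bsum k (Suc i) \<Psi> = (\<Sum>m=1..k. bsum k i (\<lambda>y. \<Psi> (m + y)))"

lemma bsum_add: "bsum k i (\<lambda>y. f y + g y) = bsum k i f + bsum k i g"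
  by (induction i arbitrary: f g) (auto simp: sum.distrib)

lemma bsum_cmult: "bsum k i (\<lambda>y. c * f y) = c * bsum k i f"
  by (induction i arbitrary: f) (auto simp: sum_distrib_left)

lemma bsum_diff: "bsum k i (\<lambda>y. f y - g y) = bsum k i f - bsum k i g"
  using bsum_add[of k i f "\<lambda>y. (-1) * g y"] bsum_cmult[of k i "-1" g] by simp

lemma bsum_sum: "bsum k i (\<lambda>y. \<Sum>m\<in>A. f m y) = (\<Sum>m\<in>A. bsum k i (f m))"
  by (induction i arbitrary: f) (auto intro: sum.swap)

text \<open>At \<open>X = - m\<close> this is \<open>(- 1) ^ j\<close> times
  \<open>m choose j\<close>, which is how numbers of colourings enter.\<close>

definition rf :: "nat \<Rightarrow> real \<Rightarrow> real" where "rf j X = pochhammer X j / fact j"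

lemma rf_Suc_add1: "rf (Suc j) (X + 1) = rf (Suc j) X + rf j (X + 1)"
proof -
  have "pochhammer (X + 1) (Suc j) = pochhammer X (Suc j) + (1 + real j) * pochhammer (X + 1) j"
    by (subst pochhammer_rec, subst pochhammer_Suc) (simp add: algebra_simps)
  then show ?thesis by (simp add: rf_def add_divide_distrib)
qed

lemma rf_Suc_add: "rf (Suc j) (X + real k) = rf (Suc j) X + (\<Sum>m=1..k. rf j (X + real m))"
proof (induction k)
  case (Suc k)
  then show ?case using rf_Suc_add1[of j "X + real k"] by (simp add: algebra_simps)
qed simp

text \<open>Shifting the argument by \<open>k\<close> is the identity plus an operator that lowers
  the degree by one and sums over shifts \<open>1..k\<close>. Expanding the \<open>a\<close>-th
  power of this sum by the binomial theorem gives the right-hand side.\<close>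

lemma rf_add_mult:
  "a \<le> j \<Longrightarrow> rf j (X + real k * real a) = (\<Sum>i\<le>a. real (a choose i) * bsum k i (\<lambda>y. rf (j - i) (X + real y)))"
proof (induction a arbitrary: X)
  case (Suc a)
  let ?b = "\<lambda>i. bsum k i (\<lambda>y. rf (j - i) (X + real y))"
  have st: "bsum k i (\<lambda>y. rf (j - i) (X + real k + real y)) = ?b i + ?b (Suc i)" if "i \<le> a" for i
  proof -
    have j: "j - i = Suc (j - Suc i)" using that Suc.prems by auto
    have "rf (j - i) (X + real k + real y) = rf (j - i) (X + real y) + (\<Sum>m=1..k. rf (j - Suc i) (X + real (m + y)))" for y
      unfolding j using rf_Suc_add[of "j - Suc i" "X + real y" k] by (simp add: algebra_simps)
    then show ?thesis by (simp add: bsum_add bsum_sum)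
  qed
  have "rf j (X + real k * real (Suc a)) = rf j ((X + real k) + real k * real a)" by (simp add: algebra_simps)
  also have "\<dots> = (\<Sum>i\<le>a. real (a choose i) * (?b i + ?b (Suc i)))"
    using Suc st by (subst Suc.IH) auto
  also have "\<dots> = (\<Sum>i\<le>a. real (a choose i) * ?b i) + (\<Sum>i\<le>a. real (a choose i) * ?b (Suc i))"
    by (simp add: algebra_simps sum.distrib)
  also have "(\<Sum>i\<le>a. real (a choose i) * ?b i) = (\<Sum>i\<le>Suc a. real (a choose i) * ?b i)" by simp
  also have "\<dots> = ?b 0 + (\<Sum>i\<le>a. real (a choose Suc i) * ?b (Suc i))"
    by (subst sum.atMost_Suc_shift) simp
  also have "?b 0 + (\<Sum>i\<le>a. real (a choose Suc i) * ?b (Suc i)) + (\<Sum>i\<le>a. real (a choose i) * ?b (Suc i))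
     = ?b 0 + (\<Sum>i\<le>a. real (Suc a choose Suc i) * ?b (Suc i))"
    by (simp add: algebra_simps sum.distrib)
  also have "\<dots> = (\<Sum>i\<le>Suc a. real (Suc a choose i) * ?b i)"
    by (subst sum.atMost_Suc_shift) simp
  finally show ?case .
qed simp

text \<open>After the binomial expansion the permutations enter only through sums of
  \<open>asc xs choose i\<close>; the factorial of \<open>sum_asc_choose\<close> cancels the
  denominator of \<open>rf\<close>.\<close>

lemma sum_rf_asc:
  "(\<Sum>xs\<in>permutations_of_set {1..j}. rf j (X + real k * real (asc xs)))
   = (\<Sum>r\<le>j. real (Stirling j r) * bsum k (j - r) (\<lambda>y. pochhammer (X + real y) r))"
proof -
  let ?b = "\<lambda>i. bsum k i (\<lambda>y. rf (j - i) (X + real y))"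
  have "(\<Sum>xs\<in>permutations_of_set {1..j}. rf j (X + real k * real (asc xs)))
     = (\<Sum>xs\<in>permutations_of_set {1..j}. \<Sum>i\<le>j. real (asc xs choose i) * ?b i)"
  proof (intro sum.cong refl)
    fix xs assume xs: "xs \<in> permutations_of_set {1..j}"
    have le: "asc xs \<le> j"
      using asc_le_length[of xs] xs length_finite_permutations_of_set[OF xs] by simp
    have "(\<Sum>i\<le>asc xs. real (asc xs choose i) * ?b i) = (\<Sum>i\<le>j. real (asc xs choose i) * ?b i)"
      by (rule sum.mono_neutral_left) (use le in auto)
    then show "rf j (X + real k * real (asc xs)) = (\<Sum>i\<le>j. real (asc xs choose i) * ?b i)"
      using rf_add_mult[OF le] by simp
  qed
  also have "\<dots> = (\<Sum>i\<le>j. (\<Sum>xs\<in>permutations_of_set {1..j}. real (asc xs choose i)) * ?b i)"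
    by (subst sum.swap) (simp add: sum_distrib_right)
  also have "\<dots> = (\<Sum>i\<le>j. real (Stirling j (j - i)) * bsum k i (\<lambda>y. pochhammer (X + real y) (j - i)))"
  proof (intro sum.cong refl)
    fix i assume "i \<in> {..j}"
    have "bsum k i (\<lambda>y. pochhammer (X + real y) (j - i)) = fact (j - i) * ?b i"
      by (subst bsum_cmult[symmetric]) (simp add: rf_def)
    then show "(\<Sum>xs\<in>permutations_of_set {1..j}. real (asc xs choose i)) * ?b i
        = real (Stirling j (j - i)) * bsum k i (\<lambda>y. pochhammer (X + real y) (j - i))"
      using sum_asc_choose[of i j] \<open>i \<in> {..j}\<close> by simp
  qed
  also have "\<dots> = (\<Sum>r\<le>j. real (Stirling j r) * bsum k (j - r) (\<lambda>y. pochhammer (X + real y) r))"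
    by (rule sum.reindex_bij_witness[of _ "\<lambda>r. j - r" "\<lambda>r. j - r"]) auto
  finally show ?thesis .
qed

text \<open>The children of a vertex \<open>v\<close> of a decreasing tree are coloured under a condition that is not a product
  over the children. It becomes a signed sum of products over types \<open>(z, m)\<close>: in type \<open>(z, m)\<close> a child
  larger than \<open>v\<close> may use the top \<open>k2 + m\<close> colours and a smaller child the top \<open>k2 + m + z\<close>
  (lemma \<open>sum_vtypes_color_ok\<close> below).\<close>

definition vtypes :: "nat \<Rightarrow> (nat \<times> nat) set" where
  "vtypes k = Pair 1 ` {0..k} \<union> Pair 0 ` {1..k}"

definition tsign :: "nat \<times> nat \<Rightarrow> real" where "tsign t = (if fst t = 1 then 1 else -1)"

lemma finite_vtypes [simp]: "finite (vtypes k)" by (simp add: vtypes_def)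

lemma sum_vtypes: "(\<Sum>t\<in>vtypes k. tsign t * f t) = (\<Sum>m=0..k. f (1, m)) - (\<Sum>m=1..k. f (0, m))"
  unfolding vtypes_def
  by (subst sum.union_disjoint) (auto simp: sum.reindex inj_on_def tsign_def sum_negf)

lemma sum_PiE_insert:
  assumes "a \<notin> A"
  shows "(\<Sum>f\<in>PiE (insert a A) B. g f) = (\<Sum>b\<in>B a. \<Sum>f\<in>PiE A B. g (f(a := b)))"
proof -
  have "(\<Sum>f\<in>PiE (insert a A) B. g f) = (\<Sum>p\<in>B a \<times> PiE A B. g ((\<lambda>(y, h). h(a := y)) p))"
    unfolding PiE_insert_eq by (subst sum.reindex) (use assms in \<open>auto intro: inj_combinator\<close>)
  also have "\<dots> = (\<Sum>b\<in>B a. \<Sum>f\<in>PiE A B. g (f(a := b)))"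
    by (subst sum.cartesian_product) (auto intro: sum.cong)
  finally show ?thesis .
qed

text \<open>Splitting off the last vertex reproduces the recurrence of \<open>Stirling\<close>: type
  \<open>(1, 0)\<close> lengthens the rising factorial by one factor (a new block), while
  \<open>(1, m)\<close> and \<open>(0, m)\<close> together leave \<open>r\<close> times the old one
  (joining a block) and one more summation in \<open>bsum\<close>. \<open>\<Psi>\<close> and
  \<open>h\<close> are general so that they can absorb the shift by \<open>m\<close>.\<close>

lemma sum_vtypes_product:
  "(\<Sum>t\<in>PiE {1..j} (\<lambda>_. vtypes k). (\<Prod>v\<in>{1..j}. tsign (t v)) * (\<Psi> (\<Sum>v\<in>{1..j}. snd (t v)) *
       (\<Prod>i\<in>{1..j}. h (\<Sum>v\<in>{1..j}. snd (t v)) + real (\<Sum>v\<in>{i<..j}. fst (t v)))))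
   = (\<Sum>r\<le>j. real (Stirling j r) * bsum k (j - r) (\<lambda>y. \<Psi> y * pochhammer (h y) r))"
proof (induction j arbitrary: \<Psi> h)
  case 0
  then show ?case by simp
next
  case (Suc j)
  have ins: "{1..Suc j} = insert (Suc j) {1..j}" by auto
  let ?W = "\<lambda>j \<Psi> h t. (\<Prod>v\<in>{1..j}. tsign (t v)) * (\<Psi> (\<Sum>v\<in>{1..j}. snd (t v)) *
       (\<Prod>i\<in>{1..j}. h (\<Sum>v\<in>{1..j}. snd (t v)) + real (\<Sum>v\<in>{i<..j}. fst (t v))))"
  let ?V = "\<lambda>\<Psi> h. (\<Sum>r\<le>j. real (Stirling j r) * bsum k (j - r) (\<lambda>y. \<Psi> y * pochhammer (h y) r))"
  let ?\<Psi> = "\<lambda>m y. \<Psi> (m + y) * h (m + y)"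
  \<comment> \<open>The factor of index \<open>Suc j\<close> has an empty sum of first components
    and is \<open>h\<close> itself, absorbed into \<open>\<Psi>\<close>; each of the other factors
    grows by \<open>fst b\<close>.\<close>
  have W: "?W (Suc j) \<Psi> h (f(Suc j := b)) = tsign b * ?W j (?\<Psi> (snd b)) (\<lambda>y. h (snd b + y) + real (fst b)) f" for f b
  proof -
    have 1: "(\<Prod>v\<in>{1..Suc j}. tsign ((f(Suc j := b)) v)) = tsign b * (\<Prod>v\<in>{1..j}. tsign (f v))"
      unfolding ins by (subst prod.insert) (auto intro!: prod.cong)
    have 2: "(\<Sum>v\<in>{1..Suc j}. snd ((f(Suc j := b)) v)) = snd b + (\<Sum>v\<in>{1..j}. snd (f v))"
      unfolding ins by (subst sum.insert) (auto intro!: sum.cong)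
    have 3: "(\<Sum>v\<in>{i<..Suc j}. fst ((f(Suc j := b)) v)) = fst b + (\<Sum>v\<in>{i<..j}. fst (f v))" if "i \<in> {1..j}" for i
    proof -
      have "{i<..Suc j} = insert (Suc j) {i<..j}" using that by auto
      then show ?thesis using that by (auto intro!: sum.cong)
    qed
    have 4: "(\<Prod>i\<in>{1..Suc j}. h Y + real (\<Sum>v\<in>{i<..Suc j}. fst ((f(Suc j := b)) v)))
       = h Y * (\<Prod>i\<in>{1..j}. h Y + real (fst b) + real (\<Sum>v\<in>{i<..j}. fst (f v)))" for Y
      unfolding ins by (subst prod.insert) (use 3 in \<open>auto intro!: prod.cong\<close>)
    show ?thesis unfolding 1 2 4 by (simp add: mult_ac)
  qed
  have "(\<Sum>t\<in>PiE {1..Suc j} (\<lambda>_. vtypes k). ?W (Suc j) \<Psi> h t)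
     = (\<Sum>b\<in>vtypes k. \<Sum>f\<in>PiE {1..j} (\<lambda>_. vtypes k). ?W (Suc j) \<Psi> h (f(Suc j := b)))"
    unfolding ins by (rule sum_PiE_insert) auto
  also have "\<dots> = (\<Sum>b\<in>vtypes k. tsign b * ?V (?\<Psi> (snd b)) (\<lambda>y. h (snd b + y) + real (fst b)))"
    unfolding W by (subst Suc.IH[symmetric]) (simp only: sum_distrib_left)
  also have "\<dots> = (\<Sum>m=0..k. ?V (?\<Psi> m) (\<lambda>y. h (m + y) + 1)) - (\<Sum>m=1..k. ?V (?\<Psi> m) (\<lambda>y. h (m + y)))"
    by (subst sum_vtypes) simp
  also have "\<dots> = ?V (?\<Psi> 0) (\<lambda>y. h y + 1) + (\<Sum>m=1..k. ?V (?\<Psi> m) (\<lambda>y. h (m + y) + 1) - ?V (?\<Psi> m) (\<lambda>y. h (m + y)))"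
    by (simp add: sum.atLeast_Suc_atMost sum_subtractf)
  also have "?V (?\<Psi> 0) (\<lambda>y. h y + 1) = (\<Sum>r\<le>j. real (Stirling j r) * bsum k (j - r) (\<lambda>y. \<Psi> y * pochhammer (h y) (Suc r)))"
    by (simp add: pochhammer_rec mult.assoc)
  also have "(\<Sum>m=1..k. ?V (?\<Psi> m) (\<lambda>y. h (m + y) + 1) - ?V (?\<Psi> m) (\<lambda>y. h (m + y)))
     = (\<Sum>m=1..k. (\<Sum>r\<le>j. real (r * Stirling j r) * bsum k (j - r) (\<lambda>y. \<Psi> (m + y) * pochhammer (h (m + y)) r)))"
  proof (intro sum.cong refl)
    fix m
    \<comment> \<open>Both sides are \<open>x * pochhammer (x + 1) (r - 1)\<close> up to the
      difference of the outer factors \<open>x + r\<close> and \<open>x\<close>, for positive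
      \<open>r\<close>; at \<open>r = 0\<close> both vanish.\<close>
    have p: "x * pochhammer (x + 1) r - x * pochhammer x r = real r * pochhammer x r" for x :: real and r
      using pochhammer_rec[of x r] pochhammer_Suc[of x r] by (simp add: algebra_simps)
    have "bsum k (j - r) (\<lambda>y. ?\<Psi> m y * pochhammer (h (m + y) + 1) r) - bsum k (j - r) (\<lambda>y. ?\<Psi> m y * pochhammer (h (m + y)) r)
       = real r * bsum k (j - r) (\<lambda>y. \<Psi> (m + y) * pochhammer (h (m + y)) r)" for r
      unfolding bsum_diff[symmetric] bsum_cmult[symmetric]
    proof (rule arg_cong[where f = "bsum k (j - r)"], rule ext)
      fix y
      have "?\<Psi> m y * pochhammer (h (m + y) + 1) r - ?\<Psi> m y * pochhammer (h (m + y)) r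
        = \<Psi> (m + y) * (h (m + y) * pochhammer (h (m + y) + 1) r - h (m + y) * pochhammer (h (m + y)) r)"
        by (simp add: algebra_simps)
      then show "?\<Psi> m y * pochhammer (h (m + y) + 1) r - ?\<Psi> m y * pochhammer (h (m + y)) r
         = real r * (\<Psi> (m + y) * pochhammer (h (m + y)) r)" unfolding p by simp
    qed
    then show "?V (?\<Psi> m) (\<lambda>y. h (m + y) + 1) - ?V (?\<Psi> m) (\<lambda>y. h (m + y)) =
       (\<Sum>r\<le>j. real (r * Stirling j r) * bsum k (j - r) (\<lambda>y. \<Psi> (m + y) * pochhammer (h (m + y)) r))"
      unfolding sum_subtractf[symmetric] by (intro sum.cong refl) (simp add: right_diff_distrib[symmetric])
  qed
  also have "\<dots> = (\<Sum>r\<le>j. real (r * Stirling j r) * bsum k (Suc j - r) (\<lambda>y. \<Psi> y * pochhammer (h y) r))"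
    by (subst sum.swap) (auto simp: Suc_diff_le sum_distrib_left intro!: sum.cong)
  also have "\<dots> = (\<Sum>r\<le>Suc j. real (r * Stirling j r) * bsum k (Suc j - r) (\<lambda>y. \<Psi> y * pochhammer (h y) r))"
    by simp
  also have "\<dots> = (\<Sum>r\<le>j. real (Suc r * Stirling j (Suc r)) * bsum k (j - r) (\<lambda>y. \<Psi> y * pochhammer (h y) (Suc r)))"
    by (subst sum.atMost_Suc_shift) simp
  also have "(\<Sum>r\<le>j. real (Stirling j r) * bsum k (j - r) (\<lambda>y. \<Psi> y * pochhammer (h y) (Suc r))) + \<dots>
     = (\<Sum>r\<le>j. real (Stirling (Suc j) (Suc r)) * bsum k (j - r) (\<lambda>y. \<Psi> y * pochhammer (h y) (Suc r)))"
    unfolding sum.distrib[symmetric] by (intro sum.cong refl) (simp add: algebra_simps)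
  also have "\<dots> = (\<Sum>r\<le>Suc j. real (Stirling (Suc j) r) * bsum k (Suc j - r) (\<lambda>y. \<Psi> y * pochhammer (h y) r))"
    by (subst sum.atMost_Suc_shift) simp
  finally show ?case .
qed

text \<open>The bridge between the two counts: the signed sum on the left comes from trees, the sum
  over permutations on the right from colourings.\<close>

lemma sum_vtypes_eq_sum_rf:
  "(\<Sum>t\<in>PiE {1..j} (\<lambda>_. vtypes k). (\<Prod>v\<in>{1..j}. tsign (t v)) *
       (\<Prod>i\<in>{1..j}. X + real (\<Sum>v\<in>{1..j}. snd (t v)) + real (\<Sum>v\<in>{i<..j}. fst (t v))))
   = (\<Sum>xs\<in>permutations_of_set {1..j}. rf j (X + real k * real (asc xs)))"
  using sum_vtypes_product[where j = j and k = k and \<Psi> = "\<lambda>_. 1" and h = "\<lambda>y. X + real y"]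
  unfolding sum_rf_asc by simp

section \<open>Weighted rooted forests\<close>

text \<open>A rooted forest on \<open>S\<close> is encoded by its parent function; the value \<open>0\<close>, which is not in \<open>S\<close>, marks the roots.\<close>

definition prel :: "nat set \<Rightarrow> (nat \<Rightarrow> nat) \<Rightarrow> (nat \<times> nat) set" where
  "prel S p = {(p w, w) | w. w \<in> S \<and> p w \<noteq> 0}"

definition froots :: "nat set \<Rightarrow> (nat \<Rightarrow> nat) \<Rightarrow> nat set" where
  "froots S p = {w \<in> S. p w = 0}"

definition pforests :: "nat set \<Rightarrow> (nat \<Rightarrow> nat) set" where
  "pforests S = {p \<in> PiE S (\<lambda>_. insert 0 S). acyclic (prel S p)}"

definition fweight :: "(nat \<Rightarrow> nat \<Rightarrow> real) \<Rightarrow> nat set \<Rightarrow> (nat \<Rightarrow> nat) \<Rightarrow> real" where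
  "fweight wt S p = (\<Prod>w\<in>{w \<in> S. p w \<noteq> 0}. wt (p w) w)"

definition forest_sum :: "(nat \<Rightarrow> nat \<Rightarrow> real) \<Rightarrow> nat set \<Rightarrow> real \<Rightarrow> real" where
  "forest_sum wt S u = (\<Sum>p\<in>pforests S. u ^ card (froots S p) * fweight wt S p)"

lemma finite_pforests: "finite S \<Longrightarrow> finite (pforests S)"
  unfolding pforests_def by (auto intro!: finite_PiE)

lemma prel_subset:
  assumes "p \<in> PiE S (\<lambda>_. insert 0 S)" "0 \<notin> S" shows "prel S p \<subseteq> S \<times> S"
  using assms by (fastforce simp: prel_def PiE_def Pi_def)

lemma pforest_root_exists:
  assumes "finite S" "0 \<notin> S" "p \<in> pforests S" "q \<in> S"
  shows "\<exists>r\<in>froots S p. (r, q) \<in> (prel S p)\<^sup>*"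
proof -
  have sub: "prel S p \<subseteq> S \<times> S" using assms prel_subset by (auto simp: pforests_def)
  have "wf (prel S p)"
    using assms sub by (intro finite_acyclic_wf) (auto simp: pforests_def intro: finite_subset[of _ "S \<times> S"])
  then show ?thesis using assms(4)
  proof (induction q rule: wf_induct_rule)
    case (less q)
    show ?case
    proof (cases "p q = 0")
      case True
      then show ?thesis using less by (auto simp: froots_def)
    next
      case False
      then have e: "(p q, q) \<in> prel S p" using less by (auto simp: prel_def)
      then obtain r where "r \<in> froots S p" "(r, p q) \<in> (prel S p)\<^sup>*" using less sub by blast
      then show ?thesis using e by (meson rtrancl.rtrancl_into_rtrancl)
    qed
  qed
qed

lemma froots_no_pred: "r \<in> froots S p \<Longrightarrow> (x, r) \<in> (prel S p)\<^sup>* \<Longrightarrow> x = r"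
  by (erule rtranclE) (auto simp: froots_def prel_def)

text \<open>Parents are unique, so the ancestors of \<open>q\<close> form a chain, and a root has no
  ancestor besides itself.\<close>

lemma pforest_root_unique:
  assumes "r \<in> froots S p" "r' \<in> froots S p" "(r, q) \<in> (prel S p)\<^sup>*" "(r', q) \<in> (prel S p)\<^sup>*"
  shows "r = r'"
proof -
  have "single_valued ((prel S p)\<inverse>)" by (auto simp: single_valued_def prel_def)
  then have "(r, r') \<in> ((prel S p)\<inverse>)\<^sup>* \<or> (r', r) \<in> ((prel S p)\<inverse>)\<^sup>*"
    using assms(3,4) by (intro single_valued_confluent[of _ q]) (auto simp: rtrancl_converse)
  then show ?thesis using froots_no_pred assms by (auto simp: rtrancl_converse)
qed

lemma sum_Pow_binomial:
  fixes b u :: real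
  assumes "finite R"
  shows "(\<Sum>C\<in>Pow R. b ^ card C * u ^ (card R - card C)) = (u + b) ^ card R"
  using assms
proof (induction R)
  case (insert x R)
  have disj: "Pow R \<inter> insert x ` Pow R = {}" using insert by auto
  have inj: "inj_on (insert x) (Pow R)" using insert by (auto simp: inj_on_def)
  have cR: "C \<subseteq> R \<Longrightarrow> card C \<le> card R" "C \<subseteq> R \<Longrightarrow> card (insert x C) = Suc (card C)" for C
    using insert by (auto simp: card_mono card_insert_if finite_subset)
  have "(\<Sum>C\<in>Pow (insert x R). b ^ card C * u ^ (card (insert x R) - card C))
      = (\<Sum>C\<in>Pow R. b ^ card C * u ^ (card (insert x R) - card C))
        + (\<Sum>C\<in>Pow R. b ^ card (insert x C) * u ^ (card (insert x R) - card (insert x C)))"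
    unfolding Pow_insert using insert disj inj by (subst sum.union_disjoint) (auto simp: sum.reindex)
  also have "\<dots> = (\<Sum>C\<in>Pow R. u * (b ^ card C * u ^ (card R - card C)))
        + (\<Sum>C\<in>Pow R. b * (b ^ card C * u ^ (card R - card C)))"
    using insert cR by (intro arg_cong2[where f = "(+)"] sum.cong) (auto simp: Suc_diff_le)
  also have "\<dots> = (u + b) * (u + b) ^ card R"
    using insert by (simp add: sum_distrib_left[symmetric] algebra_simps)
  finally show ?case using insert by simp
qed simp

text \<open>Edges leaving the new vertex \<open>v\<close> close no cycle as long as nothing enters
  \<open>v\<close>. An edge from \<open>q\<close> into \<open>v\<close> closes one exactly when some
  child of \<open>v\<close> reaches \<open>q\<close>.\<close>

lemma acyclic_attach_iff:
  assumes r0: "r0 \<subseteq> S \<times> S" and C: "C \<subseteq> S" and v: "v \<notin> S" and q: "q \<noteq> v"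
  shows "acyclic (insert (q, v) (r0 \<union> {v} \<times> C)) \<longleftrightarrow> acyclic r0 \<and> (\<forall>r\<in>C. (r, q) \<notin> r0\<^sup>*)"
    and "acyclic (r0 \<union> {v} \<times> C) \<longleftrightarrow> acyclic r0"
proof -
  let ?r1 = "r0 \<union> {v} \<times> C"
  have sub: "?r1\<^sup>+ \<subseteq> r0\<^sup>+ \<union> {v} \<times> S"
  proof
    fix z assume "z \<in> ?r1\<^sup>+"
    then obtain x y where z: "z = (x, y)" "(x, y) \<in> ?r1\<^sup>+" by (cases z) auto
    from z(2) have "(x, y) \<in> r0\<^sup>+ \<union> {v} \<times> S"
    proof induction
      case (base y)
      then show ?case using C by auto
    next
      case (step y z)
      have "y \<in> S" using step(3) r0 trancl_subset_Sigma[OF r0] by auto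
      then have "(y, z) \<in> r0" using step(2) v by auto
      then show ?case using step(3) r0 by (auto intro: trancl_into_trancl)
    qed
    then show "z \<in> r0\<^sup>+ \<union> {v} \<times> S" using z by simp
  qed
  show ac: "acyclic ?r1 \<longleftrightarrow> acyclic r0"
  proof
    assume "acyclic ?r1" then show "acyclic r0" by (rule acyclic_subset) auto
  next
    assume "acyclic r0" then show "acyclic ?r1" using sub v unfolding acyclic_def by blast
  qed
  have reach: "(v, q) \<in> ?r1\<^sup>* \<longleftrightarrow> (\<exists>r\<in>C. (r, q) \<in> r0\<^sup>*)"
  proof
    assume "(v, q) \<in> ?r1\<^sup>*"
    then have "q = v \<or> (\<exists>r\<in>C. (r, q) \<in> r0\<^sup>*)"
    proof induction
      case (step y z)
      show ?case
      proof (cases "(y, z) \<in> r0")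
        case True
        then have "y \<noteq> v" using r0 v by auto
        then show ?thesis using step True by (meson rtrancl.rtrancl_into_rtrancl)
      next
        case False
        then show ?thesis using step by auto
      qed
    qed simp
    then show "\<exists>r\<in>C. (r, q) \<in> r0\<^sup>*" using q by simp
  next
    assume "\<exists>r\<in>C. (r, q) \<in> r0\<^sup>*"
    then obtain r where r: "r \<in> C" "(r, q) \<in> r0\<^sup>*" by auto
    have "(r, q) \<in> ?r1\<^sup>*" using r(2) rtrancl_mono[of r0 ?r1] by auto
    then show "(v, q) \<in> ?r1\<^sup>*" using r(1) by (meson SigmaI UnI2 converse_rtrancl_into_rtrancl singletonI)
  qed
  show "acyclic (insert (q, v) ?r1) \<longleftrightarrow> acyclic r0 \<and> (\<forall>r\<in>C. (r, q) \<notin> r0\<^sup>*)"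
    unfolding acyclic_insert ac reach by blast
qed

text \<open>Deleting \<open>v\<close> leaves a forest \<open>p\<close>. The children of \<open>v\<close> are a set \<open>C\<close> of roots of \<open>p\<close>, and the parent of
  \<open>v\<close> is \<open>0\<close> or any vertex of a tree of \<open>p\<close> whose root is not in \<open>C\<close>.\<close>

lemma forest_sum_insert:
  assumes fin: "finite S" and v: "v \<notin> S" and z: "0 \<notin> insert v S"
    and b: "\<And>w. w \<in> S \<Longrightarrow> wt v w = b"
  shows "forest_sum wt (insert v S) u * (u + b) = u * (u + b + (\<Sum>q\<in>S. wt q v)) * forest_sum wt S (u + b)"
proof -
  define Q where "Q = (\<lambda>p C. insert 0 {q \<in> S. \<forall>r\<in>C. (r, q) \<notin> (prel S p)\<^sup>*})"
  define I where "I = Sigma (pforests S) (\<lambda>p. Sigma (Pow (froots S p)) (Q p))"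
  define ext where "ext = (\<lambda>(p, C, q). \<lambda>w. if w = v then q else if w \<in> C then v else (p :: nat \<Rightarrow> nat) w)"
  define red where "red = (\<lambda>p. (restrict (\<lambda>w. if p w = v then 0 else p w) S, {w \<in> S. p w = v}, p v))"
  have v0: "v \<noteq> 0" and zS: "0 \<notin> S" using z by auto
  have prel_ext: "prel (insert v S) (ext (p, C, q)) =
      (if q = 0 then prel S p \<union> {v} \<times> C else insert (q, v) (prel S p \<union> {v} \<times> C))"
    if "C \<subseteq> froots S p" for p C q
  proof (rule set_eqI, clarify)
    fix x w
    have "w \<in> C \<Longrightarrow> w \<in> S \<and> p w = 0" using that by (auto simp: froots_def)
    then show "(x, w) \<in> prel (insert v S) (ext (p, C, q)) \<longleftrightarrow>
        (x, w) \<in> (if q = 0 then prel S p \<union> {v} \<times> C else insert (q, v) (prel S p \<union> {v} \<times> C))"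
      using v v0 by (cases "w = v"; cases "w \<in> C") (auto simp: prel_def ext_def)
  qed
  have in_ext: "ext (p, C, q) \<in> pforests (insert v S)"
    if p: "p \<in> pforests S" and C: "C \<subseteq> froots S p" and q: "q \<in> Q p C" for p C q
  proof -
    have CS: "C \<subseteq> S" using C by (auto simp: froots_def)
    have pS: "p \<in> PiE S (\<lambda>_. insert 0 S)" "acyclic (prel S p)" using p by (auto simp: pforests_def)
    have qv: "q \<noteq> v" using q v v0 by (auto simp: Q_def)
    have "acyclic (prel (insert v S) (ext (p, C, q)))"
      unfolding prel_ext[OF C] using acyclic_attach_iff[OF prel_subset[OF pS(1) zS] CS v qv] pS q
      by (auto simp: Q_def)
    moreover have "ext (p, C, q) \<in> PiE (insert v S) (\<lambda>_. insert 0 (insert v S))"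
    proof (rule PiE_I)
      fix w assume "w \<in> insert v S"
      then show "ext (p, C, q) w \<in> insert 0 (insert v S)" using PiE_mem[OF pS(1), of w] q by (auto simp: ext_def Q_def)
    next
      fix w assume "w \<notin> insert v S"
      then show "ext (p, C, q) w = undefined" using pS(1) CS by (auto simp: ext_def PiE_def extensional_def)
    qed
    ultimately show ?thesis by (simp add: pforests_def)
  qed
  have bij: "bij_betw ext I (pforests (insert v S))"
  proof (rule bij_betw_byWitness[where f' = red])
    show "\<forall>a\<in>I. red (ext a) = a"
    proof
      fix a assume a: "a \<in> I"
      obtain p C q where a': "a = (p, C, q)" by (cases a) auto
      have p: "p \<in> pforests S" and C: "C \<subseteq> froots S p" and q: "q \<in> Q p C" using a a' by (auto simp: I_def)
      have C0: "w \<in> C \<Longrightarrow> w \<in> S \<and> p w = 0" for w using C by (auto simp: froots_def)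
      have pv: "w \<in> S \<Longrightarrow> p w \<noteq> v" for w using p PiE_mem[of p S "\<lambda>_. insert 0 S" w] v v0 by (auto simp: pforests_def)
      have px: "w \<notin> S \<Longrightarrow> p w = undefined" for w using p by (auto simp: pforests_def PiE_def extensional_def)
      have "restrict (\<lambda>w. if ext (p, C, q) w = v then 0 else ext (p, C, q) w) S = p"
        using C0 pv px v by (auto simp: ext_def restrict_def fun_eq_iff)
      moreover have "{w \<in> S. ext (p, C, q) w = v} = C" using C0 pv v by (auto simp: ext_def)
      moreover have "ext (p, C, q) v = q" by (simp add: ext_def)
      ultimately show "red (ext a) = a" using a' by (simp add: red_def)
    qed
    have red_prop: "red p \<in> I \<and> ext (red p) = p" if p: "p \<in> pforests (insert v S)" for p
    proof -
      define p' where "p' = restrict (\<lambda>w. if p w = v then 0 else p w) S"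
      define C where "C = {w \<in> S. p w = v}"
      have pE: "p \<in> PiE (insert v S) (\<lambda>_. insert 0 (insert v S))" "acyclic (prel (insert v S) p)"
        using p by (auto simp: pforests_def)
      have ex: "ext (p', C, p v) = p"
        using pE v by (auto simp: ext_def p'_def C_def fun_eq_iff restrict_def PiE_def extensional_def)
      have CR: "C \<subseteq> froots S p'" using v0 by (auto simp: C_def froots_def p'_def)
      have CS: "C \<subseteq> S" by (auto simp: C_def)
      have p'E: "p' \<in> PiE S (\<lambda>_. insert 0 S)"
      proof (rule PiE_I)
        fix w assume "w \<in> S"
        then show "p' w \<in> insert 0 S" using PiE_mem[OF pE(1), of w] by (auto simp: p'_def)
      qed (auto simp: p'_def)
      have qv: "p v \<noteq> v"
      proof
        assume "p v = v"
        then have "(v, v) \<in> prel (insert v S) p" using v0 by (force simp: prel_def)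
        then show False using pE(2) by (auto simp: acyclic_def)
      qed
      have "acyclic (if p v = 0 then prel S p' \<union> {v} \<times> C else insert (p v, v) (prel S p' \<union> {v} \<times> C))"
        using prel_ext[OF CR, of "p v"] pE(2) ex by simp
      then have "acyclic (prel S p')" "p v \<noteq> 0 \<Longrightarrow> \<forall>r\<in>C. (r, p v) \<notin> (prel S p')\<^sup>*"
        using acyclic_attach_iff[OF prel_subset[OF p'E zS] CS v qv] by (auto split: if_splits)
      moreover have "p v \<in> insert 0 S" using PiE_mem[OF pE(1), of v] qv by auto
      ultimately have "p' \<in> pforests S" "p v \<in> Q p' C" using p'E by (auto simp: pforests_def Q_def)
      then have "(p', C, p v) \<in> I" using CR by (auto simp: I_def)
      then show ?thesis using ex unfolding red_def p'_def C_def by auto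
    qed
    show "\<forall>a'\<in>pforests (insert v S). ext (red a') = a'" "red ` pforests (insert v S) \<subseteq> I"
      using red_prop by auto
    show "ext ` I \<subseteq> pforests (insert v S)" using in_ext by (auto simp: I_def)
  qed
  have wt_ext: "u ^ card (froots (insert v S) (ext (p, C, q))) * fweight wt (insert v S) (ext (p, C, q))
     = (if q = 0 then u else wt q v) * (b ^ card C * u ^ (card (froots S p) - card C)) * fweight wt S p"
    if p: "p \<in> pforests S" and C: "C \<subseteq> froots S p" and q: "q \<in> Q p C" for p C q
  proof -
    have C0: "w \<in> C \<Longrightarrow> w \<in> S \<and> p w = 0" for w using C by (auto simp: froots_def)
    have finR: "finite (froots S p)" using fin by (auto simp: froots_def)
    have finC: "finite C" using C finR finite_subset by auto
    have R: "froots (insert v S) (ext (p, C, q)) = (if q = 0 then insert v (froots S p - C) else froots S p - C)"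
      using C0 v v0 by (auto simp: froots_def ext_def)
    have vR: "v \<notin> froots S p" using v by (auto simp: froots_def)
    have cR: "card (froots (insert v S) (ext (p, C, q))) = (if q = 0 then 1 else 0) + (card (froots S p) - card C)"
      unfolding R using finR C vR by (auto simp: card_Diff_subset finC)
    have N: "{w \<in> insert v S. ext (p, C, q) w \<noteq> 0} = (if q = 0 then {} else {v}) \<union> (C \<union> {w \<in> S. p w \<noteq> 0})"
      using C0 v v0 by (auto simp: ext_def)
    have "fweight wt (insert v S) (ext (p, C, q)) = (\<Prod>w\<in>(if q = 0 then {} else {v}). wt (ext (p, C, q) w) w)
        * ((\<Prod>w\<in>C. wt (ext (p, C, q) w) w) * (\<Prod>w\<in>{w \<in> S. p w \<noteq> 0}. wt (ext (p, C, q) w) w))"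
    proof -
      have d1: "(if q = 0 then {} else {v}) \<inter> (C \<union> {w \<in> S. p w \<noteq> 0}) = {}" using C0 v by auto
      have d2: "C \<inter> {w \<in> S. p w \<noteq> 0} = {}" using C0 by auto
      have f: "finite (if q = 0 then {} else {v})" "finite {w \<in> S. p w \<noteq> 0}" using fin by auto
      show ?thesis unfolding fweight_def N
        unfolding prod.union_disjoint[OF f(1) finite_UnI[OF finC f(2)] d1] prod.union_disjoint[OF finC f(2) d2] ..
    qed
    also have "(\<Prod>w\<in>C. wt (ext (p, C, q) w) w) = (\<Prod>w\<in>C. b)"
      using C0 v b by (intro prod.cong) (auto simp: ext_def)
    also have "(\<Prod>w\<in>{w \<in> S. p w \<noteq> 0}. wt (ext (p, C, q) w) w) = fweight wt S p"
      unfolding fweight_def using C0 v by (intro prod.cong) (auto simp: ext_def)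
    finally show ?thesis unfolding cR by (auto simp: ext_def)
  qed
  \<comment> \<open>If \<open>v\<close> is a root, all subsets \<open>C\<close> of the roots are
    allowed. If \<open>v\<close> has a parent \<open>q\<close>, exactly the root of the tree of
    \<open>q\<close> must stay outside \<open>C\<close>, which costs one factor
    \<open>u + b\<close>; multiplying the whole identity by \<open>u + b\<close> restores it and
    avoids a division.\<close>
  have inner: "(\<Sum>C\<in>Pow (froots S p). \<Sum>q\<in>Q p C. (if q = 0 then u else wt q v) * (b ^ card C * u ^ (card (froots S p) - card C)))
      * (u + b) = u * (u + b + (\<Sum>q\<in>S. wt q v)) * (u + b) ^ card (froots S p)" if p: "p \<in> pforests S" for p
  proof -
    let ?R = "froots S p"
    let ?x = "\<lambda>C. b ^ card C * u ^ (card ?R - card C)"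
    have finR: "finite ?R" using fin by (auto simp: froots_def)
    let ?P = "\<lambda>q C. \<forall>r\<in>C. (r, q) \<notin> (prel S p)\<^sup>*"
    have "(\<Sum>q\<in>Q p C. (if q = 0 then u else wt q v) * ?x C) = u * ?x C + (\<Sum>q\<in>S. if ?P q C then wt q v * ?x C else 0)" for C
    proof -
      have "(\<Sum>q\<in>Q p C. (if q = 0 then u else wt q v) * ?x C) = u * ?x C + (\<Sum>q\<in>{q \<in> S. ?P q C}. (if q = 0 then u else wt q v) * ?x C)"
        unfolding Q_def using fin zS by (subst sum.insert) auto
      also have "(\<Sum>q\<in>{q \<in> S. ?P q C}. (if q = 0 then u else wt q v) * ?x C) = (\<Sum>q\<in>{q \<in> S. ?P q C}. wt q v * ?x C)"
        using zS by (intro sum.cong) auto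
      finally show ?thesis using fin by (simp add: sum.inter_filter)
    qed
    then have "(\<Sum>C\<in>Pow ?R. \<Sum>q\<in>Q p C. (if q = 0 then u else wt q v) * ?x C)
       = u * (u + b) ^ card ?R + (\<Sum>C\<in>Pow ?R. \<Sum>q\<in>S. if ?P q C then wt q v * ?x C else 0)"
      by (simp add: sum.distrib sum_distrib_left[symmetric] sum_Pow_binomial[OF finR])
    also have "(\<Sum>C\<in>Pow ?R. \<Sum>q\<in>S. if ?P q C then wt q v * ?x C else 0)
       = (\<Sum>q\<in>S. wt q v * (\<Sum>C\<in>{C \<in> Pow ?R. ?P q C}. ?x C))"
    proof (subst sum.swap, intro sum.cong refl)
      fix q
      have "(\<Sum>C\<in>Pow ?R. if ?P q C then wt q v * ?x C else 0) = (\<Sum>C\<in>{C \<in> Pow ?R. ?P q C}. wt q v * ?x C)"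
        by (rule sum.inter_filter[symmetric]) (use finR in simp)
      then show "(\<Sum>C\<in>Pow ?R. if ?P q C then wt q v * ?x C else 0) = wt q v * (\<Sum>C\<in>{C \<in> Pow ?R. ?P q C}. ?x C)"
        by (simp only: sum_distrib_left)
    qed
    also have "\<dots> = (\<Sum>q\<in>S. wt q v * (u * (u + b) ^ (card ?R - 1)))"
    proof (intro sum.cong refl)
      fix q assume q: "q \<in> S"
      obtain r where r: "r \<in> ?R" "(r, q) \<in> (prel S p)\<^sup>*" using pforest_root_exists[OF fin zS p q] by auto
      have "{C \<in> Pow ?R. ?P q C} = Pow (?R - {r})"
      proof -
        have "(r', q) \<notin> (prel S p)\<^sup>*" if "r' \<in> ?R" "r' \<noteq> r" for r'
          using that pforest_root_unique[OF that(1) r(1) _ r(2)] by blast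
        then show ?thesis using r by blast
      qed
      moreover have "(\<Sum>C\<in>Pow (?R - {r}). ?x C) = (\<Sum>C\<in>Pow (?R - {r}). u * (b ^ card C * u ^ (card (?R - {r}) - card C)))"
      proof (intro sum.cong refl)
        fix C assume C: "C \<in> Pow (?R - {r})"
        have "card C \<le> card (?R - {r})" using C finR by (intro card_mono) auto
        moreover have "card ?R = Suc (card (?R - {r}))" using card_Suc_Diff1[OF finR r(1)] by simp
        ultimately show "?x C = u * (b ^ card C * u ^ (card (?R - {r}) - card C))" by (simp add: Suc_diff_le)
      qed
      ultimately have "(\<Sum>C\<in>{C \<in> Pow ?R. ?P q C}. ?x C) = u * (u + b) ^ card (?R - {r})"
        using finR by (simp only: sum_distrib_left[symmetric]) (subst sum_Pow_binomial, auto)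
      then show "wt q v * (\<Sum>C\<in>{C \<in> Pow ?R. ?P q C}. ?x C) = wt q v * (u * (u + b) ^ (card ?R - 1))"
        using r finR by simp
    qed
    finally have *: "(\<Sum>C\<in>Pow ?R. \<Sum>q\<in>Q p C. (if q = 0 then u else wt q v) * ?x C)
       = u * (u + b) ^ card ?R + (\<Sum>q\<in>S. wt q v * (u * (u + b) ^ (card ?R - 1)))" .
    \<comment> \<open>For empty \<open>S\<close> there are no roots and \<open>card ?R - 1\<close>
      is truncated to 0, but then the sum over \<open>q\<close> is empty.\<close>
    have eq2: "(\<Sum>q\<in>S. wt q v * (u * (u + b) ^ (card ?R - 1))) * (u + b) = (\<Sum>q\<in>S. wt q v) * u * (u + b) ^ card ?R"
    proof (cases "S = {}")
      case False
      then obtain q where "q \<in> S" by auto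
      then obtain r where "r \<in> ?R" using pforest_root_exists[OF fin zS p] by auto
      then have "card ?R = Suc (card ?R - 1)" using finR by (metis Suc_diff_1 card_gt_0_iff empty_iff)
      then have "(u + b) ^ card ?R = (u + b) ^ (card ?R - 1) * (u + b)" by (metis power_Suc2)
      then show ?thesis unfolding sum_distrib_right by (intro sum.cong refl) (simp only: mult.assoc)
    qed simp
    show ?thesis unfolding * distrib_right[of _ _ "u + b"] eq2 by (simp add: algebra_simps)
  qed
  have finI: "finite (Pow (froots S p))" "finite (Q p C)" for p C
    using fin by (auto simp: froots_def Q_def)
  have "forest_sum wt (insert v S) u = (\<Sum>a\<in>I. u ^ card (froots (insert v S) (ext a)) * fweight wt (insert v S) (ext a))"
    unfolding forest_sum_def by (rule sum.reindex_bij_betw[OF bij, symmetric])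
  also have "\<dots> = (\<Sum>p\<in>pforests S. \<Sum>C\<in>Pow (froots S p). \<Sum>q\<in>Q p C.
        u ^ card (froots (insert v S) (ext (p, C, q))) * fweight wt (insert v S) (ext (p, C, q)))"
  proof -
    let ?g = "\<lambda>p C q. u ^ card (froots (insert v S) (ext (p, C, q))) * fweight wt (insert v S) (ext (p, C, q))"
    have "(\<Sum>p\<in>pforests S. \<Sum>C\<in>Pow (froots S p). \<Sum>q\<in>Q p C. ?g p C q)
       = (\<Sum>p\<in>pforests S. \<Sum>(C, q)\<in>Sigma (Pow (froots S p)) (Q p). ?g p C q)"
      by (intro sum.cong refl sum.Sigma) (use finI in auto)
    also have "\<dots> = (\<Sum>(p, C, q)\<in>I. ?g p C q)"
      unfolding I_def by (subst sum.Sigma) (use finI finite_pforests[OF fin] in \<open>auto simp: split_def intro!: finite_SigmaI\<close>)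
    finally show ?thesis by (simp add: split_def)
  qed
  also have "\<dots> = (\<Sum>p\<in>pforests S. \<Sum>C\<in>Pow (froots S p). \<Sum>q\<in>Q p C.
        (if q = 0 then u else wt q v) * (b ^ card C * u ^ (card (froots S p) - card C)) * fweight wt S p)"
    by (intro sum.cong refl wt_ext) auto
  also have "\<dots> = (\<Sum>p\<in>pforests S. (\<Sum>C\<in>Pow (froots S p). \<Sum>q\<in>Q p C.
        (if q = 0 then u else wt q v) * (b ^ card C * u ^ (card (froots S p) - card C))) * fweight wt S p)"
    by (simp only: sum_distrib_right)
  finally have "forest_sum wt (insert v S) u * (u + b) = (\<Sum>p\<in>pforests S. (\<Sum>C\<in>Pow (froots S p). \<Sum>q\<in>Q p C.
        (if q = 0 then u else wt q v) * (b ^ card C * u ^ (card (froots S p) - card C))) * fweight wt S p * (u + b))"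
    by (simp only: sum_distrib_right[symmetric])
  also have "\<dots> = (\<Sum>p\<in>pforests S. u * (u + b + (\<Sum>q\<in>S. wt q v)) * ((u + b) ^ card (froots S p) * fweight wt S p))"
  proof (intro sum.cong refl)
    have sw: "X * f * U = A * (B * f)" if "X * U = A * B" for X U A B f :: real
      using that by (metis mult.assoc mult.commute)
    fix p assume "p \<in> pforests S"
    from sw[OF inner[OF this]]
    show "(\<Sum>C\<in>Pow (froots S p). \<Sum>q\<in>Q p C. (if q = 0 then u else wt q v) * (b ^ card C * u ^ (card (froots S p) - card C))) * fweight wt S p * (u + b)
       = u * (u + b + (\<Sum>q\<in>S. wt q v)) * ((u + b) ^ card (froots S p) * fweight wt S p)" .
  qed
  finally show ?thesis by (simp add: forest_sum_def sum_distrib_left)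
qed

text \<open>All children of the smallest vertex \<open>i\<close> are larger, hence have the common
  weight \<open>b i\<close>; removing it turns \<open>u\<close> into \<open>u + b i\<close> and
  contributes one factor. Positivity of \<open>u\<close> with \<open>b\<close> nonnegative permits
  cancelling \<open>u + b i\<close>.\<close>

lemma forest_sum_interval:
  fixes a b :: "nat \<Rightarrow> real"
  assumes b: "\<And>j. 0 \<le> b j" and i: "1 \<le> i" "i \<le> n" and u: "0 < u"
  shows "forest_sum (\<lambda>v w. if v < w then b v else a v) {i..n} u
     = u * (\<Prod>k\<in>{i..<n}. u + (\<Sum>j\<in>{i..k}. b j) + (\<Sum>j\<in>{k<..n}. a j))"
  using i(2,1) u
proof (induction i arbitrary: u rule: inc_induct)
  case base
  have 0: "forest_sum (\<lambda>v w. if v < w then b v else a v) {} U = 1" for U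
    by (simp add: forest_sum_def pforests_def prel_def froots_def fweight_def acyclic_def)
  have "forest_sum (\<lambda>v w. if v < w then b v else a v) (insert n {}) u * (u + b n) = u * (u + b n)"
    by (subst forest_sum_insert[where b = "b n"]) (use base 0 in auto)
  moreover have "u + b n \<noteq> 0" using base b[of n] by linarith
  ultimately show ?case by simp
next
  case (step i)
  let ?wt = "\<lambda>v w. if v < w then b v else a v"
  have ins: "{i..n} = insert i {Suc i..n}" using step by auto
  have pos: "0 < u + b i" using step b[of i] by linarith
  have "forest_sum ?wt {i..n} u * (u + b i)
    = u * (u + b i + (\<Sum>q\<in>{Suc i..n}. ?wt q i)) * forest_sum ?wt {Suc i..n} (u + b i)"
    unfolding ins by (rule forest_sum_insert) (use step in auto)
  also have "(\<Sum>q\<in>{Suc i..n}. ?wt q i) = (\<Sum>j\<in>{i<..n}. a j)"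
    by (intro sum.cong) auto
  also have "forest_sum ?wt {Suc i..n} (u + b i)
    = (u + b i) * (\<Prod>k\<in>{Suc i..<n}. u + b i + (\<Sum>j\<in>{Suc i..k}. b j) + (\<Sum>j\<in>{k<..n}. a j))"
    using step pos by simp
  also have "(\<Prod>k\<in>{Suc i..<n}. u + b i + (\<Sum>j\<in>{Suc i..k}. b j) + (\<Sum>j\<in>{k<..n}. a j))
    = (\<Prod>k\<in>{Suc i..<n}. u + (\<Sum>j\<in>{i..k}. b j) + (\<Sum>j\<in>{k<..n}. a j))"
    by (intro prod.cong refl) (auto simp: sum.atLeast_Suc_atMost[of i])
  finally have "forest_sum ?wt {i..n} u * (u + b i) = u * (u + b i + (\<Sum>j\<in>{i<..n}. a j)) *
    (\<Prod>k\<in>{Suc i..<n}. u + (\<Sum>j\<in>{i..k}. b j) + (\<Sum>j\<in>{k<..n}. a j)) * (u + b i)"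
    by (simp only: mult_ac)
  then have "forest_sum ?wt {i..n} u = u * (u + b i + (\<Sum>j\<in>{i<..n}. a j)) *
    (\<Prod>k\<in>{Suc i..<n}. u + (\<Sum>j\<in>{i..k}. b j) + (\<Sum>j\<in>{k<..n}. a j))"
    using pos by simp
  also have "\<dots> = u * (\<Prod>k\<in>{i..<n}. u + (\<Sum>j\<in>{i..k}. b j) + (\<Sum>j\<in>{k<..n}. a j))"
    using step by (subst (2) prod.atLeast_Suc_lessThan) auto
  finally show ?case .
qed

definition ptrees :: "nat \<Rightarrow> (nat \<Rightarrow> nat) set" where
  "ptrees n = {p \<in> pforests {1..n}. card (froots {1..n} p) = 1}"

text \<open>Trees are extracted from forests as the coefficient of \<open>u\<close>, by dividing by \<open>u\<close> and letting \<open>u\<close> tend to \<open>0\<close>.\<close>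

lemma tree_sum:
  fixes a b :: "nat \<Rightarrow> real"
  assumes b: "\<And>j. 0 \<le> b j" and n: "1 \<le> n"
  shows "(\<Sum>p\<in>ptrees n. fweight (\<lambda>v w. if v < w then b v else a v) {1..n} p)
     = (\<Prod>k\<in>{1..<n}. (\<Sum>j\<in>{1..k}. b j) + (\<Sum>j\<in>{k<..n}. a j))"
proof -
  let ?wt = "\<lambda>v w. if v < w then b v else a v"
  define L where "L = (\<lambda>u. \<Sum>p\<in>pforests {1..n}. u ^ (card (froots {1..n} p) - 1) * fweight ?wt {1..n} p)"
  define R where "R = (\<lambda>u. \<Prod>k\<in>{1..<n}. u + (\<Sum>j\<in>{1..k}. b j) + (\<Sum>j\<in>{k<..n}. a j))"
  have card: "card (froots {1..n} p) \<ge> 1" if "p \<in> pforests {1..n}" for p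
  proof -
    have "\<exists>r\<in>froots {1..n} p. (r, n) \<in> (prel {1..n} p)\<^sup>*"
      by (rule pforest_root_exists[OF _ _ that]) (use n in auto)
    then obtain r where "r \<in> froots {1..n} p" by auto
    moreover have "finite (froots {1..n} p)" by (auto simp: froots_def)
    ultimately show ?thesis by (metis One_nat_def Suc_leI card_gt_0_iff empty_iff)
  qed
  have eq: "L u = R u" if u: "0 < u" for u
  proof -
    have "u * L u = forest_sum ?wt {1..n} u"
      unfolding L_def forest_sum_def sum_distrib_left
    proof (intro sum.cong refl)
      fix p assume "p \<in> pforests {1..n}"
      from card[OF this] obtain m where "card (froots {1..n} p) = Suc m" by (cases "card (froots {1..n} p)") auto
      then show "u * (u ^ (card (froots {1..n} p) - 1) * fweight ?wt {1..n} p) = u ^ card (froots {1..n} p) * fweight ?wt {1..n} p"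
        by simp
    qed
    also have "\<dots> = u * R u" unfolding R_def by (rule forest_sum_interval) (use b n u in auto)
    finally show ?thesis using u by simp
  qed
  have "continuous (at 0) L" unfolding L_def by (intro continuous_intros)
  then have 1: "(L \<longlongrightarrow> L 0) (at_right 0)" by (simp add: isCont_def filterlim_at_split)
  have "continuous (at 0) R" unfolding R_def by (intro continuous_intros)
  then have 2: "(R \<longlongrightarrow> R 0) (at_right 0)" by (simp add: isCont_def filterlim_at_split)
  have "(L \<longlongrightarrow> R 0) (at_right 0)"
    by (rule Lim_transform_eventually[OF 2]) (use eq in \<open>auto simp: eventually_at_filter\<close>)
  then have "L 0 = R 0" using 1 by (intro tendsto_unique[of "at_right (0::real)"]) auto
  moreover have "L 0 = (\<Sum>p\<in>ptrees n. fweight ?wt {1..n} p)"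
  proof -
    have "L 0 = (\<Sum>p\<in>pforests {1..n}. if card (froots {1..n} p) = 1 then fweight ?wt {1..n} p else 0)"
      unfolding L_def using card by (intro sum.cong refl) (force simp: power_0_left)
    then show ?thesis by (simp only: ptrees_def sum.inter_filter[OF finite_pforests[OF finite_atLeastAtMost]])
  qed
  ultimately show ?thesis by (simp add: R_def)
qed

section \<open>Decreasing trees\<close>

text \<open>The root has no incoming edge; fixing its colour to 0 makes the encoding of a tree by
  parents and colours unique.\<close>

definition pcols :: "nat \<Rightarrow> nat \<Rightarrow> (nat \<Rightarrow> nat) \<Rightarrow> (nat \<Rightarrow> nat) set" where
  "pcols n K p = PiE {1..n} (\<lambda>w. if p w = 0 then {0} else {1..K})"

definition tree_of :: "nat \<Rightarrow> (nat \<Rightarrow> nat) \<times> (nat \<Rightarrow> nat) \<Rightarrow> (nat \<times> nat \<times> nat) set" where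
  "tree_of n = (\<lambda>(p, c). (\<lambda>w. (p w, w, c w)) ` {w \<in> {1..n}. p w \<noteq> 0})"

lemma mem_tree_of [simp]:
  "(u, w, k) \<in> tree_of n (p, c) \<longleftrightarrow> w \<in> {1..n} \<and> u \<noteq> 0 \<and> p w = u \<and> c w = k"
  by (auto simp: tree_of_def)

lemma prel_tree_of: "{(u, w). \<exists>k. (u, w, k) \<in> tree_of n (p, c)} = prel {1..n} p"
  by (auto simp: prel_def)

lemma card_tree_of: "card (tree_of n (p, c)) = n - card (froots {1..n} p)"
proof -
  have "card (tree_of n (p, c)) = card {w \<in> {1..n}. p w \<noteq> 0}"
    unfolding tree_of_def prod.case by (rule card_image) (auto simp: inj_on_def)
  also have "{w \<in> {1..n}. p w \<noteq> 0} = {1..n} - froots {1..n} p" by (auto simp: froots_def)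
  also have "card \<dots> = n - card (froots {1..n} p)"
    by (subst card_Diff_subset) (auto simp: froots_def)
  finally show ?thesis .
qed

lemma bij_betw_tree_of:
  assumes n: "1 \<le> n"
  shows "bij_betw (tree_of n) (Sigma (ptrees n) (pcols n K)) {T. colored_rooted_tree n K T}"
  unfolding bij_betw_def
proof
  show "inj_on (tree_of n) (Sigma (ptrees n) (pcols n K))"
  proof (rule inj_onI, clarify)
    fix p c p' c'
    assume p: "p \<in> ptrees n" "p' \<in> ptrees n" and c: "c \<in> pcols n K p" "c' \<in> pcols n K p'"
      and eq: "tree_of n (p, c) = tree_of n (p', c')"
    have k: "w \<in> {1..n} \<and> u \<noteq> 0 \<and> p w = u \<and> c w = k \<longleftrightarrow> w \<in> {1..n} \<and> u \<noteq> 0 \<and> p' w = u \<and> c' w = k" for u w k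
      unfolding mem_tree_of[symmetric] eq ..
    have und: "p w = undefined" "p' w = undefined" "c w = undefined" "c' w = undefined" if "w \<notin> {1..n}" for w
      using p c that by (auto simp: ptrees_def pforests_def pcols_def PiE_def extensional_def)
    have pp: "p w = p' w" if "w \<in> {1..n}" for w
      using k[of w "p w" "c w"] k[of w "p' w" "c' w"] that by (cases "p w = 0"; cases "p' w = 0") auto
    then have ppe: "p = p'" using und by (intro ext) metis
    have "c w = c' w" if "w \<in> {1..n}" for w
    proof (cases "p w = 0")
      case True
      then show ?thesis using PiE_mem[OF c(1)[unfolded pcols_def] that] PiE_mem[OF c(2)[unfolded pcols_def] that] ppe by auto
    next
      case False
      then show ?thesis using k[of w "p w" "c w"] that by auto
    qed
    then have "c = c'" using und by (intro ext) metis
    then show "p = p' \<and> c = c'" using ppe by simp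
  qed
  show "tree_of n ` Sigma (ptrees n) (pcols n K) = {T. colored_rooted_tree n K T}"
  proof (intro equalityI subsetI)
    fix T assume "T \<in> tree_of n ` Sigma (ptrees n) (pcols n K)"
    then obtain p c where p: "p \<in> ptrees n" and c: "c \<in> pcols n K p" and T: "T = tree_of n (p, c)" by auto
    have ac: "acyclic (prel {1..n} p)" and r: "card (froots {1..n} p) = 1" and pE: "p \<in> PiE {1..n} (\<lambda>_. insert 0 {1..n})"
      using p by (auto simp: ptrees_def pforests_def)
    have ne: "p w \<noteq> w" if "w \<in> {1..n}" for w
    proof
      assume "p w = w"
      then have "(w, w) \<in> prel {1..n} p" using that by (auto simp: prel_def)
      then show False using ac by (auto simp: acyclic_def)
    qed
    have "colored_rooted_tree n K T"
      unfolding colored_rooted_tree_def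
    proof (intro conjI)
      show "T \<subseteq> {(u, w, c). u \<in> {1..n} \<and> w \<in> {1..n} \<and> u \<noteq> w \<and> c \<in> {1..K}}"
      proof clarify
        fix u w k assume "(u, w, k) \<in> T"
        then have *: "w \<in> {1..n}" "u \<noteq> 0" "p w = u" "c w = k" by (auto simp: T)
        then show "u \<in> {1..n} \<and> w \<in> {1..n} \<and> u \<noteq> w \<and> k \<in> {1..K}"
          using PiE_mem[OF pE *(1)] PiE_mem[OF c[unfolded pcols_def] *(1)] ne[OF *(1)] by auto
      qed
      show "card T = n - 1" using r by (simp add: T card_tree_of)
      show "\<forall>u w c u' c'. (u, w, c) \<in> T \<longrightarrow> (u', w, c') \<in> T \<longrightarrow> u = u' \<and> c = c'" by (auto simp: T)
      show "acyclic {(u, w). \<exists>c. (u, w, c) \<in> T}" unfolding T prel_tree_of by (rule ac)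
    qed
    then show "T \<in> {T. colored_rooted_tree n K T}" by simp
  next
    fix T assume "T \<in> {T. colored_rooted_tree n K T}"
    then have T1: "T \<subseteq> {(u, w, c). u \<in> {1..n} \<and> w \<in> {1..n} \<and> u \<noteq> w \<and> c \<in> {1..K}}"
      and T2: "card T = n - 1" and T3: "\<forall>u w c u' c'. (u, w, c) \<in> T \<longrightarrow> (u', w, c') \<in> T \<longrightarrow> u = u' \<and> c = c'"
      and T4: "acyclic {(u, w). \<exists>c. (u, w, c) \<in> T}"
      by (auto simp: colored_rooted_tree_def)
    define P where "P = (\<lambda>w. SOME x. (fst x, w, snd x) \<in> T)"
    define H where "H = (\<lambda>w. \<exists>u c. (u, w, c) \<in> T)"
    have P: "(fst (P w), w, snd (P w)) \<in> T" if "H w" for w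
    proof -
      obtain u c where "(u, w, c) \<in> T" using \<open>H w\<close> H_def by auto
      then show ?thesis unfolding P_def by (intro someI[of "\<lambda>x. (fst x, w, snd x) \<in> T" "(u, c)"]) simp
    qed
    define p where "p = restrict (\<lambda>w. if H w then fst (P w) else 0) {1..n}"
    define c where "c = restrict (\<lambda>w. if H w then snd (P w) else 0) {1..n}"
    have mem: "(u, w, k) \<in> T \<longleftrightarrow> w \<in> {1..n} \<and> u \<noteq> 0 \<and> p w = u \<and> c w = k" for u w k
    proof
      assume a: "(u, w, k) \<in> T"
      then have H: "H w" by (auto simp: H_def)
      have "fst (P w) = u" "snd (P w) = k" using T3[rule_format, OF P[OF H] a] by simp_all
      then show "w \<in> {1..n} \<and> u \<noteq> 0 \<and> p w = u \<and> c w = k"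
        using subsetD[OF T1 a] H by (simp add: p_def c_def)
    next
      assume a: "w \<in> {1..n} \<and> u \<noteq> 0 \<and> p w = u \<and> c w = k"
      then have H: "H w" by (auto simp: p_def split: if_splits)
      then show "(u, w, k) \<in> T" using P[OF H] a by (auto simp: p_def c_def)
    qed
    have TT: "T = tree_of n (p, c)" using mem by auto
    have "p \<in> PiE {1..n} (\<lambda>_. insert 0 {1..n})"
    proof (rule PiE_I)
      fix w assume w: "w \<in> {1..n}"
      show "p w \<in> insert 0 {1..n}"
      proof (cases "H w")
        case True
        then show ?thesis using subsetD[OF T1 P[OF True]] w by (simp add: p_def)
      qed (use w in \<open>simp add: p_def\<close>)
    qed (auto simp: p_def)
    moreover have "acyclic (prel {1..n} p)" using T4 unfolding TT prel_tree_of .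
    \<comment> \<open>The subtraction is truncated, so the equation determines the number of roots
      only together with the bound by \<open>n\<close>.\<close>
    moreover have "card (froots {1..n} p) = 1"
    proof -
      have "n - card (froots {1..n} p) = n - 1" using T2 unfolding TT card_tree_of .
      moreover have "card (froots {1..n} p) \<le> card {1..n}" by (rule card_mono) (auto simp: froots_def)
      ultimately show ?thesis using n by simp
    qed
    ultimately have "p \<in> ptrees n" by (simp add: ptrees_def pforests_def)
    moreover have "c \<in> pcols n K p"
    proof -
      have "c w \<in> (if p w = 0 then {0} else {1..K})" if w: "w \<in> {1..n}" for w
      proof (cases "H w")
        case True
        then show ?thesis using subsetD[OF T1 P[OF True]] w by (simp add: p_def c_def)
      next
        case False
        then show ?thesis using w by (auto simp: p_def c_def)
      qed
      then show ?thesis unfolding pcols_def by (auto simp: c_def)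
    qed
    ultimately show "T \<in> tree_of n ` Sigma (ptrees n) (pcols n K)" using TT by auto
  qed
qed

section \<open>The colour condition as a signed sum of products\<close>

lemma prod_of_bool: "finite A \<Longrightarrow> (\<Prod>v\<in>A. of_bool (Q v)) = (of_bool (\<forall>v\<in>A. Q v) :: real)"
  by (induction A rule: finite_induct) auto

lemma sum_of_bool_card: "finite A \<Longrightarrow> (\<Sum>v\<in>A. of_bool (Q v)) = real (card {v \<in> A. Q v})"
  by (simp add: Int_def)

text \<open>Membership of \<open>c\<close> in a final segment of the colours \<open>1..K\<close>,
  written additively to avoid truncated subtraction.\<close>

definition color_ok :: "nat \<Rightarrow> nat \<Rightarrow> nat \<times> nat \<Rightarrow> nat \<Rightarrow> nat \<Rightarrow> nat \<Rightarrow> bool" where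
  "color_ok K k2 t v w c \<longleftrightarrow> K < c + k2 + snd t + (if w < v then fst t else 0)"

lemma card_color_ok:
  assumes "K = k1 + 1 + k2" "t \<in> vtypes k1"
  shows "card {c \<in> {1..K}. color_ok K k2 t v w c} = k2 + snd t + (if w < v then fst t else 0)"
proof -
  define m where "m = k2 + snd t + (if w < v then fst t else 0)"
  have m: "m \<le> K" using assms by (auto simp: m_def vtypes_def)
  have "{c \<in> {1..K}. color_ok K k2 t v w c} = {K - m<..K}" using m by (auto simp: color_ok_def m_def)
  then show ?thesis using m by (simp add: m_def)
qed

text \<open>Only the minimal colour \<open>\<mu>\<close> and whether all its children are smaller
  decide admissibility. For \<open>m\<close> at least 1 the types \<open>(1, m)\<close> and
  \<open>(0, m)\<close> cancel except where the first admits the minimal colour for smaller children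
  only. Type \<open>(1, 0)\<close> accounts for \<open>\<mu>\<close> above \<open>k1\<close> and,
  with all other pairs cancelling, for a vertex without children.\<close>

lemma sum_vtypes_color_ok:
  fixes c :: "nat \<Rightarrow> nat"
  assumes K: "K = k1 + 1 + k2" and fin: "finite W" and c: "\<And>w. w \<in> W \<Longrightarrow> 1 \<le> c w"
  shows "(\<Sum>t\<in>vtypes k1. tsign t * (\<Prod>w\<in>W. of_bool (color_ok K k2 t v w (c w))))
     = of_bool (W \<noteq> {} \<longrightarrow> Min (c ` W) \<le> k1 + 1 \<longrightarrow> (\<forall>w\<in>W. c w = Min (c ` W) \<longrightarrow> w < v))"
proof -
  note pr = prod_of_bool[OF fin]
  define A B where "A = (\<lambda>m. \<forall>w\<in>W. K < c w + k2 + m + (if w < v then 1 else 0))"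
    and "B = (\<lambda>m. \<forall>w\<in>W. K < c w + k2 + m)"
  have s: "(\<Sum>t\<in>vtypes k1. tsign t * (\<Prod>w\<in>W. of_bool (color_ok K k2 t v w (c w))))
      = (\<Sum>m=0..k1. of_bool (A m)) - (\<Sum>m=1..k1. of_bool (B m))"
    unfolding sum_vtypes pr by (simp add: color_ok_def A_def B_def)
  also have "\<dots> = of_bool (A 0) + (\<Sum>m=1..k1. of_bool (A m) - of_bool (B m))"
  proof -
    have "(\<Sum>m=0..k. f m) - (\<Sum>m=1..k. g m) = f 0 + (\<Sum>m=1..k. f m - g m)" for f g :: "nat \<Rightarrow> real" and k
      by (simp add: sum.atLeast_Suc_atMost sum_subtractf)
    then show ?thesis .
  qed
  finally have s: "(\<Sum>t\<in>vtypes k1. tsign t * (\<Prod>w\<in>W. of_bool (color_ok K k2 t v w (c w))))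
      = of_bool (A 0) + (\<Sum>m=1..k1. of_bool (A m) - of_bool (B m))" .
  show ?thesis
  proof (cases "W = {}")
    case True
    then show ?thesis using s by (simp add: A_def B_def)
  next
    case False
    define \<mu> where "\<mu> = Min (c ` W)"
    define g where "g \<longleftrightarrow> (\<forall>w\<in>W. c w = \<mu> \<longrightarrow> w < v)"
    have \<mu>le: "\<mu> \<le> c w" if "w \<in> W" for w using that fin by (simp add: \<mu>_def)
    have "\<mu> \<in> c ` W" using False fin by (simp add: \<mu>_def)
    then obtain w0 where w0: "w0 \<in> W" "c w0 = \<mu>" by auto
    have \<mu>1: "1 \<le> \<mu>" using w0 c by auto
    have B: "B m \<longleftrightarrow> k1 + 1 < \<mu> + m" for m
    proof
      assume "B m" then show "k1 + 1 < \<mu> + m" using w0 K unfolding B_def by auto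
    next
      assume a: "k1 + 1 < \<mu> + m"
      show "B m" unfolding B_def
      proof
        fix w assume "w \<in> W"
        then show "K < c w + k2 + m" using \<mu>le[of w] a K by linarith
      qed
    qed
    have A: "A m \<longleftrightarrow> k1 + 1 < \<mu> + m \<or> (k1 + 1 = \<mu> + m \<and> g)" for m
    proof
      assume a: "A m"
      have "K < \<mu> + k2 + m + 1" using bspec[OF a[unfolded A_def] w0(1)] w0(2) by (auto split: if_splits)
      moreover have g if "k1 + 1 = \<mu> + m"
        unfolding g_def
      proof (intro ballI impI)
        fix w assume "w \<in> W" "c w = \<mu>"
        then show "w < v" using bspec[OF a[unfolded A_def], of w] that K by (auto split: if_splits)
      qed
      ultimately show "k1 + 1 < \<mu> + m \<or> (k1 + 1 = \<mu> + m \<and> g)" using K by linarith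
    next
      assume a: "k1 + 1 < \<mu> + m \<or> (k1 + 1 = \<mu> + m \<and> g)"
      show "A m" unfolding A_def
      proof
        fix w assume w: "w \<in> W"
        show "K < c w + k2 + m + (if w < v then 1 else 0)"
        proof (cases "c w = \<mu>")
          case True
          then show ?thesis using a w K by (auto simp: g_def)
        next
          case False
          then have "\<mu> < c w" using \<mu>le[OF w] by simp
          then show ?thesis using a K by auto
        qed
      qed
    qed
    \<comment> \<open>The types differ only at \<open>\<mu> + m = k1 + 1\<close>. For
      \<open>\<mu>\<close> above \<open>k1\<close> the truncated difference
      \<open>k1 + 1 - \<mu>\<close> is 0 and falls outside the range of summation.\<close>
    have "(\<Sum>m=1..k1. of_bool (A m) - of_bool (B m)) = (\<Sum>m=1..k1. if m = k1 + 1 - \<mu> then of_bool (g \<and> \<mu> \<le> k1 + 1) else (0::real))"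
    proof (intro sum.cong refl)
      fix m assume "m \<in> {1..k1}"
      then show "of_bool (A m) - of_bool (B m) = (if m = k1 + 1 - \<mu> then of_bool (g \<and> \<mu> \<le> k1 + 1) else (0::real))"
        unfolding A B by auto
    qed
    also have "\<dots> = of_bool (g \<and> \<mu> \<le> k1)" using \<mu>1 by auto
    finally show ?thesis unfolding s A using False unfolding \<mu>_def[symmetric] g_def[symmetric] by auto
  qed
qed

text \<open>All children of \<open>n\<close> are smaller than \<open>n\<close>, so its condition
  always holds and the quantifier shrinks to \<open>{1..<n}\<close>. The colours at \<open>n\<close>
  are thereby free to carry \<open>y\<close>.\<close>

lemma decreasing_tree_of_iff:
  assumes n: "1 \<le> n" and p: "p \<in> ptrees n" and c: "c \<in> pcols n (k1 + 1 + k2) p"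
  shows "decreasing_tree n (k1 + 1) k2 (tree_of n (p, c)) \<longleftrightarrow>
    (\<forall>v\<in>{1..<n}. {w \<in> {1..n}. p w = v} \<noteq> {} \<longrightarrow> Min (c ` {w \<in> {1..n}. p w = v}) \<le> k1 + 1 \<longrightarrow>
       (\<forall>w\<in>{w \<in> {1..n}. p w = v}. c w = Min (c ` {w \<in> {1..n}. p w = v}) \<longrightarrow> w < v))"
proof -
  let ?T = "tree_of n (p, c)"
  have ct: "colored_rooted_tree n (k1 + 1 + k2) ?T"
    using bij_betw_tree_of[OF n, of "k1 + 1 + k2"] p c by (auto simp: bij_betw_def)
  have mc: "min_child_color ?T v = Min (c ` {w \<in> {1..n}. p w = v})" if "v \<noteq> 0" for v
    unfolding min_child_color_def using that by (intro arg_cong[where f = Min]) auto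
  have vn: "1 \<le> v \<and> v \<le> n" and wv: "u \<noteq> w" if "(v, w', k) \<in> ?T" "(u, w, k') \<in> ?T" for v w' k u w k'
  proof -
    have sub: "?T \<subseteq> {(u, w, c). u \<in> {1..n} \<and> w \<in> {1..n} \<and> u \<noteq> w \<and> c \<in> {1..k1 + 1 + k2}}"
      using ct unfolding colored_rooted_tree_def by (rule conjunct1)
    show "1 \<le> v \<and> v \<le> n" "u \<noteq> w" using subsetD[OF sub that(1)] subsetD[OF sub that(2)] by auto
  qed
  have "decreasing_tree n (k1 + 1) k2 ?T \<longleftrightarrow> (\<forall>v. (\<exists>w c'. (v, w, c') \<in> ?T) \<longrightarrow> min_child_color ?T v \<le> k1 + 1 \<longrightarrow>
        (\<forall>w. (v, w, min_child_color ?T v) \<in> ?T \<longrightarrow> w < v))"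
    unfolding decreasing_tree_def using ct by blast
  also have "\<dots> \<longleftrightarrow> (\<forall>v\<in>{1..<n}. (\<exists>w c'. (v, w, c') \<in> ?T) \<longrightarrow> min_child_color ?T v \<le> k1 + 1 \<longrightarrow>
        (\<forall>w. (v, w, min_child_color ?T v) \<in> ?T \<longrightarrow> w < v))" (is "?L \<longleftrightarrow> ?R")
  proof
    assume R: ?R
    show ?L
    proof (intro allI impI)
      fix v w assume a: "\<exists>w c'. (v, w, c') \<in> ?T" "min_child_color ?T v \<le> k1 + 1" "(v, w, min_child_color ?T v) \<in> ?T"
      have "1 \<le> v \<and> v \<le> n" "v \<noteq> w" using vn[OF a(3) a(3)] wv[OF a(3) a(3)] by auto
      then show "w < v" using R a by (cases "v = n") auto
    qed
  qed blast
  also have "\<dots> \<longleftrightarrow> (\<forall>v\<in>{1..<n}. {w \<in> {1..n}. p w = v} \<noteq> {} \<longrightarrow> Min (c ` {w \<in> {1..n}. p w = v}) \<le> k1 + 1 \<longrightarrow>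
       (\<forall>w\<in>{w \<in> {1..n}. p w = v}. c w = Min (c ` {w \<in> {1..n}. p w = v}) \<longrightarrow> w < v))"
    by (intro ball_cong refl) (auto simp: mc)
  finally show ?thesis .
qed

text \<open>Once the sum over types is moved outside, the colours of different edges are
  independent. Summing over them gives each edge a weight that depends on the type of the parent and
  on the order of the two ends, and \<open>tree_sum\<close> applies for each choice of
  types.\<close>

lemma decreasing_tree_polynomial:
  fixes y :: real
  assumes n: "n = Suc j"
  shows "(\<Sum>T\<in>{T. decreasing_tree n (k1 + 1) k2 T}. y ^ n_root_color1_edges n T)
     = (\<Sum>xs\<in>permutations_of_set {1..j}. rf j (y + real (n * k2) + real k1 + real k1 * real (asc xs)))"
proof -
  let ?K = "k1 + 1 + k2"
  have n1: "1 \<le> n" using n by simp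
  have fin_p: "finite (ptrees n)" by (auto simp: ptrees_def finite_pforests)
  have fin_c: "finite (pcols n ?K p)" for p unfolding pcols_def by (intro finite_PiE) auto
  let ?val = "\<lambda>p c v. (\<Sum>t\<in>vtypes k1. tsign t * (\<Prod>w\<in>{w \<in> {1..n}. p w = v}. of_bool (color_ok ?K k2 t v w (c w))))"
  let ?yw = "\<lambda>p c. y ^ card {w \<in> {1..n}. p w = n \<and> c w = 1}"
  let ?Ty = "PiE {1..j} (\<lambda>_. vtypes k1)"
  \<comment> \<open>At \<open>n\<close> colour 1 weighs \<open>y\<close> and each of the other
    \<open>k1 + k2\<close> colours weighs 1, which gives \<open>a t n\<close>; no child is larger
    than \<open>n\<close>, hence the value 0 of \<open>b t n\<close>. Elsewhere \<open>a\<close> and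
    \<open>b\<close> count the admissible colours of a smaller and of a larger child.\<close>
  define wc where "wc = (\<lambda>t v w (k::nat). if v = n then (if k = 1 then y else 1) else (of_bool (color_ok ?K k2 (t v) v w k) :: real))"
  define a where "a = (\<lambda>t v. if v = n then y + real (k1 + k2) else real (k2 + snd (t v) + fst (t v :: nat \<times> nat)))"
  define b where "b = (\<lambda>t v. if v = n then 0 else real (k2 + snd (t v :: nat \<times> nat)))"
  have val: "(\<Prod>v\<in>{1..<n}. ?val p c v) = of_bool (decreasing_tree n (k1 + 1) k2 (tree_of n (p, c)))"
    if p: "p \<in> ptrees n" and c: "c \<in> pcols n ?K p" for p c
  proof -
    have c1: "1 \<le> c w" if "w \<in> {w \<in> {1..n}. p w = v}" "v \<in> {1..<n}" for w v
      using PiE_mem[OF c[unfolded pcols_def], of w] that by (auto split: if_splits)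
    let ?Q = "\<lambda>v. {w \<in> {1..n}. p w = v} \<noteq> {} \<longrightarrow> Min (c ` {w \<in> {1..n}. p w = v}) \<le> k1 + 1 \<longrightarrow>
       (\<forall>w\<in>{w \<in> {1..n}. p w = v}. c w = Min (c ` {w \<in> {1..n}. p w = v}) \<longrightarrow> w < v)"
    have "(\<Prod>v\<in>{1..<n}. ?val p c v) = (\<Prod>v\<in>{1..<n}. of_bool (?Q v))"
      using c1 by (intro prod.cong refl sum_vtypes_color_ok) auto
    also have "\<dots> = of_bool (\<forall>v\<in>{1..<n}. ?Q v)"
      by (rule prod_of_bool) simp
    finally show ?thesis unfolding decreasing_tree_of_iff[OF n1 p c] .
  qed
  have yw: "n_root_color1_edges n (tree_of n (p, c)) = card {w \<in> {1..n}. p w = n \<and> c w = 1}" for p c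
  proof -
    have "{(u, w, k) \<in> tree_of n (p, c). u = n \<and> k = 1} = (\<lambda>w. (n, w, 1)) ` {w \<in> {1..n}. p w = n \<and> c w = 1}"
      using n by (auto simp: image_iff)
    then show ?thesis unfolding n_root_color1_edges_def by (simp add: card_image inj_on_def)
  qed
  have expand: "?yw p c * (\<Prod>v\<in>{1..<n}. ?val p c v) =
      (\<Sum>t\<in>?Ty. (\<Prod>v\<in>{1..j}. tsign (t v)) * (\<Prod>w\<in>{w \<in> {1..n}. p w \<noteq> 0}. wc t (p w) w (c w)))"
    if p: "p \<in> ptrees n" for p c
  proof -
    have pE: "p w \<in> insert 0 {1..n}" if "w \<in> {1..n}" for w
      using p that PiE_mem[of p "{1..n}" "\<lambda>_. insert 0 {1..n}" w] by (auto simp: ptrees_def pforests_def)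
    have yw': "?yw p c = (\<Prod>w\<in>{w \<in> {1..n}. p w = n}. if c w = 1 then y else 1)"
      by (simp add: prod.If_cases Int_def conj_ac)
    have jn: "{1..<n} = {1..j}" using n by auto
    have "(\<Prod>v\<in>{1..<n}. ?val p c v) = (\<Sum>t\<in>?Ty. \<Prod>v\<in>{1..j}. tsign (t v) *
        (\<Prod>w\<in>{w \<in> {1..n}. p w = v}. of_bool (color_ok ?K k2 (t v) v w (c w))))"
      unfolding jn by (rule prod_sum_PiE) auto
    then have "?yw p c * (\<Prod>v\<in>{1..<n}. ?val p c v) = (\<Sum>t\<in>?Ty. ?yw p c * (\<Prod>v\<in>{1..j}. tsign (t v) *
        (\<Prod>w\<in>{w \<in> {1..n}. p w = v}. of_bool (color_ok ?K k2 (t v) v w (c w)))))"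
      by (simp only: sum_distrib_left)
    also have "\<dots> = (\<Sum>t\<in>?Ty. (\<Prod>v\<in>{1..j}. tsign (t v)) * (\<Prod>w\<in>{w \<in> {1..n}. p w \<noteq> 0}. wc t (p w) w (c w)))"
    proof (intro sum.cong refl)
      fix t assume "t \<in> ?Ty"
      have "(\<Prod>w\<in>{w \<in> {1..n}. p w \<noteq> 0}. wc t (p w) w (c w))
         = (\<Prod>v\<in>{1..n}. \<Prod>w\<in>{w \<in> {w \<in> {1..n}. p w \<noteq> 0}. p w = v}. wc t (p w) w (c w))"
      proof (rule prod.group[symmetric])
        show "p ` {w \<in> {1..n}. p w \<noteq> 0} \<subseteq> {1..n}"
        proof (rule image_subsetI)
          fix w assume "w \<in> {w \<in> {1..n}. p w \<noteq> 0}"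
          then show "p w \<in> {1..n}" using pE[of w] by simp
        qed
      qed auto
      also have "\<dots> = (\<Prod>v\<in>{1..n}. \<Prod>w\<in>{w \<in> {1..n}. p w = v}. wc t v w (c w))"
        by (intro prod.cong refl) auto
      also have "{1..n} = insert n {1..j}" using n by auto
      also have "(\<Prod>v\<in>insert n {1..j}. \<Prod>w\<in>{w \<in> insert n {1..j}. p w = v}. wc t v w (c w))
         = (\<Prod>w\<in>{w \<in> insert n {1..j}. p w = n}. wc t n w (c w)) * (\<Prod>v\<in>{1..j}. \<Prod>w\<in>{w \<in> insert n {1..j}. p w = v}. wc t v w (c w))"
        using n by (subst prod.insert) auto
      also have "insert n {1..j} = {1..n}" using n by auto
      also have "(\<Prod>w\<in>{w \<in> {1..n}. p w = n}. wc t n w (c w)) = ?yw p c"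
        unfolding yw' by (simp add: wc_def)
      also have "(\<Prod>v\<in>{1..j}. \<Prod>w\<in>{w \<in> {1..n}. p w = v}. wc t v w (c w))
         = (\<Prod>v\<in>{1..j}. \<Prod>w\<in>{w \<in> {1..n}. p w = v}. of_bool (color_ok ?K k2 (t v) v w (c w)))"
        using n by (intro prod.cong refl) (auto simp: wc_def)
      finally show "?yw p c * (\<Prod>v\<in>{1..j}. tsign (t v) * (\<Prod>w\<in>{w \<in> {1..n}. p w = v}. of_bool (color_ok ?K k2 (t v) v w (c w))))
        = (\<Prod>v\<in>{1..j}. tsign (t v)) * (\<Prod>w\<in>{w \<in> {1..n}. p w \<noteq> 0}. wc t (p w) w (c w))"
        by (simp add: prod.distrib)
    qed
    finally show ?thesis .
  qed
  have colsum: "(\<Sum>c\<in>pcols n ?K p. \<Prod>w\<in>{w \<in> {1..n}. p w \<noteq> 0}. wc t (p w) w (c w))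
      = fweight (\<lambda>v w. if v < w then b t v else a t v) {1..n} p"
    if p: "p \<in> ptrees n" and t: "t \<in> ?Ty" for p t
  proof -
    have pE: "p w \<in> insert 0 {1..n}" if "w \<in> {1..n}" for w
      using p that PiE_mem[of p "{1..n}" "\<lambda>_. insert 0 {1..n}" w] by (auto simp: ptrees_def pforests_def)
    have pne: "p w \<noteq> w" if "w \<in> {1..n}" for w
    proof
      assume "p w = w"
      then have "(w, w) \<in> prel {1..n} p" using that by (auto simp: prel_def)
      then show False using p by (auto simp: acyclic_def ptrees_def pforests_def)
    qed
    let ?h = "\<lambda>w k. if p w = 0 then 1 else wc t (p w) w k"
    have inter: "(\<Prod>w\<in>{w \<in> {1..n}. p w \<noteq> 0}. f w) = (\<Prod>w\<in>{1..n}. if p w = 0 then 1 else f w)" for f :: "nat \<Rightarrow> real"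
      by (subst prod.inter_filter) (auto intro!: prod.cong)
    have "(\<Sum>c\<in>pcols n ?K p. \<Prod>w\<in>{w \<in> {1..n}. p w \<noteq> 0}. wc t (p w) w (c w)) = (\<Sum>c\<in>pcols n ?K p. \<Prod>w\<in>{1..n}. ?h w (c w))"
      unfolding inter ..
    also have "\<dots> = (\<Prod>w\<in>{1..n}. \<Sum>k\<in>(if p w = 0 then {0} else {1..?K}). ?h w k)"
      unfolding pcols_def by (rule prod_sum_PiE[symmetric]) auto
    also have "\<dots> = (\<Prod>w\<in>{1..n}. if p w = 0 then 1 else (if p w < w then b t (p w) else a t (p w)))"
    proof (intro prod.cong refl)
      fix w assume w: "w \<in> {1..n}"
      show "(\<Sum>k\<in>(if p w = 0 then {0} else {1..?K}). ?h w k) = (if p w = 0 then 1 else (if p w < w then b t (p w) else a t (p w)))"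
      proof (cases "p w = 0 \<or> p w = n")
        case True
        have "(\<Sum>k=1..?K. if k = 1 then y else 1) = y + real (k1 + k2)"
          by (simp add: sum.atLeast_Suc_atMost)
        then show ?thesis using True w n by (auto simp: wc_def a_def b_def)
      next
        case False
        then have "p w \<in> {1..j}" using pE[OF w] n by auto
        then have tv: "t (p w) \<in> vtypes k1" using t by auto
        have "(\<Sum>k\<in>{1..?K}. of_bool (color_ok ?K k2 (t (p w)) (p w) w k)) = real (card {k \<in> {1..?K}. color_ok ?K k2 (t (p w)) (p w) w k})"
          by (rule sum_of_bool_card) simp
        also have "\<dots> = (if p w < w then b t (p w) else a t (p w))"
          unfolding card_color_ok[OF refl tv] using False pne[OF w] by (auto simp: a_def b_def)
        finally show ?thesis using False by (simp add: wc_def)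
      qed
    qed
    finally show ?thesis unfolding fweight_def inter .
  qed
  \<comment> \<open>Every vertex below \<open>n\<close> contributes \<open>k2 + snd (t v)\<close> to
    each factor, whether through \<open>a\<close> or \<open>b\<close>; only those beyond the index
    of the factor add \<open>fst (t v)\<close>. Vertex \<open>n\<close> adds
    \<open>y + k1 + k2\<close>, which completes \<open>n * k2\<close>.\<close>
  have prodform: "(\<Sum>p\<in>ptrees n. fweight (\<lambda>v w. if v < w then b t v else a t v) {1..n} p)
     = (\<Prod>i\<in>{1..j}. y + real (n * k2) + real k1 + real (\<Sum>v\<in>{1..j}. snd (t v)) + real (\<Sum>v\<in>{i<..j}. fst (t v)))" for t
  proof -
    have "(\<Sum>p\<in>ptrees n. fweight (\<lambda>v w. if v < w then b t v else a t v) {1..n} p)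
      = (\<Prod>k\<in>{1..<n}. (\<Sum>i\<in>{1..k}. b t i) + (\<Sum>i\<in>{k<..n}. a t i))"
      using n1 by (intro tree_sum) (auto simp: b_def)
    also have "{1..<n} = {1..j}" using n by auto
    also have "(\<Prod>k\<in>{1..j}. (\<Sum>i\<in>{1..k}. b t i) + (\<Sum>i\<in>{k<..n}. a t i))
       = (\<Prod>i\<in>{1..j}. y + real (n * k2) + real k1 + real (\<Sum>v\<in>{1..j}. snd (t v)) + real (\<Sum>v\<in>{i<..j}. fst (t v)))"
    proof (intro prod.cong refl)
      fix k assume k: "k \<in> {1..j}"
      have "{k<..n} = insert n {k<..j}" using k n by auto
      then have 1: "(\<Sum>i\<in>{k<..n}. a t i) = y + real (k1 + k2) + (\<Sum>i\<in>{k<..j}. a t i)"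
        using n by (simp add: a_def)
      have 2: "(\<Sum>i\<in>{k<..j}. a t i) = (\<Sum>i\<in>{k<..j}. real (k2 + snd (t i))) + real (\<Sum>v\<in>{k<..j}. fst (t v))"
        unfolding of_nat_sum sum.distrib[symmetric] using n by (intro sum.cong) (auto simp: a_def)
      have 3: "(\<Sum>i\<in>{1..k}. b t i) = (\<Sum>i\<in>{1..k}. real (k2 + snd (t i)))"
        using n k by (intro sum.cong) (auto simp: b_def)
      have "{1..j} = {1..k} \<union> {k<..j}" using k by auto
      then have 4: "(\<Sum>i\<in>{1..j}. real (k2 + snd (t i))) = (\<Sum>i\<in>{1..k}. real (k2 + snd (t i))) + (\<Sum>i\<in>{k<..j}. real (k2 + snd (t i)))"
        by (simp only:) (subst sum.union_disjoint, auto)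
      have 5: "(\<Sum>i\<in>{1..j}. real (k2 + snd (t i))) = real (j * k2) + real (\<Sum>v\<in>{1..j}. snd (t v))"
        by (simp add: sum.distrib)
      show "(\<Sum>i\<in>{1..k}. b t i) + (\<Sum>i\<in>{k<..n}. a t i) = y + real (n * k2) + real k1 + real (\<Sum>v\<in>{1..j}. snd (t v)) + real (\<Sum>v\<in>{k<..j}. fst (t v))"
        using 1 2 3 4 5 n by (simp add: algebra_simps)
    qed
    finally show ?thesis .
  qed
  have bij: "bij_betw (tree_of n) (Sigma (ptrees n) (pcols n ?K)) {T. colored_rooted_tree n ?K T}"
    by (rule bij_betw_tree_of[OF n1])
  have finT: "finite {T. colored_rooted_tree n ?K T}"
    using bij_betw_finite[OF bij] fin_p fin_c by auto
  have "(\<Sum>T\<in>{T. decreasing_tree n (k1 + 1) k2 T}. y ^ n_root_color1_edges n T)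
     = (\<Sum>T\<in>{T. colored_rooted_tree n ?K T}. of_bool (decreasing_tree n (k1 + 1) k2 T) * y ^ n_root_color1_edges n T)"
    using finT by (intro sum.mono_neutral_cong_left) (auto simp: decreasing_tree_def)
  also have "\<dots> = (\<Sum>x\<in>Sigma (ptrees n) (pcols n ?K). of_bool (decreasing_tree n (k1 + 1) k2 (tree_of n x)) * y ^ n_root_color1_edges n (tree_of n x))"
    by (rule sum.reindex_bij_betw[OF bij, symmetric])
  also have "\<dots> = (\<Sum>p\<in>ptrees n. \<Sum>c\<in>pcols n ?K p. of_bool (decreasing_tree n (k1 + 1) k2 (tree_of n (p, c))) * y ^ n_root_color1_edges n (tree_of n (p, c)))"
    by (subst sum.Sigma) (use fin_p fin_c in \<open>auto intro!: sum.cong\<close>)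
  also have "\<dots> = (\<Sum>p\<in>ptrees n. \<Sum>c\<in>pcols n ?K p. \<Sum>t\<in>?Ty. (\<Prod>v\<in>{1..j}. tsign (t v)) * (\<Prod>w\<in>{w \<in> {1..n}. p w \<noteq> 0}. wc t (p w) w (c w)))"
  proof (intro sum.cong refl)
    fix p c assume "p \<in> ptrees n" "c \<in> pcols n ?K p"
    then show "of_bool (decreasing_tree n (k1 + 1) k2 (tree_of n (p, c))) * y ^ n_root_color1_edges n (tree_of n (p, c))
      = (\<Sum>t\<in>?Ty. (\<Prod>v\<in>{1..j}. tsign (t v)) * (\<Prod>w\<in>{w \<in> {1..n}. p w \<noteq> 0}. wc t (p w) w (c w)))"
      unfolding expand[OF \<open>p \<in> ptrees n\<close>, of c, symmetric] yw by (subst val) (auto simp: mult.commute)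
  qed
  also have "\<dots> = (\<Sum>p\<in>ptrees n. \<Sum>t\<in>?Ty. \<Sum>c\<in>pcols n ?K p. (\<Prod>v\<in>{1..j}. tsign (t v)) * (\<Prod>w\<in>{w \<in> {1..n}. p w \<noteq> 0}. wc t (p w) w (c w)))"
    by (intro sum.cong refl sum.swap)
  also have "\<dots> = (\<Sum>t\<in>?Ty. \<Sum>p\<in>ptrees n. \<Sum>c\<in>pcols n ?K p. (\<Prod>v\<in>{1..j}. tsign (t v)) * (\<Prod>w\<in>{w \<in> {1..n}. p w \<noteq> 0}. wc t (p w) w (c w)))"
    by (rule sum.swap)
  also have "\<dots> = (\<Sum>t\<in>?Ty. (\<Prod>v\<in>{1..j}. tsign (t v)) * (\<Sum>p\<in>ptrees n. fweight (\<lambda>v w. if v < w then b t v else a t v) {1..n} p))"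
    unfolding sum_distrib_left[symmetric] by (intro sum.cong refl arg_cong2[where f = "(*)"] colsum) auto
  also have "\<dots> = (\<Sum>t\<in>?Ty. (\<Prod>v\<in>{1..j}. tsign (t v)) * (\<Prod>i\<in>{1..j}. y + real (n * k2) + real k1 + real (\<Sum>v\<in>{1..j}. snd (t v)) + real (\<Sum>v\<in>{i<..j}. fst (t v))))"
    unfolding prodform ..
  also have "\<dots> = (\<Sum>xs\<in>permutations_of_set {1..j}. rf j (y + real (n * k2) + real k1 + real k1 * real (asc xs)))"
    by (rule sum_vtypes_eq_sum_rf)
  finally show ?thesis .
qed

section \<open>Colourings modulo q\<close>

definition sat_mod :: "int \<Rightarrow> (nat \<Rightarrow> int) \<Rightarrow> gedge \<Rightarrow> bool" where
  "sat_mod q x e \<longleftrightarrow> q dvd x (fst (snd e)) - x (fst e) - snd (snd e)"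

definition colorings :: "nat \<Rightarrow> int \<Rightarrow> gedge set \<Rightarrow> gedge set \<Rightarrow> (nat \<Rightarrow> int) set" where
  "colorings n q D E = {x \<in> PiE {1..n} (\<lambda>_. {0..<q}). (\<forall>e\<in>D. sat_mod q x e) \<and> (\<forall>e\<in>E. \<not> sat_mod q x e)}"

definition gedges_on :: "nat \<Rightarrow> gedge set \<Rightarrow> bool" where
  "gedges_on n E \<longleftrightarrow> (\<forall>e\<in>E. fst e \<in> {1..n} \<and> fst (snd e) \<in> {1..n})"

lemma finite_colorings [simp]: "finite (colorings n q D E)"
  unfolding colorings_def by (rule finite_subset[of _ "PiE {1..n} (\<lambda>_. {0..<q})"]) (auto intro: finite_PiE)

lemma sat_mod_cong:
  assumes "\<And>v. v \<in> ends e \<Longrightarrow> q dvd x v - y v - s"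
  shows "sat_mod q x e \<longleftrightarrow> sat_mod q y e"
proof -
  have 1: "q dvd x (fst e) - y (fst e) - s" "q dvd x (fst (snd e)) - y (fst (snd e)) - s"
    using assms by (auto simp: ends_def)
  have "x (fst (snd e)) - x (fst e) - snd (snd e) = (y (fst (snd e)) - y (fst e) - snd (snd e))
     + ((x (fst (snd e)) - y (fst (snd e)) - s) - (x (fst e) - y (fst e) - s))" by simp
  then show ?thesis unfolding sat_mod_def using dvd_diff[OF 1(2) 1(1)] by (metis dvd_add_left_iff)
qed

text \<open>The constraints involve differences only, so adding a constant modulo \<open>q\<close>
  to all vertices preserves them, and each orbit has exactly one member in every residue at
  \<open>v\<close>.\<close>

lemma card_colorings_rotate:
  assumes q: "0 < q" and v: "v \<in> {1..n}" and on: "gedges_on n (D \<union> E)"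
  shows "card (colorings n q D E) = nat q * card {x \<in> colorings n q D E. x v = 0}"
proof -
  define f where "f = (\<lambda>(y, s). restrict (\<lambda>i. (y i + s) mod q) {1..n})"
  define g where "g = (\<lambda>x. (restrict (\<lambda>i. (x i - x v) mod q) {1..n}, x v))"
  have shift: "restrict (\<lambda>i. (y i + s) mod q) {1..n} \<in> colorings n q D E" if "y \<in> colorings n q D E" for y s
  proof -
    have "sat_mod q (restrict (\<lambda>i. (y i + s) mod q) {1..n}) e \<longleftrightarrow> sat_mod q y e" if "e \<in> D \<union> E" for e
    proof (rule sat_mod_cong[where s = s])
      fix v assume "v \<in> ends e"
      then have v: "v \<in> {1..n}" using on \<open>e \<in> D \<union> E\<close> by (auto simp: gedges_on_def ends_def)
      have "q dvd (y v + s) mod q - (y v + s)" by (metis dvd_minus_mod dvd_diff_commute)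
      then show "q dvd restrict (\<lambda>i. (y i + s) mod q) {1..n} v - y v - s" using v by (simp add: diff_diff_eq)
    qed
    then show ?thesis using that q by (auto simp: colorings_def)
  qed
  have "bij_betw f ({x \<in> colorings n q D E. x v = 0} \<times> {0..<q}) (colorings n q D E)"
  proof (rule bij_betw_byWitness[where f' = g])
    show "\<forall>a\<in>{x \<in> colorings n q D E. x v = 0} \<times> {0..<q}. g (f a) = a"
    proof clarify
      fix y s assume y: "y \<in> colorings n q D E" "y v = 0" and s: "s \<in> {0..<q}"
      have yr: "y i \<in> {0..<q}" if "i \<in> {1..n}" for i using y that by (auto simp: colorings_def)
      have yu: "y i = undefined" if "i \<notin> {1..n}" for i using y that by (auto simp: colorings_def PiE_def extensional_def)
      have fv: "f (y, s) v = s" using v y s by (simp add: f_def)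
      have "(f (y, s) i - f (y, s) v) mod q = y i" if "i \<in> {1..n}" for i
        using that yr[OF that] fv by (simp add: f_def mod_diff_left_eq)
      then show "g (f (y, s)) = (y, s)" using fv yu unfolding g_def by (auto simp: fun_eq_iff restrict_def)
    qed
    show "\<forall>a'\<in>colorings n q D E. f (g a') = a'"
    proof
      fix x assume x: "x \<in> colorings n q D E"
      have xr: "x i \<in> {0..<q}" if "i \<in> {1..n}" for i using x that by (auto simp: colorings_def)
      have xu: "x i = undefined" if "i \<notin> {1..n}" for i using x that by (auto simp: colorings_def PiE_def extensional_def)
      have "((x i - x v) mod q + x v) mod q = x i" if "i \<in> {1..n}" for i
        using xr[OF that] by (simp add: mod_add_left_eq)
      then show "f (g x) = x" using xu by (auto simp: f_def g_def fun_eq_iff restrict_def)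
    qed
    show "f ` ({x \<in> colorings n q D E. x v = 0} \<times> {0..<q}) \<subseteq> colorings n q D E"
      using shift by (auto simp: f_def)
    show "g ` colorings n q D E \<subseteq> {x \<in> colorings n q D E. x v = 0} \<times> {0..<q}"
    proof (rule image_subsetI)
      fix x assume x: "x \<in> colorings n q D E"
      have "x v \<in> {0..<q}" using x v by (auto simp: colorings_def)
      then show "g x \<in> {x \<in> colorings n q D E. x v = 0} \<times> {0..<q}"
        using shift[OF x, of "- x v"] v by (simp add: g_def)
    qed
  qed
  from bij_betw_same_card[OF this] show ?thesis by (simp add: card_cartesian_product mult.commute)
qed

section \<open>Placements on a line with prescribed gaps\<close>

definition gap :: "nat \<Rightarrow> nat \<Rightarrow> nat \<Rightarrow> nat \<Rightarrow> int" where
  "gap k1 k2 u w = int k2 + 1 + (if u < w then int k1 else 0)"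

text \<open>For \<open>u < w\<close> the forbidden differences rule out a rise from \<open>u\<close>
  to \<open>w\<close> of at most \<open>k1 + k2\<close>, for \<open>u > w\<close> a rise of at most
  \<open>k2\<close>; \<open>gap\<close> is the least rise left. It is demanded for all pairs, as the
  hyperplanes require, not only for neighbours.\<close>

definition spaced :: "nat \<Rightarrow> nat \<Rightarrow> nat list \<Rightarrow> int \<Rightarrow> int \<Rightarrow> (nat \<Rightarrow> int) set" where
  "spaced k1 k2 xs a b = {y \<in> PiE (set xs) (\<lambda>_. {a..<b}). sorted_wrt (\<lambda>u w. y u + gap k1 k2 u w \<le> y w) xs}"

text \<open>The hockey-stick identity, extended to negative arguments by \<open>nat\<close>: they
  contribute 0 because \<open>l\<close> is positive.\<close>

lemma sum_choose_int:
  assumes l: "1 \<le> l" and e: "1 \<le> e"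
  shows "(\<Sum>s\<in>{a..<b}. nat (b - s - e) choose l) = nat (b - a - e + 1) choose (Suc l)"
proof (cases "a \<le> b")
  case False
  then show ?thesis using e by simp
next
  case True
  then show ?thesis
  proof (induction a rule: int_le_induct)
    case base
    then show ?case using e by simp
  next
    case (step a)
    have "{a - 1..<b} = insert (a - 1) {a..<b}" using step by auto
    then have "(\<Sum>s\<in>{a - 1..<b}. nat (b - s - e) choose l) = (nat (b - a - e + 1) choose l) + (nat (b - a - e + 1) choose (Suc l))"
      using step by (simp add: algebra_simps)
    also have "\<dots> = nat (b - (a - 1) - e + 1) choose (Suc l)"
    proof (cases "0 \<le> b - a - e + 1")
      case True
      then have "nat (b - (a - 1) - e + 1) = Suc (nat (b - a - e + 1))" by auto
      then show ?thesis by simp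
    next
      case False
      then show ?thesis using l by auto
    qed
    finally show ?case .
  qed
qed

text \<open>The gaps satisfy a triangle inequality, so once the tail is spaced, the first entry only
  has to keep its distance from the second one.\<close>

lemma card_spaced_Cons:
  assumes d: "distinct (x # w # ws)"
  shows "card (spaced k1 k2 (x # w # ws) a b) = (\<Sum>s\<in>{a..<b}. card (spaced k1 k2 (w # ws) (s + gap k1 k2 x w) b))"
proof -
  define f where "f = (\<lambda>(s::int, y::nat \<Rightarrow> int). y(x := s))"
  have g1: "1 \<le> gap k1 k2 u v" for u v by (simp add: gap_def)
  have tri: "gap k1 k2 u v \<le> gap k1 k2 u t + gap k1 k2 t v" for u v t by (auto simp: gap_def)
  let ?I = "Sigma {a..<b} (\<lambda>s. spaced k1 k2 (w # ws) (s + gap k1 k2 x w) b)"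
  have fin: "finite (spaced k1 k2 xs a b)" for xs a b
    unfolding spaced_def by (rule finite_subset[of _ "PiE (set xs) (\<lambda>_. {a..<b})"]) (auto intro: finite_PiE)
  have cong: "sorted_wrt (\<lambda>u v. (y(x := s)) u + gap k1 k2 u v \<le> (y(x := s)) v) (w # ws)
      \<longleftrightarrow> sorted_wrt (\<lambda>u v. y u + gap k1 k2 u v \<le> y v) (w # ws)" for y s
    using d by (intro iffI; elim sorted_wrt_mono_rel[rotated]) (auto split: if_splits)
  have "bij_betw f ?I (spaced k1 k2 (x # w # ws) a b)"
  proof (rule bij_betw_byWitness[where f' = "\<lambda>y. (y x, y(x := undefined))"])
    show "\<forall>p\<in>?I. (f p x, (f p)(x := undefined)) = p"
      using d by (auto simp: f_def spaced_def PiE_def extensional_def fun_eq_iff)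
    show "\<forall>y\<in>spaced k1 k2 (x # w # ws) a b. f (y x, y(x := undefined)) = y" by (auto simp: f_def)
    show "f ` ?I \<subseteq> spaced k1 k2 (x # w # ws) a b"
    proof clarify
      fix s y assume s: "s \<in> {a..<b}" and y: "y \<in> spaced k1 k2 (w # ws) (s + gap k1 k2 x w) b"
      have yE: "y \<in> PiE (set (w # ws)) (\<lambda>_. {s + gap k1 k2 x w..<b})"
        and yS: "sorted_wrt (\<lambda>u v. y u + gap k1 k2 u v \<le> y v) (w # ws)" using y by (auto simp: spaced_def)
      have yr: "s + gap k1 k2 x w \<le> y v" "y v < b" if "v \<in> set (w # ws)" for v using PiE_mem[OF yE that] by auto
      have lo: "s + gap k1 k2 x v \<le> y v" if v: "v \<in> set (w # ws)" for v
      proof (cases "v = w")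
        case False
        then have "y w + gap k1 k2 w v \<le> y v" using yS v by auto
        then show ?thesis using yr[of w] tri[of x v w] by simp
      qed (use yr v in auto)
      have "y(x := s) \<in> PiE (set (x # w # ws)) (\<lambda>_. {a..<b})"
      proof (rule PiE_I)
        fix v assume "v \<in> set (x # w # ws)"
        then show "(y(x := s)) v \<in> {a..<b}" using yr[of v] lo[of v] g1[of x v] s by (cases "v = x") auto
      next
        fix v assume "v \<notin> set (x # w # ws)"
        then show "(y(x := s)) v = undefined" using PiE_arb[OF yE, of v] by auto
      qed
      moreover have "sorted_wrt (\<lambda>u v. (y(x := s)) u + gap k1 k2 u v \<le> (y(x := s)) v) (x # w # ws)"
        using lo d yS cong[of y s] by (subst sorted_wrt.simps(2)) auto
      ultimately show "f (s, y) \<in> spaced k1 k2 (x # w # ws) a b" by (simp add: f_def spaced_def)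
    qed
    show "(\<lambda>y. (y x, y(x := undefined))) ` spaced k1 k2 (x # w # ws) a b \<subseteq> ?I"
    proof (rule image_subsetI)
      fix y assume y: "y \<in> spaced k1 k2 (x # w # ws) a b"
      have yE: "y \<in> PiE (set (x # w # ws)) (\<lambda>_. {a..<b})"
        and yS: "sorted_wrt (\<lambda>u v. y u + gap k1 k2 u v \<le> y v) (x # w # ws)" using y by (auto simp: spaced_def)
      have yr: "a \<le> y v" "y v < b" if "v \<in> set (x # w # ws)" for v using PiE_mem[OF yE that] by auto
      have lo: "y x + gap k1 k2 x w \<le> y v" if v: "v \<in> set (w # ws)" for v
      proof (cases "v = w")
        case False
        then have "y w + gap k1 k2 w v \<le> y v" "y x + gap k1 k2 x w \<le> y w" using yS v by auto
        then show ?thesis using g1[of w v] by simp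
      qed (use yS in auto)
      have "y(x := undefined) \<in> PiE (set (w # ws)) (\<lambda>_. {y x + gap k1 k2 x w..<b})"
      proof (rule PiE_I)
        fix v assume v: "v \<in> set (w # ws)"
        then have "v \<noteq> x" using d by auto
        then show "(y(x := undefined)) v \<in> {y x + gap k1 k2 x w..<b}" using lo[OF v] yr[of v] v by simp
      next
        fix v assume "v \<notin> set (w # ws)"
        then show "(y(x := undefined)) v = undefined" using PiE_arb[OF yE, of v] by auto
      qed
      moreover have "sorted_wrt (\<lambda>u v. (y(x := undefined)) u + gap k1 k2 u v \<le> (y(x := undefined)) v) (w # ws)"
        unfolding cong using yS by simp
      ultimately show "(y x, y(x := undefined)) \<in> ?I" using yr[of x] by (auto simp: spaced_def)
    qed
  qed
  from bij_betw_same_card[OF this] show ?thesis using fin by (simp add: card_SigmaI)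
qed

text \<open>Each neighbouring pair uses up \<open>k2\<close> places, and \<open>k1\<close> more at
  an ascent, beyond the single step that keeps positions distinct. Deleting these places leaves an
  arbitrary choice of positions.\<close>

lemma card_spaced:
  assumes "distinct xs" "xs \<noteq> []"
  shows "card (spaced k1 k2 xs a b)
    = nat (b - a - int k2 * (int (length xs) - 1) - int k1 * int (asc xs)) choose length xs"
  using assms
proof (induction xs arbitrary: a rule: asc.induct)
  case (1 x w ws)
  let ?l = "length (w # ws)"
  define c where "c = int k2 * (int ?l - 1) + int k1 * int (asc (w # ws))"
  have c0: "0 \<le> c" by (simp add: c_def)
  define e where "e = gap k1 k2 x w + c"
  have e: "1 \<le> e" using c0 by (simp add: e_def gap_def)
  have "card (spaced k1 k2 (x # w # ws) a b) = (\<Sum>s\<in>{a..<b}. nat (b - s - e) choose ?l)"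
    unfolding card_spaced_Cons[OF "1.prems"(1)]
  proof (intro sum.cong refl)
    fix s
    have "b - (s + gap k1 k2 x w) - int k2 * (int ?l - 1) - int k1 * int (asc (w # ws)) = b - s - e"
      by (simp add: e_def c_def)
    moreover have "card (spaced k1 k2 (w # ws) (s + gap k1 k2 x w) b) =
        nat (b - (s + gap k1 k2 x w) - int k2 * (int ?l - 1) - int k1 * int (asc (w # ws))) choose ?l"
      by (rule "1.IH") (use "1.prems" in auto)
    ultimately show "card (spaced k1 k2 (w # ws) (s + gap k1 k2 x w) b) = nat (b - s - e) choose ?l" by metis
  qed
  also have "\<dots> = nat (b - a - e + 1) choose (Suc ?l)" by (rule sum_choose_int) (use e in auto)
  also have "b - a - e + 1 = b - a - int k2 * (int (length (x # w # ws)) - 1) - int k1 * int (asc (x # w # ws))"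
    by (simp add: e_def c_def gap_def algebra_simps)
  finally show ?case by simp
next
  case ("2_2" v)
  have "spaced k1 k2 [v] a b = PiE {v} (\<lambda>_. {a..<b})" by (auto simp: spaced_def)
  then show ?case by (simp add: card_PiE)
qed simp

text \<open>Both \<open>d\<close> and \<open>g\<close> lie strictly between \<open>- q\<close> and
  \<open>q\<close>, so a multiple of \<open>q\<close> equal to \<open>d - g\<close> is 0,
  \<open>q\<close> or \<open>- q\<close>; the three clauses exclude these.\<close>

lemma dvd_interval_iff:
  fixes d q :: int
  assumes d: "-q < d" "d < q" and q: "int k1 + int k2 < q"
  shows "(\<forall>g. - int k2 \<le> g \<and> g \<le> int k1 + int k2 \<longrightarrow> \<not> q dvd d - g) \<longleftrightarrow>
     (d < - int k2 \<or> d > int k1 + int k2) \<and> (d + q > int k1 + int k2) \<and> (d - q < - int k2)"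
    (is "?L \<longleftrightarrow> ?R")
proof
  assume L: ?L
  have 1: "d < - int k2 \<or> d > int k1 + int k2"
  proof (rule ccontr)
    assume "\<not> ?thesis" then show False using L[rule_format, of d] by simp
  qed
  have 2: "d + q > int k1 + int k2"
  proof (rule ccontr)
    assume "\<not> ?thesis" then show False using L[rule_format, of "d + q"] d by simp
  qed
  have 3: "d - q < - int k2"
  proof (rule ccontr)
    assume "\<not> ?thesis" then show False using L[rule_format, of "d - q"] d by simp
  qed
  show ?R using 1 2 3 by auto
next
  assume R: ?R
  show ?L
  proof (intro allI impI notI)
    fix g assume g: "- int k2 \<le> g \<and> g \<le> int k1 + int k2" and dv: "q dvd d - g"
    then obtain t where t: "d - g = q * t" by (auto elim: dvdE)
    have q0: "0 < q" using q by linarith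
    have "q * t < q * 2" "q * (-2) < q * t" using t g d q by linarith+
    then have "t < 2" "-2 < t" using q0 mult_less_cancel_left_pos[OF q0, of t 2] mult_less_cancel_left_pos[OF q0, of "-2" t] by auto
    then have "t = 0 \<or> t = 1 \<or> t = -1" by linarith
    then show False using t g R by auto
  qed
qed

lemma mem_gain_edges: "(i, j, g) \<in> gain_edges n a b \<longleftrightarrow> 1 \<le> i \<and> i < j \<and> j \<le> n \<and> a \<le> g \<and> g \<le> b"
  by (simp add: gain_edges_def)

lemma gain_coloring_iff:
  assumes q: "int k1 + int k2 < q" and x: "x \<in> PiE {1..n} (\<lambda>_. {0..<q})"
  shows "x \<in> colorings n q {} (gain_edges n (- int k2) (int k1 + int k2)) \<longleftrightarrow>
     (\<forall>i j. 1 \<le> i \<and> i < j \<and> j \<le> n \<longrightarrow> (x j - x i < - int k2 \<or> x j - x i > int k1 + int k2) \<and>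
         (x j - x i + q > int k1 + int k2) \<and> (x j - x i - q < - int k2))"
proof -
  have "x \<in> colorings n q {} (gain_edges n (- int k2) (int k1 + int k2)) \<longleftrightarrow>
     (\<forall>i j. 1 \<le> i \<and> i < j \<and> j \<le> n \<longrightarrow> (\<forall>g. - int k2 \<le> g \<and> g \<le> int k1 + int k2 \<longrightarrow> \<not> q dvd (x j - x i) - g))"
    using x by (simp add: colorings_def sat_mod_def gain_edges_def Ball_def split_paired_All) blast
  also have "\<dots> \<longleftrightarrow> (\<forall>i j. 1 \<le> i \<and> i < j \<and> j \<le> n \<longrightarrow> (x j - x i < - int k2 \<or> x j - x i > int k1 + int k2) \<and>
         (x j - x i + q > int k1 + int k2) \<and> (x j - x i - q < - int k2))"
  proof (intro all_cong1 imp_cong refl dvd_interval_iff q)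
    fix i j assume "1 \<le> i \<and> i < j \<and> j \<le> n"
    then show "- q < x j - x i" "x j - x i < q" using PiE_mem[OF x, of i] PiE_mem[OF x, of j] by auto
  qed
  finally show ?thesis .
qed

text \<open>With \<open>n\<close> at 0, the constraints involving \<open>n\<close> confine all other
  vertices to an interval. It stays so far from both ends of \<open>0..<q\<close> that the
  wrap-around constraints between two other vertices hold automatically.\<close>

lemma card_based_gain_colorings:
  assumes q: "int k1 + int k2 < q" and n: "n = Suc j"
  shows "card {x \<in> colorings n q {} (gain_edges n (- int k2) (int k1 + int k2)). x n = 0}
    = card {y \<in> PiE {1..j} (\<lambda>_. {int k2 + 1..<q - int k1 - int k2}).
         \<forall>u\<in>{1..j}. \<forall>w\<in>{1..j}. u < w \<longrightarrow> y w - y u > int k1 + int k2 \<or> y u - y w > int k2}"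
    (is "card ?A = card ?B")
proof -
  have q0: "0 < q" using q by linarith
  have ne: "i \<noteq> n" if "i \<in> {1..j}" for i using that n by auto
  have "bij_betw (\<lambda>x. x(n := undefined)) ?A ?B"
  proof (rule bij_betw_byWitness[where f' = "\<lambda>y. y(n := 0)"])
    show "\<forall>a\<in>?A. (a(n := undefined))(n := 0) = a" by auto
    show "\<forall>a'\<in>?B. (a'(n := 0))(n := undefined) = a'" using n by (auto simp: fun_eq_iff PiE_def extensional_def)
    show "(\<lambda>x. x(n := undefined)) ` ?A \<subseteq> ?B"
    proof (rule image_subsetI)
      fix x assume x: "x \<in> ?A"
      then have xE: "x \<in> PiE {1..n} (\<lambda>_. {0..<q})" by (auto simp: colorings_def)
      have c: "(x w - x u < - int k2 \<or> x w - x u > int k1 + int k2) \<and>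
         (x w - x u + q > int k1 + int k2) \<and> (x w - x u - q < - int k2)" if "1 \<le> u" "u < w" "w \<le> n" for u w
        using x gain_coloring_iff[OF q xE] that by blast
      have r: "int k2 + 1 \<le> x u \<and> x u < q - int k1 - int k2" if u: "u \<in> {1..j}" for u
        using c[of u n] u x n PiE_mem[OF xE, of u] by auto
      have "x(n := undefined) \<in> PiE {1..j} (\<lambda>_. {int k2 + 1..<q - int k1 - int k2})"
      proof (rule PiE_I)
        fix v assume "v \<in> {1..j}"
        then show "(x(n := undefined)) v \<in> {int k2 + 1..<q - int k1 - int k2}" using r[of v] ne[of v] by simp
      next
        fix v assume "v \<notin> {1..j}"
        then show "(x(n := undefined)) v = undefined" using PiE_arb[OF xE, of v] n by auto
      qed
      moreover have "\<forall>u\<in>{1..j}. \<forall>w\<in>{1..j}. u < w \<longrightarrow> (x(n := undefined)) w - (x(n := undefined)) u > int k1 + int k2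
           \<or> (x(n := undefined)) u - (x(n := undefined)) w > int k2"
      proof (intro ballI impI)
        fix u w assume uw: "u \<in> {1..j}" "w \<in> {1..j}" "u < w"
        show "(x(n := undefined)) w - (x(n := undefined)) u > int k1 + int k2
           \<or> (x(n := undefined)) u - (x(n := undefined)) w > int k2"
          using c[of u w] uw ne[of u] ne[of w] n by auto
      qed
      ultimately show "x(n := undefined) \<in> ?B" by simp
    qed
    show "(\<lambda>y. y(n := 0)) ` ?B \<subseteq> ?A"
    proof (rule image_subsetI)
      fix y assume y: "y \<in> ?B"
      let ?x = "y(n := 0)"
      have yE: "y \<in> PiE {1..j} (\<lambda>_. {int k2 + 1..<q - int k1 - int k2})" using y by simp
      have r: "int k2 + 1 \<le> y u \<and> y u < q - int k1 - int k2" if u: "u \<in> {1..j}" for u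
        using PiE_mem[OF yE u] by simp
      have xE: "?x \<in> PiE {1..n} (\<lambda>_. {0..<q})"
      proof (rule PiE_I)
        fix v assume "v \<in> {1..n}"
        then show "?x v \<in> {0..<q}" using r[of v] q0 n by (cases "v = n") auto
      next
        fix v assume "v \<notin> {1..n}"
        then show "?x v = undefined" using PiE_arb[OF yE, of v] n by auto
      qed
      have "?x \<in> colorings n q {} (gain_edges n (- int k2) (int k1 + int k2))"
        unfolding gain_coloring_iff[OF q xE]
      proof (intro allI impI)
        fix i k assume ik: "1 \<le> i \<and> i < k \<and> k \<le> n"
        then have i: "i \<in> {1..j}" "i \<noteq> n" using n by auto
        show "(?x k - ?x i < - int k2 \<or> ?x k - ?x i > int k1 + int k2) \<and>
         (?x k - ?x i + q > int k1 + int k2) \<and> (?x k - ?x i - q < - int k2)"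
        proof (cases "k = n")
          case True
          then show ?thesis using r[OF i(1)] i q0 by auto
        next
          case False
          then have k: "k \<in> {1..j}" using ik n by auto
          have "y k - y i > int k1 + int k2 \<or> y i - y k > int k2" using y i k ik by blast
          then show ?thesis using r[OF i(1)] r[OF k] i False by auto
        qed
      qed
      then show "?x \<in> ?A" by simp
    qed
  qed
  then show ?thesis by (rule bij_betw_same_card)
qed

text \<open>All gaps are positive, so the positions are distinct and each placement is sorted by
  exactly one permutation; in that order the pairwise conditions are the gap conditions.\<close>

lemma card_linear_spaced:
  assumes j: "1 \<le> j"
  shows "card {y \<in> PiE {1..j} (\<lambda>_. {a..<b}).
         \<forall>u\<in>{1..j}. \<forall>w\<in>{1..j}. u < w \<longrightarrow> y w - y u > int k1 + int k2 \<or> y u - y w > int k2}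
    = (\<Sum>xs\<in>permutations_of_set {1..j}. nat (b - a - int k2 * (int j - 1) - int k1 * int (asc xs)) choose j)"
    (is "card ?B = _")
proof -
  have fin: "finite (spaced k1 k2 xs a b)" for xs
    unfolding spaced_def by (rule finite_subset[of _ "PiE (set xs) (\<lambda>_. {a..<b})"]) (auto intro: finite_PiE)
  have "?B = (\<Union>xs\<in>permutations_of_set {1..j}. spaced k1 k2 xs a b)"
  proof (intro equalityI subsetI)
    fix y assume y: "y \<in> ?B"
    define xs where "xs = sort_key y (sorted_list_of_set {1..j})"
    have xs: "xs \<in> permutations_of_set {1..j}" by (auto simp: xs_def permutations_of_set_def)
    have st: "set xs = {1..j}" "distinct xs" using xs by (auto simp: permutations_of_set_def)
    have so: "sorted (map y xs)" by (simp add: xs_def)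
    have "sorted_wrt (\<lambda>u w. y u + gap k1 k2 u w \<le> y w) xs"
      unfolding sorted_wrt_iff_nth_less
    proof (intro allI impI)
      fix s t assume s: "s < t" and t: "t < length xs"
      have le: "y (xs ! s) \<le> y (xs ! t)" using sorted_nth_mono[OF so, of s t] s t by simp
      have mem: "xs ! s \<in> {1..j}" "xs ! t \<in> {1..j}" using nth_mem[of s xs] nth_mem[of t xs] s t unfolding st(1) by auto
      have "xs ! s \<noteq> xs ! t" using st s t by (simp add: nth_eq_iff_index_eq)
      then consider "xs ! s < xs ! t" | "xs ! t < xs ! s" by linarith
      then show "y (xs ! s) + gap k1 k2 (xs ! s) (xs ! t) \<le> y (xs ! t)"
      proof cases
        case 1
        then have "y (xs ! t) - y (xs ! s) > int k1 + int k2 \<or> y (xs ! s) - y (xs ! t) > int k2" using y mem by blast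
        then show ?thesis using le 1 by (auto simp: gap_def)
      next
        case 2
        then have "y (xs ! s) - y (xs ! t) > int k1 + int k2 \<or> y (xs ! t) - y (xs ! s) > int k2" using y mem by blast
        then show ?thesis using le 2 by (auto simp: gap_def)
      qed
    qed
    then have "y \<in> spaced k1 k2 xs a b" using y st by (simp add: spaced_def)
    then show "y \<in> (\<Union>xs\<in>permutations_of_set {1..j}. spaced k1 k2 xs a b)" using xs by blast
  next
    fix y assume "y \<in> (\<Union>xs\<in>permutations_of_set {1..j}. spaced k1 k2 xs a b)"
    then obtain xs where xs: "xs \<in> permutations_of_set {1..j}" and y: "y \<in> spaced k1 k2 xs a b" by blast
    have st: "set xs = {1..j}" "distinct xs" using xs by (auto simp: permutations_of_set_def)
    have so: "sorted_wrt (\<lambda>u w. y u + gap k1 k2 u w \<le> y w) xs" using y by (simp add: spaced_def)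
    have "y w - y u > int k1 + int k2 \<or> y u - y w > int k2" if "u \<in> {1..j}" "w \<in> {1..j}" "u < w" for u w
    proof -
      have "u \<in> set xs" "w \<in> set xs" using that st by auto
      then obtain s t where s: "s < length xs" "xs ! s = u" and t: "t < length xs" "xs ! t = w"
        unfolding in_set_conv_nth by blast
      have "s \<noteq> t" using s t that by auto
      then consider "s < t" | "t < s" by linarith
      then show ?thesis
      proof cases
        case 1
        then have "y u + gap k1 k2 u w \<le> y w" using so s t unfolding sorted_wrt_iff_nth_less by blast
        then show ?thesis using that by (simp add: gap_def)
      next
        case 2
        then have "y w + gap k1 k2 w u \<le> y u" using so s t unfolding sorted_wrt_iff_nth_less by blast
        then show ?thesis using that by (simp add: gap_def)
      qed
    qed
    then show "y \<in> ?B" using y st by (simp add: spaced_def)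
  qed
  also have "card \<dots> = (\<Sum>xs\<in>permutations_of_set {1..j}. card (spaced k1 k2 xs a b))"
  proof (rule card_UN_disjoint)
    show "\<forall>xs\<in>permutations_of_set {1..j}. \<forall>ys\<in>permutations_of_set {1..j}. xs \<noteq> ys \<longrightarrow>
      spaced k1 k2 xs a b \<inter> spaced k1 k2 ys a b = {}"
    proof (intro ballI impI, rule ccontr)
      fix xs ys assume p: "xs \<in> permutations_of_set {1..j}" "ys \<in> permutations_of_set {1..j}" "xs \<noteq> ys"
        and ne: "spaced k1 k2 xs a b \<inter> spaced k1 k2 ys a b \<noteq> {}"
      then obtain y where y: "y \<in> spaced k1 k2 xs a b" "y \<in> spaced k1 k2 ys a b" by blast
      have strict: "sorted_wrt (<) (map y zs)" if "y \<in> spaced k1 k2 zs a b" for zs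
        unfolding sorted_wrt_map
        by (rule sorted_wrt_mono_rel[of zs "\<lambda>u w. y u + gap k1 k2 u w \<le> y w"])
           (use that in \<open>auto simp: spaced_def gap_def split: if_splits\<close>)
      have st: "set xs = set ys" using p by (auto simp: permutations_of_set_def)
      have "map y xs = map y ys"
        by (rule strict_sorted_equal) (use strict[OF y(1)] strict[OF y(2)] st in auto)
      moreover have "inj_on y (set xs \<union> set ys)"
        using strict[OF y(1)] st by (simp add: strict_sorted_iff distinct_map)
      ultimately show False using p(3) inj_on_map_eq_map by blast
    qed
  qed (use fin in auto)
  also have "\<dots> = (\<Sum>xs\<in>permutations_of_set {1..j}. nat (b - a - int k2 * (int j - 1) - int k1 * int (asc xs)) choose j)"
  proof (intro sum.cong refl)
    fix xs assume xs: "xs \<in> permutations_of_set {1..j}"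
    then have "distinct xs" "length xs = j" using length_finite_permutations_of_set[OF xs] by (auto simp: permutations_of_set_def)
    moreover have "xs \<noteq> []" using j \<open>length xs = j\<close> by auto
    ultimately show "card (spaced k1 k2 xs a b) = nat (b - a - int k2 * (int j - 1) - int k1 * int (asc xs)) choose j"
      using card_spaced[of xs k1 k2 a b] by simp
  qed
  finally show ?thesis .
qed

lemma gedges_on_gain_edges: "gedges_on n (gain_edges n a b)"
  by (auto simp: gedges_on_def gain_edges_def)

lemma card_gain_colorings:
  assumes n: "n = Suc j" and j: "1 \<le> j" and q: "int (n * k2 + n * k1 + 1) \<le> q"
  shows "real (card (colorings n q {} (gain_edges n (- int k2) (int k1 + int k2))))
    = real_of_int q * ((- 1) ^ j * (\<Sum>xs\<in>permutations_of_set {1..j}.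
         rf j ((1 - real_of_int q) + real (n * k2) + real k1 + real k1 * real (asc xs))))"
proof -
  have q1: "int k1 + int k2 < q"
  proof -
    have "k1 \<le> n * k1" "k2 \<le> n * k2" using n by auto
    then show ?thesis using q by linarith
  qed
  have q0: "0 < q" using q1 by linarith
  let ?C = "colorings n q {} (gain_edges n (- int k2) (int k1 + int k2))"
  have "card ?C = nat q * card {x \<in> ?C. x n = 0}"
    by (rule card_colorings_rotate) (use q0 n gedges_on_gain_edges in auto)
  also have "card {x \<in> ?C. x n = 0} = (\<Sum>xs\<in>permutations_of_set {1..j}.
      nat (q - int k1 - int k2 - (int k2 + 1) - int k2 * (int j - 1) - int k1 * int (asc xs)) choose j)"
    unfolding card_based_gain_colorings[OF q1 n] by (rule card_linear_spaced[OF j])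
  finally have "real (card ?C) = real_of_int q * (\<Sum>xs\<in>permutations_of_set {1..j}.
      real (nat (q - int k1 - int k2 - (int k2 + 1) - int k2 * (int j - 1) - int k1 * int (asc xs)) choose j))"
    using q0 by simp
  also have "(\<Sum>xs\<in>permutations_of_set {1..j}.
      real (nat (q - int k1 - int k2 - (int k2 + 1) - int k2 * (int j - 1) - int k1 * int (asc xs)) choose j))
    = (\<Sum>xs\<in>permutations_of_set {1..j}. (- 1) ^ j *
         rf j ((1 - real_of_int q) + real (n * k2) + real k1 + real k1 * real (asc xs)))"
  proof (intro sum.cong refl)
    fix xs assume xs: "xs \<in> permutations_of_set {1..j}"
    have "asc xs \<le> j" using asc_le_length[of xs] length_finite_permutations_of_set[OF xs] by simp
    then have "k1 * (asc xs + 1) \<le> k1 * n" using n by (intro mult_left_mono) auto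
    define Z where "Z = q - int k1 - int k2 - (int k2 + 1) - int k2 * (int j - 1) - int k1 * int (asc xs)"
    have Zeq: "Z = q - 1 - int (n * k2) - int (k1 * (asc xs + 1))" by (simp add: Z_def n algebra_simps)
    \<comment> \<open>A permutation of \<open>{1..j}\<close> has at most \<open>j\<close> ascents,
      so \<open>asc xs + 1\<close> is at most \<open>n\<close>; this is the source of the bound
      \<open>n * k2 + n * k1 + 1\<close>. For negative \<open>Z\<close> the binomial coefficient
      would no longer be the polynomial in \<open>q\<close>.\<close>
    have Z0: "0 \<le> Z" 
    proof -
      have "int (n * k2) + int (k1 * n) + 1 \<le> q" using q by (simp add: mult.commute)
      moreover have "int (k1 * (asc xs + 1)) \<le> int (k1 * n)"
        using \<open>k1 * (asc xs + 1) \<le> k1 * n\<close> by (simp only: of_nat_le_iff)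
      ultimately show ?thesis unfolding Zeq by linarith
    qed
    have "real (nat Z choose j) = (real (nat Z)) gchoose j" by (rule binomial_gbinomial)
    also have "\<dots> = (- 1) ^ j * pochhammer (- real (nat Z)) j / fact j" by (rule gbinomial_pochhammer)
    also have "- real (nat Z) = (1 - real_of_int q) + real (n * k2) + real k1 + real k1 * real (asc xs)"
      using Z0 by (simp add: Zeq algebra_simps)
    finally show "real (nat (q - int k1 - int k2 - (int k2 + 1) - int k2 * (int j - 1) - int k1 * int (asc xs)) choose j)
      = (- 1) ^ j * rf j ((1 - real_of_int q) + real (n * k2) + real k1 + real k1 * real (asc xs))"
      by (simp add: Z_def rf_def)
  qed
  finally show ?thesis by (simp add: sum_distrib_left)
qed

section \<open>Forests and balanced circles\<close>

abbreviation src :: "gedge \<Rightarrow> nat" where "src e \<equiv> fst e"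
abbreviation tgt :: "gedge \<Rightarrow> nat" where "tgt e \<equiv> fst (snd e)"
abbreviation gn :: "gedge \<Rightarrow> int" where "gn e \<equiv> snd (snd e)"

definition conn :: "gedge set \<Rightarrow> nat \<Rightarrow> nat \<Rightarrow> bool" where "conn S u v \<longleftrightarrow> (u, v) \<in> (adj S)\<^sup>*"

lemma conn_refl [simp]: "conn S u u" by (simp add: conn_def)

lemma conn_trans: "conn S u v \<Longrightarrow> conn S v w \<Longrightarrow> conn S u w"
  unfolding conn_def by (rule rtrancl_trans)

lemma conn_sym: "conn S u v \<Longrightarrow> conn S v u"
proof -
  have "sym (adj S)" by (auto simp: sym_def adj_def)
  then show "conn S u v \<Longrightarrow> conn S v u" unfolding conn_def by (meson sym_rtrancl symD)
qed

lemma conn_mono: "conn S u v \<Longrightarrow> S \<subseteq> T \<Longrightarrow> conn T u v"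
  unfolding conn_def using rtrancl_mono[of "adj S" "adj T"] by (fastforce simp: adj_def)

lemma conn_edge: "e \<in> S \<Longrightarrow> conn S (src e) (tgt e)"
  unfolding conn_def by (rule r_into_rtrancl) (cases e; auto simp: adj_def)

lemma conn_step_invariant:
  assumes "conn S u v" "P u"
    and "\<And>e. e \<in> S \<Longrightarrow> P (src e) \<longleftrightarrow> P (tgt e)"
  shows "P v"
  using assms(1) unfolding conn_def
proof induction
  case (step y z)
  then obtain g where "(y, z, g) \<in> S \<or> (z, y, g) \<in> S" by (auto simp: adj_def)
  then show ?case using step assms(3) by force
qed (rule assms(2))

lemma conn_insert:
  "conn (insert e S) u v \<longleftrightarrow> conn S u v \<or> (conn S u (src e) \<and> conn S (tgt e) v) \<or> (conn S u (tgt e) \<and> conn S (src e) v)"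
    (is "?L \<longleftrightarrow> ?R v")
proof
  assume L: ?L
  show "?R v"
  \<comment> \<open>As a property of the end point, the right-hand side holds at \<open>u\<close>
    and is constant along every edge.\<close>
  proof (rule conn_step_invariant[OF L, where P = ?R])
    show "?R u" by simp
    fix f assume f: "f \<in> insert e S"
    show "?R (src f) \<longleftrightarrow> ?R (tgt f)"
    proof (cases "f = e")
      case True
      then show ?thesis by (meson conn_refl conn_trans conn_sym)
    next
      case False
      then have "conn S (src f) (tgt f)" using f by (auto intro: conn_edge)
      then have "conn S w (src f) \<longleftrightarrow> conn S w (tgt f)" for w by (meson conn_trans conn_sym)
      then show ?thesis by simp
    qed
  qed
next
  assume R: "?R v"
  have e: "conn (insert e S) (src e) (tgt e)" by (rule conn_edge) simp
  have m: "conn S a b \<Longrightarrow> conn (insert e S) a b" for a b by (erule conn_mono) auto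
  show ?L using R e m by (meson conn_trans conn_sym)
qed

text \<open>Every edge is a bridge. Loops and parallel edges violate this at once, and deletion and
  contraction can be handled without lists of vertices.\<close>

definition acyc :: "gedge set \<Rightarrow> bool" where
  "acyc S \<longleftrightarrow> (\<forall>e\<in>S. \<not> conn (S - {e}) (src e) (tgt e))"

lemma acyc_subset: "acyc S \<Longrightarrow> T \<subseteq> S \<Longrightarrow> acyc T"
  unfolding acyc_def using conn_mono[of "T - {_}" _ _ "S - {_}"] by (meson Diff_mono order_refl subsetD)

lemma acyc_insert:
  assumes S: "acyc S" and e: "\<not> conn S (src e) (tgt e)"
  shows "acyc (insert e S)"
  unfolding acyc_def
proof
  fix f assume f: "f \<in> insert e S"
  have eS: "e \<notin> S" using e conn_edge by blast
  show "\<not> conn (insert e S - {f}) (src f) (tgt f)"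
  proof (cases "f = e")
    case True
    then show ?thesis using e eS by simp
  next
    case False
    then have fS: "f \<in> S" using f by simp
    have eq: "insert e S - {f} = insert e (S - {f})" using False by auto
    have m: "conn (S - {f}) a b \<Longrightarrow> conn S a b" for a b by (erule conn_mono) auto
    show ?thesis
    proof
      assume "conn (insert e S - {f}) (src f) (tgt f)"
      then have "conn (S - {f}) (src f) (src e) \<and> conn (S - {f}) (tgt e) (tgt f)
         \<or> conn (S - {f}) (src f) (tgt e) \<and> conn (S - {f}) (src e) (tgt f)"
        using S fS unfolding eq conn_insert acyc_def by blast
      moreover have "conn S (src f) (tgt f)" using fS by (rule conn_edge)
      ultimately show False using e m by (meson conn_trans conn_sym)
    qed
  qed
qed

section \<open>Paths and their gains\<close>

definition gpath :: "gedge set \<Rightarrow> nat list \<Rightarrow> gedge list \<Rightarrow> bool" where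
  "gpath S vs es \<longleftrightarrow> length vs = Suc (length es) \<and> distinct vs \<and>
     (\<forall>t<length es. es ! t \<in> S \<and> ends (es ! t) = {vs ! t, vs ! Suc t})"

definition pgain :: "nat list \<Rightarrow> gedge list \<Rightarrow> int" where
  "pgain vs es = (\<Sum>t<length es. dgain (es ! t) (vs ! t))"

lemma gpath_mono: "gpath S vs es \<Longrightarrow> set es \<subseteq> T \<Longrightarrow> gpath T vs es"
  unfolding gpath_def by (auto dest: nth_mem)

lemma gpath_set: "gpath S vs es \<Longrightarrow> set es \<subseteq> S"
  unfolding gpath_def subset_iff in_set_conv_nth by metis

lemma gpath_distinct:
  assumes "gpath S vs es" shows "distinct es"
  unfolding distinct_conv_nth
proof (intro allI impI)
  fix s t assume st: "s < length es" "t < length es" "s \<noteq> t"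
  have l: "length vs = Suc (length es)" and d: "distinct vs" using assms by (auto simp: gpath_def)
  show "es ! s \<noteq> es ! t"
  proof
    assume eq: "es ! s = es ! t"
    have "{vs ! s, vs ! Suc s} = {vs ! t, vs ! Suc t}" using assms st eq unfolding gpath_def by metis
    then have "(vs ! s = vs ! t) \<or> (vs ! s = vs ! Suc t \<and> vs ! Suc s = vs ! t)" by (auto simp: doubleton_eq_iff)
    then show False using d l st by (auto simp: nth_eq_iff_index_eq)
  qed
qed

lemma gpath_conn:
  assumes "gpath S vs es" "t \<le> length es" shows "conn S (vs ! 0) (vs ! t)"
  using assms(2)
proof (induction t)
  case (Suc t)
  have e: "es ! t \<in> S" "ends (es ! t) = {vs ! t, vs ! Suc t}" using assms(1) Suc by (auto simp: gpath_def)
  have "conn S (vs ! t) (vs ! Suc t)"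
    using conn_edge[OF e(1)] e(2) conn_sym by (fastforce simp: ends_def doubleton_eq_iff)
  then show ?case using Suc conn_trans by auto
qed simp

lemma conn_imp_gpath:
  assumes "conn S u v"
  shows "\<exists>vs es. gpath S vs es \<and> vs ! 0 = u \<and> vs ! length es = v"
  using assms unfolding conn_def
proof induction
  case base
  show ?case by (rule exI[of _ "[u]"], rule exI[of _ "[]"]) (simp add: gpath_def)
next
  case (step y z)
  then obtain vs es where p: "gpath S vs es" "vs ! 0 = u" "vs ! length es = y" by auto
  have l: "length vs = Suc (length es)" and d: "distinct vs" using p by (auto simp: gpath_def)
  obtain g where g: "(y, z, g) \<in> S \<or> (z, y, g) \<in> S" using step by (auto simp: adj_def)
  then obtain e where e: "e \<in> S" "ends e = {y, z}" by (metis ends_def fst_conv snd_conv insert_commute)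
  show ?case
  proof (cases "z \<in> set vs")
    \<comment> \<open>If the new vertex already occurs, the path is cut back to it, which keeps the
      vertices distinct.\<close>
    case True
    then obtain t where t: "t < length vs" "vs ! t = z" by (auto simp: in_set_conv_nth)
    have "gpath S (take (Suc t) vs) (take t es)" using p l d t unfolding gpath_def by auto
    then show ?thesis using p t l by (intro exI[of _ "take (Suc t) vs"] exI[of _ "take t es"]) auto
  next
    case False
    have "gpath S (vs @ [z]) (es @ [e])"
      unfolding gpath_def
    proof (intro conjI allI impI)
      fix t assume t: "t < length (es @ [e])"
      show "(es @ [e]) ! t \<in> S" "ends ((es @ [e]) ! t) = {(vs @ [z]) ! t, (vs @ [z]) ! Suc t}"
        using t p e l by (cases "t = length es"; auto simp: gpath_def nth_append)+
    qed (use l d False in auto)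
    then show ?thesis using p l by (intro exI[of _ "vs @ [z]"] exI[of _ "es @ [e]"]) (auto simp: nth_append)
  qed
qed

text \<open>\<open>P\<close> stands for membership in an additive subgroup: being a multiple of
  \<open>q\<close> for colourings, being 0 for points of the arrangement. Summing the edge equations
  along the path gives both uses at once.\<close>

lemma gpath_potential:
  fixes x :: "nat \<Rightarrow> 'a::ring_1"
  assumes p: "gpath S vs es"
    and P: "P 0" "\<And>a b. P a \<Longrightarrow> P b \<Longrightarrow> P (a + b)" "\<And>a. P a \<Longrightarrow> P (- a)"
    and S: "\<And>e. e \<in> S \<Longrightarrow> P (x (tgt e) - x (src e) - of_int (gn e))"
  shows "P (x (vs ! length es) - x (vs ! 0) - of_int (pgain vs es))"
proof -
  have "t \<le> length es \<Longrightarrow> P (x (vs ! t) - x (vs ! 0) - of_int (\<Sum>s<t. dgain (es ! s) (vs ! s)))" for t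
  proof (induction t)
    case (Suc t)
    have e: "es ! t \<in> S" "ends (es ! t) = {vs ! t, vs ! Suc t}" using p Suc by (auto simp: gpath_def)
    have ne: "vs ! t \<noteq> vs ! Suc t" using p Suc by (auto simp: gpath_def nth_eq_iff_index_eq)
    have "P (x (vs ! Suc t) - x (vs ! t) - of_int (dgain (es ! t) (vs ! t)))"
    proof (cases "src (es ! t) = vs ! t")
      case True
      then have "tgt (es ! t) = vs ! Suc t" using e(2) ne by (auto simp: ends_def doubleton_eq_iff)
      then show ?thesis using S[OF e(1)] True by (simp add: dgain_def)
    next
      case False
      then have "src (es ! t) = vs ! Suc t" "tgt (es ! t) = vs ! t" using e(2) ne by (auto simp: ends_def doubleton_eq_iff)
      then show ?thesis using P(3)[OF S[OF e(1)]] False by (simp add: dgain_def algebra_simps)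
    qed
    from P(2)[OF this Suc.IH] show ?case using Suc.prems by (simp add: algebra_simps)
  qed (use P in simp)
  from this[of "length es"] show ?thesis by (simp add: pgain_def)
qed

text \<open>\<open>e\<close> closes a balanced circle with a path in \<open>S\<close>, so its
  equation follows from those of \<open>S\<close>.\<close>

definition gspan :: "gedge set \<Rightarrow> gedge \<Rightarrow> bool" where
  "gspan S e \<longleftrightarrow> (\<exists>vs es. gpath S vs es \<and> ends e = {vs ! 0, vs ! length es} \<and>
      pgain vs es + dgain e (vs ! length es) = 0)"

lemma gspan_conn: "gspan S e \<Longrightarrow> conn S (src e) (tgt e)"
proof -
  assume "gspan S e"
  then obtain vs es where "gpath S vs es" "ends e = {vs ! 0, vs ! length es}" by (auto simp: gspan_def)
  then show ?thesis using gpath_conn[of S vs es "length es"] conn_sym by (fastforce simp: ends_def doubleton_eq_iff)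
qed

text \<open>Modulo the subgroup given by \<open>P\<close>, the defect of \<open>e\<close> equals the
  gain of the closed walk up to sign.\<close>

lemma path_edge_potential:
  fixes x :: "nat \<Rightarrow> 'a::ring_1"
  assumes p: "gpath S vs es" and ee: "ends e = {vs ! 0, vs ! length es}" and ne: "src e \<noteq> tgt e"
    and P: "P 0" "\<And>a b. P a \<Longrightarrow> P b \<Longrightarrow> P (a + b)" "\<And>a. P a \<Longrightarrow> P (- a)"
    and S: "\<And>e. e \<in> S \<Longrightarrow> P (x (tgt e) - x (src e) - of_int (gn e))"
  shows "P (x (tgt e) - x (src e) - of_int (gn e)) \<longleftrightarrow> P (of_int (pgain vs es + dgain e (vs ! length es)))"
proof -
  let ?m = "length es"
  have a: "P (x (vs ! ?m) - x (vs ! 0) - of_int (pgain vs es))" (is "P ?a")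
    by (rule gpath_potential[OF p, of P]) (use P S in auto)
  have cancel: "P b \<longleftrightarrow> P c" if "P (b + c)" for b c
  proof
    assume "P b" from P(2)[OF that P(3)[OF this]] show "P c" by simp
  next
    assume "P c" from P(2)[OF that P(3)[OF this]] show "P b" by simp
  qed
  have neg: "P (- b) \<longleftrightarrow> P b" for b using P(3)[of b] P(3)[of "- b"] by auto
  show ?thesis
  proof (cases "src e = vs ! ?m")
    case True
    then have "tgt e = vs ! 0" using ee ne by (auto simp: ends_def doubleton_eq_iff)
    then have "(x (tgt e) - x (src e) - of_int (gn e)) + of_int (pgain vs es + dgain e (vs ! ?m)) = - ?a"
      using True by (simp add: dgain_def)
    then show ?thesis using cancel P(3)[OF a] by metis
  next
    case False
    then have "src e = vs ! 0" "tgt e = vs ! ?m" using ee ne by (auto simp: ends_def doubleton_eq_iff)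
    then have "(x (tgt e) - x (src e) - of_int (gn e)) + (- of_int (pgain vs es + dgain e (vs ! ?m))) = ?a"
      using False by (simp add: dgain_def)
    then show ?thesis using cancel[of _ "- of_int _"] a neg by metis
  qed
qed

lemma gpath_circle:
  assumes p: "gpath S vs es" and e: "ends e = {vs ! 0, vs ! length es}" "src e \<noteq> tgt e" "e \<notin> set es"
  shows "circle_seq vs (es @ [e])"
    and "(\<Sum>t<length vs. dgain ((es @ [e]) ! t) (vs ! t)) = pgain vs es + dgain e (vs ! length es)"
proof -
  let ?m = "length es"
  have l: "length vs = Suc ?m" and d: "distinct vs" using p by (auto simp: gpath_def)
  have m: "?m \<noteq> 0" using e by (auto simp: ends_def doubleton_eq_iff)
  show "circle_seq vs (es @ [e])"
    unfolding circle_seq_def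
  proof (intro conjI allI impI)
    show "distinct (es @ [e])" using gpath_distinct[OF p] e by simp
    fix t assume t: "t < length vs"
    show "ends ((es @ [e]) ! t) = {vs ! t, vs ! ((t + 1) mod length vs)}"
    proof (cases "t = ?m")
      case True
      then show ?thesis using e l by (simp add: insert_commute)
    next
      case False
      then have "t < ?m" using t l by simp
      then show ?thesis using p l by (simp add: gpath_def nth_append)
    qed
  qed (use l d m in \<open>auto simp: Suc_le_eq\<close>)
  show "(\<Sum>t<length vs. dgain ((es @ [e]) ! t) (vs ! t)) = pgain vs es + dgain e (vs ! length es)"
    unfolding l by (simp add: pgain_def nth_append)
qed

text \<open>The edge to be singled out, such as the smallest one, may stand anywhere in the list of
  a circle; rotating the list puts it last and leaves a path with the same total gain.\<close>

lemma circle_gpath: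
  assumes c: "circle_seq vs es" and e: "e \<in> set es"
  shows "\<exists>vs' es'. gpath (set es - {e}) vs' es' \<and> ends e = {vs' ! 0, vs' ! length es'} \<and>
     pgain vs' es' + dgain e (vs' ! length es') = (\<Sum>t<length vs. dgain (es ! t) (vs ! t))"
proof -
  obtain k where k: "k < length es" "es ! k = e" using e by (auto simp: in_set_conv_nth)
  define L where "L = length vs"
  have L2: "2 \<le> L" and le: "length es = L" and dv: "distinct vs" and de: "distinct es"
    and en: "\<And>t. t < L \<Longrightarrow> ends (es ! t) = {vs ! t, vs ! ((t + 1) mod L)}"
    using c by (auto simp: circle_seq_def L_def)
  \<comment> \<open>The rotation starts just after position \<open>k\<close>, so that
    \<open>e\<close> receives the last index \<open>L - 1\<close>.\<close>
  define r where "r = (\<lambda>t. (Suc k + t) mod L)"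
  have rL: "r t < L" for t using L2 by (simp add: r_def)
  have rinj: "r s = r t \<longleftrightarrow> s = t" if "s < L" "t < L" for s t
  proof
    have aux: "s = t" if "s \<le> t" "t < L" "r s = r t" for s t
    proof -
      have "L dvd (Suc k + t) - (Suc k + s)" using that(3) unfolding r_def by (metis mod_eq_dvd_iff_nat add_le_mono order_refl that(1))
      then have "L dvd t - s" by simp
      then show ?thesis using that by (auto dest: dvd_imp_le)
    qed
    assume "r s = r t"
    then show "s = t" using aux[of s t] aux[of t s] that by (cases "s \<le> t") auto
  qed simp
  have rk: "r (L - 1) = k" using k le L2 by (simp add: r_def)
  have rS: "r (Suc t) = (r t + 1) mod L" for t by (simp add: r_def mod_Suc_eq)
  define vs' where "vs' = map (\<lambda>t. vs ! r t) [0..<L]"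
  define es' where "es' = map (\<lambda>t. es ! r t) [0..<L - 1]"
  have le': "length es' = L - 1" by (simp add: es'_def)
  have v': "vs' ! t = vs ! r t" if "t < L" for t using that by (simp add: vs'_def)
  have e': "es' ! t = es ! r t" if "t < L - 1" for t using that by (simp add: es'_def)
  have g: "gpath (set es - {e}) vs' es'"
    unfolding gpath_def
  proof (intro conjI allI impI)
    show "length vs' = Suc (length es')" using L2 by (simp add: vs'_def es'_def)
    show "distinct vs'"
      unfolding vs'_def using dv rL rinj by (auto simp: distinct_map inj_on_def L_def nth_eq_iff_index_eq)
    fix t assume t: "t < length es'"
    then have t': "t < L - 1" "t < L" "Suc t < L" by (auto simp: le')
    have "r t \<noteq> k" using rinj[of t "L - 1"] rk t' L2 by auto
    then show "es' ! t \<in> set es - {e}"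
      using e'[OF t'(1)] rL[of t] k de le by (auto simp: nth_eq_iff_index_eq)
    show "ends (es' ! t) = {vs' ! t, vs' ! Suc t}"
      using e'[OF t'(1)] v'[OF t'(2)] v'[OF t'(3)] en[OF rL[of t]] rS[of t] by simp
  qed
  have z: "vs' ! 0 = vs ! ((k + 1) mod L)" "vs' ! length es' = vs ! k"
    using v'[of 0] v'[of "L - 1"] L2 rk by (auto simp: le' r_def)
  have "ends e = {vs' ! 0, vs' ! length es'}" using en[of k] k le z by (auto simp: insert_commute)
  moreover have "pgain vs' es' + dgain e (vs' ! length es') = (\<Sum>t<length vs. dgain (es ! t) (vs ! t))"
  proof -
    have "pgain vs' es' = (\<Sum>t<L - 1. dgain (es ! r t) (vs ! r t))"
      unfolding pgain_def le' by (intro sum.cong) (auto simp: e' v')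
    moreover have "dgain e (vs' ! length es') = dgain (es ! r (L - 1)) (vs ! r (L - 1))" using z k rk by simp
    ultimately have "pgain vs' es' + dgain e (vs' ! length es') = (\<Sum>t<Suc (L - 1). dgain (es ! r t) (vs ! r t))" by simp
    also have "\<dots> = (\<Sum>t<L. dgain (es ! r t) (vs ! r t))" using L2 by simp
    also have "\<dots> = (\<Sum>t<L. dgain (es ! t) (vs ! t))"
    proof (rule sum.reindex_bij_betw)
      have "inj_on r {..<L}" using rinj by (auto simp: inj_on_def)
      moreover have "r ` {..<L} \<subseteq> {..<L}" using rL by auto
      ultimately show "bij_betw r {..<L} {..<L}" by (simp add: bij_betw_def endo_inj_surj)
    qed
    finally show ?thesis by (simp add: L_def)
  qed
  ultimately show ?thesis using g by blast
qed

section \<open>Forests, broken circuits and activity in terms of connectivity\<close>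

definition loopless :: "gedge set \<Rightarrow> bool" where "loopless E \<longleftrightarrow> (\<forall>e\<in>E. src e \<noteq> tgt e)"

lemma is_forest_iff:
  assumes E: "loopless E"
  shows "is_forest E S \<longleftrightarrow> S \<subseteq> E \<and> acyc S"
proof
  assume f: "is_forest E S"
  then have SE: "S \<subseteq> E" by (simp add: is_forest_def)
  have "acyc S" unfolding acyc_def
  proof (intro ballI notI)
    fix e assume e: "e \<in> S" "conn (S - {e}) (src e) (tgt e)"
    then obtain vs es where p: "gpath (S - {e}) vs es" "vs ! 0 = src e" "vs ! length es = tgt e"
      using conn_imp_gpath by blast
    have "circle_seq vs (es @ [e])"
      by (rule gpath_circle[OF p(1)]) (use p e SE E gpath_set[OF p(1)] in \<open>auto simp: ends_def loopless_def\<close>)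
    moreover have "set (es @ [e]) \<subseteq> S" using gpath_set[OF p(1)] e by auto
    ultimately show False using f SE unfolding is_forest_def is_circle_def by blast
  qed
  then show "S \<subseteq> E \<and> acyc S" using SE by simp
next
  assume S: "S \<subseteq> E \<and> acyc S"
  have "\<not> is_circle E C" if C: "C \<subseteq> S" for C
  proof
    assume "is_circle E C"
    then obtain vs es where c: "circle_seq vs es" "set es = C" by (auto simp: is_circle_def)
    then have "es \<noteq> []" by (auto simp: circle_seq_def)
    then have e: "hd es \<in> set es" by simp
    obtain vs' es' where p: "gpath (set es - {hd es}) vs' es'" "ends (hd es) = {vs' ! 0, vs' ! length es'}"
      using circle_gpath[OF c(1) e] by blast
    have "conn (set es - {hd es}) (src (hd es)) (tgt (hd es))"
      using gpath_conn[OF p(1), of "length es'"] p(2) conn_sym by (fastforce simp: ends_def doubleton_eq_iff)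
    then have "conn (S - {hd es}) (src (hd es)) (tgt (hd es))" by (rule conn_mono) (use c C in auto)
    then show False using S e c C by (auto simp: acyc_def)
  qed
  then show "is_forest E S" using S by (auto simp: is_forest_def)
qed

text \<open>Injectivity of \<open>ord\<close> makes the rest of a circle strictly larger than its
  smallest edge \<open>e\<close>, so a broken circuit in \<open>S\<close> is a path of edges of
  \<open>S\<close> larger than \<open>e\<close> that is closed by \<open>e\<close> with gain 0. The
  condition at \<open>e\<close> therefore depends only on larger edges.\<close>

lemma nbc_set_iff:
  assumes E: "loopless E" and inj: "inj_on ord E"
  shows "nbc_set E ord S \<longleftrightarrow> S \<subseteq> E \<and> acyc S \<and> (\<forall>e\<in>E. \<not> gspan {f \<in> S. ord f > ord e} e)"
proof -
  have "(\<forall>C. balanced_circle E C \<longrightarrow> \<not> broken_circuit ord C \<subseteq> S) \<longleftrightarrow> (\<forall>e\<in>E. \<not> gspan {f \<in> S. ord f > ord e} e)"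
    if SE: "S \<subseteq> E"
  proof
    assume A: "\<forall>C. balanced_circle E C \<longrightarrow> \<not> broken_circuit ord C \<subseteq> S"
    show "\<forall>e\<in>E. \<not> gspan {f \<in> S. ord f > ord e} e"
    proof (intro ballI notI)
      fix e assume e: "e \<in> E" "gspan {f \<in> S. ord f > ord e} e"
      then obtain vs es where p: "gpath {f \<in> S. ord f > ord e} vs es" "ends e = {vs ! 0, vs ! length es}"
        "pgain vs es + dgain e (vs ! length es) = 0" by (auto simp: gspan_def)
      have ss: "set es \<subseteq> {f \<in> S. ord f > ord e}" by (rule gpath_set[OF p(1)])
      have ne: "src e \<noteq> tgt e" "e \<notin> set es" using e E ss by (auto simp: loopless_def)
      have "balanced_circle E (set (es @ [e]))"
        unfolding balanced_circle_def
      proof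
        show "set (es @ [e]) \<subseteq> E" using ss SE e by auto
        show "\<exists>vs' es'. circle_seq vs' es' \<and> set es' = set (es @ [e]) \<and> (\<Sum>t<length vs'. dgain (es' ! t) (vs' ! t)) = 0"
          using gpath_circle[OF p(1,2) ne] p(3) by (intro exI[of _ vs] exI[of _ "es @ [e]"]) auto
      qed
      moreover have "broken_circuit ord (set (es @ [e])) \<subseteq> S"
        using ss by (fastforce simp: broken_circuit_def)
      ultimately show False using A by blast
    qed
  next
    assume A: "\<forall>e\<in>E. \<not> gspan {f \<in> S. ord f > ord e} e"
    show "\<forall>C. balanced_circle E C \<longrightarrow> \<not> broken_circuit ord C \<subseteq> S"
    proof (intro allI impI notI)
      fix C assume C: "balanced_circle E C" "broken_circuit ord C \<subseteq> S"
      then obtain vs es where c: "C \<subseteq> E" "circle_seq vs es" "set es = C" "(\<Sum>t<length vs. dgain (es ! t) (vs ! t)) = 0"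
        by (auto simp: balanced_circle_def)
      have ne: "C \<noteq> {}" "finite C" using c by (auto simp: circle_seq_def)
      obtain e where e: "e \<in> C" "\<And>f. f \<in> C \<Longrightarrow> ord e \<le> ord f"
        using ne by (metis arg_min_if_finite(1) arg_min_least)
      obtain vs' es' where p: "gpath (set es - {e}) vs' es'" "ends e = {vs' ! 0, vs' ! length es'}"
        "pgain vs' es' + dgain e (vs' ! length es') = 0"
        using circle_gpath[OF c(2)] e c by metis
      have "set es - {e} \<subseteq> {f \<in> S. ord f > ord e}"
      proof
        fix f assume f: "f \<in> set es - {e}"
        then have "ord f \<noteq> ord e" using inj c e by (auto simp: inj_on_def)
        then have "ord f > ord e" using e f c by (metis DiffD1 le_neq_implies_less)
        then show "f \<in> {f \<in> S. ord f > ord e}" using f e c C by (auto simp: broken_circuit_def)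
      qed
      then have "gpath {f \<in> S. ord f > ord e} vs' es'" using p(1) gpath_mono gpath_set by (meson subset_trans)
      then show False using A e c p by (auto simp: gspan_def)
    qed
  qed
  then show ?thesis unfolding nbc_set_def is_forest_iff[OF E] by blast
qed

definition spans :: "nat \<Rightarrow> gedge set \<Rightarrow> bool" where
  "spans n S \<longleftrightarrow> (\<forall>u\<in>{1..n}. \<forall>v\<in>{1..n}. conn S u v)"

lemma spanning_tree_iff:
  "loopless E \<Longrightarrow> spanning_tree n E S \<longleftrightarrow> S \<subseteq> E \<and> acyc S \<and> spans n S"
  by (simp add: spanning_tree_def is_forest_iff spans_def conn_def)

lemma nbc_basis_iff:
  "loopless E \<Longrightarrow> inj_on ord E \<Longrightarrow> nbc_basis n E ord B \<longleftrightarrow>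
    B \<subseteq> E \<and> acyc B \<and> spans n B \<and> (\<forall>e\<in>E. \<not> gspan {f \<in> B. ord f > ord e} e)"
  by (auto simp: nbc_basis_def nbc_set_iff spanning_tree_iff)

lemma spans_exchange:
  assumes sp: "spans n B" and f: "src f \<in> {1..n}" "tgt f \<in> {1..n}"
    and nc: "\<not> conn (B - {e}) (src f) (tgt f)" and eB: "e \<in> B"
  shows "spans n (insert f (B - {e}))"
proof -
  let ?C = "B - {e}"
  have B: "B = insert e ?C" using eB by auto
  have "conn ?C u (src e) \<or> conn ?C u (tgt e)" if "u \<in> {1..n}" for u
  proof -
    have "conn (insert e ?C) u (src f)" "conn (insert e ?C) u (tgt f)" using sp that f B by (auto simp: spans_def)
    then show ?thesis unfolding conn_insert using nc by (meson conn_sym conn_trans)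
  qed
  then have fe: "conn ?C u (src f) \<or> conn ?C u (tgt f)" if "u \<in> {1..n}" for u
    using f nc that by (meson conn_sym conn_trans)
  show ?thesis unfolding spans_def conn_insert
    using fe by (meson conn_sym conn_trans)
qed

text \<open>Removing \<open>e\<close> splits the tree into two parts, and \<open>f\<close> repairs
  it exactly when it crosses between them. An \<open>f\<close> already present in the rest does not
  cross, and the rest alone does not span.\<close>

lemma exchange_spanning_tree_iff:
  assumes E: "loopless E" and on: "gedges_on n E" and B: "B \<subseteq> E" "acyc B" "spans n B"
    and e: "e \<in> B" and f: "f \<in> E"
  shows "spanning_tree n E ((B - {e}) \<union> {f}) \<longleftrightarrow> \<not> conn (B - {e}) (src f) (tgt f)"
proof
  assume st: "spanning_tree n E ((B - {e}) \<union> {f})"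
  have ac: "acyc (insert f (B - {e}))" and sp: "spans n (insert f (B - {e}))"
    using st by (auto simp: spanning_tree_iff[OF E])
  show "\<not> conn (B - {e}) (src f) (tgt f)"
  proof
    assume c: "conn (B - {e}) (src f) (tgt f)"
    show False
    proof (cases "f \<in> B - {e}")
      case True
      have "src e \<in> {1..n}" "tgt e \<in> {1..n}" using e B on by (auto simp: gedges_on_def)
      then have "conn (insert f (B - {e})) (src e) (tgt e)" using sp by (auto simp: spans_def)
      then have "conn (B - {e}) (src e) (tgt e)" using True by (simp add: insert_absorb)
      then show False using B e by (auto simp: acyc_def)
    next
      case False
      then have "insert f (B - {e}) - {f} = B - {e}" by auto
      then show False using ac c unfolding acyc_def by (metis insertI1)
    qed
  qed
next
  assume nc: "\<not> conn (B - {e}) (src f) (tgt f)"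
  have "acyc (insert f (B - {e}))" by (rule acyc_insert[OF acyc_subset[OF B(2)] nc]) auto
  moreover have "spans n (insert f (B - {e}))"
    by (rule spans_exchange) (use B f on nc e in \<open>auto simp: gedges_on_def\<close>)
  ultimately show "spanning_tree n E ((B - {e}) \<union> {f})" using B f by (auto simp: spanning_tree_iff[OF E])
qed

lemma active_iff:
  assumes "loopless E" "gedges_on n E" "B \<subseteq> E" "acyc B" "spans n B" "e \<in> B"
  shows "active n E ord B e \<longleftrightarrow> (\<forall>f\<in>E. \<not> conn (B - {e}) (src f) (tgt f) \<longrightarrow> ord e \<le> ord f)"
  using assms exchange_spanning_tree_iff[OF assms] by (auto simp: active_def)

section \<open>Deletion and contraction\<close>

text \<open>Bases of the gain graph \<open>E\<close> with the edges of \<open>D\<close> contracted. No vertices are identified: a basis keeps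
  \<open>D\<close> as a subset, and colourings and cells are restricted to the points satisfying the equations of \<open>D\<close>.\<close>

definition nb :: "nat \<Rightarrow> (gedge \<Rightarrow> nat) \<Rightarrow> gedge set \<Rightarrow> gedge set \<Rightarrow> gedge set set" where
  "nb n ord D E = {B. D \<subseteq> B \<and> B \<subseteq> D \<union> E \<and> acyc B \<and> spans n B \<and> (\<forall>e\<in>E. \<not> gspan {f \<in> B. ord f > ord e} e)}"

text \<open>Contracted edges are neither counted nor offered for exchange.\<close>

definition act_in :: "(gedge \<Rightarrow> nat) \<Rightarrow> gedge set \<Rightarrow> gedge set \<Rightarrow> nat" where
  "act_in ord E B = card {b \<in> B \<inter> E. \<forall>f\<in>E. \<not> conn (B - {b}) (src f) (tgt f) \<longrightarrow> ord b \<le> ord f}"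

definition nbpoly :: "nat \<Rightarrow> (gedge \<Rightarrow> nat) \<Rightarrow> gedge set \<Rightarrow> gedge set \<Rightarrow> real \<Rightarrow> real" where
  "nbpoly n ord D E y = (\<Sum>B\<in>nb n ord D E. y ^ act_in ord E B)"

lemma nb_empty: "acyc D \<Longrightarrow> spans n D \<Longrightarrow> nb n ord D {} = {D}"
  by (auto simp: nb_def)

lemma finite_nb: "finite D \<Longrightarrow> finite E \<Longrightarrow> finite (nb n ord D E)"
  unfolding nb_def by (rule finite_subset[of _ "Pow (D \<union> E)"]) auto

text \<open>Contracted edges rank above \<open>e\<close> and remaining ones below, so the NBC
  condition at \<open>e\<close> is a condition on \<open>D\<close> alone, the same for every
  candidate basis.\<close>

lemma greater_eq_contracted:
  fixes ord :: "gedge \<Rightarrow> nat"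
  assumes "D \<subseteq> B" "B \<subseteq> D \<union> insert e E" "\<forall>f\<in>E. ord f < ord e" "\<forall>d\<in>D. ord e < ord d"
  shows "{f \<in> B. ord f > ord e} = D"
proof (intro set_eqI iffI)
  fix f assume f: "f \<in> {f \<in> B. ord f > ord e}"
  then have "f \<in> D \<union> insert e E" using assms(2) by blast
  moreover have "f \<noteq> e" "f \<notin> E" using f bspec[OF assms(3), of f] by auto
  ultimately show "f \<in> D" by blast
next
  fix f assume "f \<in> D"
  then show "f \<in> {f \<in> B. ord f > ord e}" using assms by blast
qed

context
  fixes n :: nat and ord :: "gedge \<Rightarrow> nat" and D E :: "gedge set" and e :: gedge
  assumes less: "\<forall>f\<in>E. ord f < ord e" and gr: "\<forall>d\<in>D. ord e < ord d"
begin

lemma nb_insert_gspan: "gspan D e \<Longrightarrow> nb n ord D (insert e E) = {}"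
  using greater_eq_contracted[OF _ _ less gr] by (auto simp: nb_def)

lemma nb_insert:
  assumes "\<not> gspan D e"
  shows "nb n ord D (insert e E) = nb n ord D E \<union> nb n ord (insert e D) E"
proof (intro equalityI subsetI)
  fix B assume B: "B \<in> nb n ord D (insert e E)"
  show "B \<in> nb n ord D E \<union> nb n ord (insert e D) E"
    using B by (cases "e \<in> B") (auto simp: nb_def)
next
  fix B assume B: "B \<in> nb n ord D E \<union> nb n ord (insert e D) E"
  have "{f \<in> B. ord f > ord e} = D" by (rule greater_eq_contracted[OF _ _ less gr]) (use B in \<open>auto simp: nb_def\<close>)
  then show "B \<in> nb n ord D (insert e E)" using B assms by (auto simp: nb_def)
qed

lemma nb_disconnected:
  assumes "src e \<in> {1..n}" "tgt e \<in> {1..n}" "\<not> conn (D \<union> E) (src e) (tgt e)"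
  shows "nb n ord D E = {}"
proof (rule ccontr)
  assume "nb n ord D E \<noteq> {}"
  then obtain B where B: "B \<subseteq> D \<union> E" "spans n B" by (auto simp: nb_def)
  then have "conn B (src e) (tgt e)" using assms by (auto simp: spans_def)
  then show False using assms B conn_mono by blast
qed

lemma act_in_delete: "e \<notin> B \<Longrightarrow> act_in ord (insert e E) B = act_in ord E B"
  unfolding act_in_def using less by (intro arg_cong[where f = card]) (auto simp: less_imp_le)

text \<open>All of \<open>E\<close> is smaller than \<open>e\<close>, so \<open>e\<close> is active
  exactly when no edge of \<open>E\<close> crosses the cut it leaves, that is, when \<open>e\<close>
  is an isthmus. For the other edges the larger \<open>e\<close> is no competitor.\<close>

lemma act_in_contract:
  assumes fin: "finite D" "finite E" and B: "B \<in> nb n ord (insert e D) E" and on: "gedges_on n E"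
  shows "act_in ord (insert e E) B = act_in ord E B + of_bool (\<not> conn (D \<union> E) (src e) (tgt e))"
proof -
  have eE: "e \<notin> E" "e \<notin> D" using less gr by auto
  have B': "insert e D \<subseteq> B" "B \<subseteq> insert e D \<union> E" "acyc B" "spans n B" using B by (auto simp: nb_def)
  have Beq: "B = insert e (B - {e})" using B' by auto
  have act: "(\<forall>f\<in>E. conn (B - {e}) (src f) (tgt f)) \<longleftrightarrow> \<not> conn (D \<union> E) (src e) (tgt e)"
  proof
    assume A: "\<forall>f\<in>E. conn (B - {e}) (src f) (tgt f)"
    show "\<not> conn (D \<union> E) (src e) (tgt e)"
    proof
      assume c: "conn (D \<union> E) (src e) (tgt e)"
      have "conn (B - {e}) (src f) (tgt f)" if "f \<in> D \<union> E" for f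
        using that A B' eE conn_edge[of f "B - {e}"] by blast
      then have "conn (B - {e}) (src e) (tgt e)"
        using conn_step_invariant[OF c, of "conn (B - {e}) (src e)"] by (meson conn_refl conn_sym conn_trans)
      then show False using B' by (auto simp: acyc_def)
    qed
  next
    assume nc: "\<not> conn (D \<union> E) (src e) (tgt e)"
    show "\<forall>f\<in>E. conn (B - {e}) (src f) (tgt f)"
    proof (rule ballI, rule ccontr)
      fix f assume f: "f \<in> E" and nf: "\<not> conn (B - {e}) (src f) (tgt f)"
      have "conn (insert e (B - {e})) (src f) (tgt f)"
        using B'(4) f on Beq by (auto simp: spans_def gedges_on_def)
      then have "conn (B - {e}) (src f) (src e) \<and> conn (B - {e}) (tgt e) (tgt f)
         \<or> conn (B - {e}) (src f) (tgt e) \<and> conn (B - {e}) (src e) (tgt f)"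
        unfolding conn_insert using nf by blast
      moreover have "conn (B - {e}) a b \<Longrightarrow> conn (D \<union> E) a b" for a b by (erule conn_mono) (use B' in auto)
      moreover have "conn (D \<union> E) (src f) (tgt f)" using f by (auto intro: conn_edge)
      ultimately show False using nc by (meson conn_sym conn_trans)
    qed
  qed
  let ?A = "{b \<in> B \<inter> E. \<forall>f\<in>E. \<not> conn (B - {b}) (src f) (tgt f) \<longrightarrow> ord b \<le> ord f}"
  have "{b \<in> B \<inter> insert e E. \<forall>f\<in>insert e E. \<not> conn (B - {b}) (src f) (tgt f) \<longrightarrow> ord b \<le> ord f}
     = (if \<not> conn (D \<union> E) (src e) (tgt e) then insert e ?A else ?A)" (is "?L = ?R")
  proof (rule set_eqI)
    fix b
    show "b \<in> ?L \<longleftrightarrow> b \<in> ?R"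
    proof (cases "b = e")
      case True
      have "b \<in> ?L \<longleftrightarrow> (\<forall>f\<in>E. conn (B - {e}) (src f) (tgt f))"
        using True less B' by fastforce
      then show ?thesis using True act eE by simp
    next
      case False
      then show ?thesis using less by (auto simp: less_imp_le)
    qed
  qed
  moreover have "finite ?A" "e \<notin> ?A" using fin eE by auto
  ultimately show ?thesis unfolding act_in_def by simp
qed

text \<open>An isthmus belongs to every basis and is active, hence the factor \<open>y\<close>. The
  middle case includes an \<open>e\<close> that contradicts \<open>D\<close>; its contraction term
  is then 0 by \<open>nbpoly_contract_conn\<close>.\<close>

lemma nbpoly_insert:
  assumes fin: "finite D" "finite E" and on: "gedges_on n E" and one: "src e \<in> {1..n}" "tgt e \<in> {1..n}"
  shows "nbpoly n ord D (insert e E) y =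
    (if gspan D e then 0
     else if conn (D \<union> E) (src e) (tgt e) then nbpoly n ord D E y + nbpoly n ord (insert e D) E y
     else y * nbpoly n ord (insert e D) E y)"
proof (cases "gspan D e")
  case True
  then show ?thesis by (simp add: nbpoly_def nb_insert_gspan)
next
  case False
  let ?c = "conn (D \<union> E) (src e) (tgt e)"
  have eE: "e \<notin> E" "e \<notin> D" using less gr by auto
  have disj: "nb n ord D E \<inter> nb n ord (insert e D) E = {}" using eE by (auto simp: nb_def)
  have "nbpoly n ord D (insert e E) y = (\<Sum>B\<in>nb n ord D E. y ^ act_in ord (insert e E) B)
      + (\<Sum>B\<in>nb n ord (insert e D) E. y ^ act_in ord (insert e E) B)"
    unfolding nbpoly_def nb_insert[OF False] using disj fin
    by (intro sum.union_disjoint) (auto intro: finite_nb)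
  also have "(\<Sum>B\<in>nb n ord D E. y ^ act_in ord (insert e E) B) = nbpoly n ord D E y"
    unfolding nbpoly_def
  proof (intro sum.cong refl)
    fix B assume "B \<in> nb n ord D E"
    then have "e \<notin> B" using eE by (auto simp: nb_def)
    then show "y ^ act_in ord (insert e E) B = y ^ act_in ord E B" by (simp add: act_in_delete)
  qed
  also have "(\<Sum>B\<in>nb n ord (insert e D) E. y ^ act_in ord (insert e E) B)
     = (\<Sum>B\<in>nb n ord (insert e D) E. (if ?c then 1 else y) * y ^ act_in ord E B)"
    by (intro sum.cong refl) (use act_in_contract[OF fin _ on] in auto)
  also have "\<dots> = (if ?c then 1 else y) * nbpoly n ord (insert e D) E y"
    by (simp add: nbpoly_def sum_distrib_left)
  finally show ?thesis using False nb_disconnected[OF one] by (auto simp: nbpoly_def)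
qed

end

text \<open>Together with the connection through \<open>D\<close>, the contracted edge would close a
  circle inside every candidate basis.\<close>

lemma nbpoly_contract_conn:
  "\<forall>d\<in>D. ord e < ord d \<Longrightarrow> conn D (src e) (tgt e) \<Longrightarrow> nbpoly n ord (insert e D) E y = 0"
  unfolding nbpoly_def
proof -
  assume gr: "\<forall>d\<in>D. ord e < ord d" and c: "conn D (src e) (tgt e)"
  have "nb n ord (insert e D) E = {}"
  proof (rule ccontr)
    assume "nb n ord (insert e D) E \<noteq> {}"
    then obtain B where B: "insert e D \<subseteq> B" "acyc B" by (auto simp: nb_def)
    have "e \<notin> D" using gr by auto
    then have "conn (B - {e}) (src e) (tgt e)" using c B by (auto elim: conn_mono)
    then show False using B by (auto simp: acyc_def)
  qed
  then show "(\<Sum>B\<in>nb n ord (insert e D) E. y ^ act_in ord E B) = 0" by simp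
qed

section \<open>Deletion and contraction for colourings\<close>

lemma colorings_insert:
  assumes "e \<notin> D"
  shows "card (colorings n q D E) = card (colorings n q D (insert e E)) + card (colorings n q (insert e D) E)"
proof -
  have "colorings n q D E = colorings n q D (insert e E) \<union> colorings n q (insert e D) E"
    "colorings n q D (insert e E) \<inter> colorings n q (insert e D) E = {}"
    by (auto simp: colorings_def)
  then show ?thesis by (metis card_Un_disjoint finite_colorings)
qed

text \<open>Shifting all vertices on the side \<open>U\<close> of \<open>tgt e\<close> by
  \<open>s\<close> respects every other constraint and moves the defect of \<open>e\<close> by
  \<open>s\<close>, so all \<open>q\<close> residues of the defect are equally frequent.\<close>

lemma card_colorings_isthmus:
  assumes q: "0 < q" and on: "gedges_on n (insert e (D \<union> E))" and nc: "\<not> conn (D \<union> E) (src e) (tgt e)"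
  shows "card (colorings n q D E) = nat q * card (colorings n q (insert e D) E)"
proof -
  define U where "U = {u. conn (D \<union> E) (tgt e) u}"
  define sh where "sh = (\<lambda>(x :: nat \<Rightarrow> int) s. restrict (\<lambda>i. (x i + (if i \<in> U then s else 0)) mod q) {1..n})"
  define df where "df = (\<lambda>x. (x (tgt e) - x (src e) - gn e) mod q)"
  have eU: "tgt e \<in> U" "src e \<notin> U" using nc conn_sym by (auto simp: U_def)
  have en: "tgt e \<in> {1..n}" "src e \<in> {1..n}" using on by (auto simp: gedges_on_def)
  have fU: "src f \<in> U \<longleftrightarrow> tgt f \<in> U" if "f \<in> D \<union> E" for f
    using conn_edge[OF that] unfolding U_def by (auto intro: conn_trans conn_sym)
  have shift: "sh x s \<in> colorings n q D E" if x: "x \<in> colorings n q D E" for x s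
  proof -
    have "sat_mod q (sh x s) f \<longleftrightarrow> sat_mod q x f" if f: "f \<in> D \<union> E" for f
    proof (rule sat_mod_cong[where s = "if src f \<in> U then s else 0"])
      fix v assume v: "v \<in> ends f"
      then have vn: "v \<in> {1..n}" using on f by (auto simp: gedges_on_def ends_def)
      have "v \<in> U \<longleftrightarrow> src f \<in> U" using v fU[OF f] by (auto simp: ends_def)
      moreover have "q dvd (x v + a) mod q - x v - a" for a by (metis diff_diff_eq dvd_minus_mod dvd_diff_commute)
      ultimately show "q dvd sh x s v - x v - (if src f \<in> U then s else 0)" using vn by (simp add: sh_def)
    qed
    then show ?thesis using x q by (auto simp: colorings_def sh_def)
  qed
  have sh_sh: "sh (sh x s) t = sh x (s + t)" for x s t
    by (auto simp: sh_def fun_eq_iff restrict_def mod_simps add.assoc)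
  have sh_0: "sh x s = x" if x: "x \<in> colorings n q D E" and s: "s mod q = 0" for x s
  proof
    fix i
    have "(x i + s) mod q = x i" "x i mod q = x i" if "i \<in> {1..n}"
    proof -
      have xi: "x i \<in> {0..<q}" using x that by (auto simp: colorings_def)
      then show "x i mod q = x i" by simp
      have "(x i + s) mod q = (x i + s mod q) mod q" by (simp add: mod_simps)
      then show "(x i + s) mod q = x i" using s xi by simp
    qed
    moreover have "x i = undefined" if "i \<notin> {1..n}" using x that by (auto simp: colorings_def PiE_def extensional_def)
    ultimately show "sh x s i = x i" by (auto simp: sh_def)
  qed
  have df_sh: "df (sh x s) = (df x + s) mod q" for x s
  proof -
    have "df (sh x s) = ((x (tgt e) + s) mod q - x (src e) mod q - gn e) mod q"
      using eU en by (simp add: df_def sh_def)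
    also have "\<dots> = (x (tgt e) + s - x (src e) - gn e) mod q" by (metis mod_diff_eq mod_diff_left_eq)
    also have "x (tgt e) + s - x (src e) - gn e = (x (tgt e) - x (src e) - gn e) + s" by simp
    finally show ?thesis by (simp add: df_def mod_simps)
  qed
  have mem: "x \<in> colorings n q (insert e D) E \<longleftrightarrow> x \<in> colorings n q D E \<and> df x = 0" for x
    by (auto simp: colorings_def sat_mod_def df_def dvd_eq_mod_eq_0)
  have "bij_betw (\<lambda>(x, s). sh x s) (colorings n q (insert e D) E \<times> {0..<q}) (colorings n q D E)"
  proof (rule bij_betw_byWitness[where f' = "\<lambda>x. (sh x (- df x), df x)"])
    show "\<forall>a\<in>colorings n q (insert e D) E \<times> {0..<q}. (\<lambda>x. (sh x (- df x), df x)) ((\<lambda>(x, s). sh x s) a) = a"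
    proof
      fix a assume a: "a \<in> colorings n q (insert e D) E \<times> {0..<q}"
      obtain x s where xs: "a = (x, s)" by (cases a)
      have x: "x \<in> colorings n q (insert e D) E" and s: "s \<in> {0..<q}" using a xs by auto
      have d: "df (sh x s) = s" using x s by (simp add: df_sh mem)
      then show "(\<lambda>x. (sh x (- df x), df x)) ((\<lambda>(x, s). sh x s) a) = a"
        using sh_0[of x 0] x xs by (simp add: sh_sh mem)
    qed
    show "\<forall>a'\<in>colorings n q D E. (\<lambda>(x, s). sh x s) (sh a' (- df a'), df a') = a'"
      using sh_0 by (auto simp: sh_sh)
    show "(\<lambda>(x, s). sh x s) ` (colorings n q (insert e D) E \<times> {0..<q}) \<subseteq> colorings n q D E"
      using shift by (auto simp: mem)
    show "(\<lambda>x. (sh x (- df x), df x)) ` colorings n q D E \<subseteq> colorings n q (insert e D) E \<times> {0..<q}"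
      using shift q by (auto simp: mem df_sh) (auto simp: df_def)
  qed
  from bij_betw_same_card[OF this] show ?thesis by (simp add: card_cartesian_product mult.commute)
qed

text \<open>Each edge of a forest is an isthmus when it is added, so its equation divides the count
  by \<open>q\<close>; the product form avoids the exponent \<open>n - card D\<close>.\<close>

lemma card_colorings_acyc:
  assumes q: "0 < q" and "finite D" "acyc D" "gedges_on n D"
  shows "card (colorings n q D {}) * nat q ^ card D = nat q ^ n"
  using assms(2-)
proof (induction D)
  case empty
  have "colorings n q {} {} = PiE {1..n} (\<lambda>_. {0..<q})" by (auto simp: colorings_def)
  then show ?case by (simp add: card_PiE)
next
  case (insert e D)
  have "\<not> conn D (src e) (tgt e)" using insert by (auto simp: acyc_def)
  then have "card (colorings n q D {}) = nat q * card (colorings n q (insert e D) {})"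
    by (intro card_colorings_isthmus) (use insert q in auto)
  moreover have "acyc D" using insert.prems(1) by (rule acyc_subset) auto
  ultimately show ?case using insert by (simp add: gedges_on_def mult_ac)
qed

text \<open>A colouring is determined along the tree by its value at vertex 1, rotation makes all
  values equally frequent, and the forest count shows that a colouring exists.\<close>

lemma card_colorings_spanning_tree:
  assumes q: "0 < q" and D: "finite D" "acyc D" "gedges_on n D" "spans n D" and n: "1 \<le> n"
  shows "card (colorings n q D {}) = nat q"
proof -
  have "card {x \<in> colorings n q D {}. x 1 = 0} \<le> 1"
  proof (rule card_le_Suc0_iff_eq[THEN iffD2, unfolded One_nat_def[symmetric]])
    show "\<forall>x\<in>{x \<in> colorings n q D {}. x 1 = 0}. \<forall>y\<in>{x \<in> colorings n q D {}. x 1 = 0}. x = y"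
    proof (intro ballI ext)
      fix x y i assume x: "x \<in> {x \<in> colorings n q D {}. x 1 = 0}" and y: "y \<in> {x \<in> colorings n q D {}. x 1 = 0}"
      show "x i = y i"
      proof (cases "i \<in> {1..n}")
        case True
        have c: "conn D 1 i" using D True n by (auto simp: spans_def)
        have "q dvd x i - y i"
        proof (rule conn_step_invariant[OF c, where P = "\<lambda>i. q dvd x i - y i"])
          show "q dvd x 1 - y 1" using x y by simp
          fix e assume e: "e \<in> D"
          have "q dvd x (tgt e) - x (src e) - gn e" "q dvd y (tgt e) - y (src e) - gn e"
            using x y e by (auto simp: colorings_def sat_mod_def)
          then have "q dvd (x (tgt e) - x (src e) - gn e) - (y (tgt e) - y (src e) - gn e)" by (rule dvd_diff)
          then have *: "q dvd (x (tgt e) - y (tgt e)) - (x (src e) - y (src e))" by (simp add: algebra_simps)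
          show "q dvd x (src e) - y (src e) \<longleftrightarrow> q dvd x (tgt e) - y (tgt e)"
            using * by (metis dvd_diff_right_iff dvd_diff_commute zdvd_zdiffD)
        qed
        moreover have "x i \<in> {0..<q}" "y i \<in> {0..<q}" using x y True by (auto simp: colorings_def)
        ultimately show ?thesis by (metis atLeastLessThan_iff mod_eq_dvd_iff mod_pos_pos_trivial)
      next
        case False
        then show ?thesis using x y by (auto simp: colorings_def PiE_def extensional_def)
      qed
    qed
  qed simp
  moreover have eq: "card (colorings n q D {}) = nat q * card {x \<in> colorings n q D {}. x 1 = 0}"
    by (rule card_colorings_rotate) (use q n D in auto)
  moreover have "card (colorings n q D {}) \<noteq> 0"
    using card_colorings_acyc[OF q D(1-3)] q by (metis mult_zero_left power_not_zero zero_less_nat_eq less_numeral_extra(3))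
  ultimately have "card {x \<in> colorings n q D {}. x 1 = 0} = 1" by (cases "card {x \<in> colorings n q D {}. x 1 = 0}") auto
  then show ?thesis using eq by simp
qed

text \<open>The counts of colourings for forests and for spanning trees are compared at modulus
  2.\<close>

lemma card_spanning_tree:
  assumes D: "finite D" "acyc D" "gedges_on n D" "spans n D" and n: "1 \<le> n"
  shows "Suc (card D) = n"
proof -
  have "nat 2 * nat 2 ^ card D = nat 2 ^ n"
    using card_colorings_acyc[of 2 D n] card_colorings_spanning_tree[of 2 D n] assms by simp
  then have "(2::nat) ^ Suc (card D) = 2 ^ n" by simp
  then show ?thesis using power_inject_exp[of "2::nat" "Suc (card D)" n] by simp
qed

text \<open>\<open>D\<close> ranks above \<open>E\<close> because the largest remaining edge is
  always the one treated; \<open>D \<union> E\<close> keeps spanning because an isthmus is never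
  deleted.\<close>

definition delcon_state :: "nat \<Rightarrow> (gedge \<Rightarrow> nat) \<Rightarrow> gedge set \<Rightarrow> gedge set \<Rightarrow> bool" where
  "delcon_state n ord D E \<longleftrightarrow> finite D \<and> finite E \<and> gedges_on n (D \<union> E) \<and> loopless (D \<union> E) \<and>
     inj_on ord E \<and> (\<forall>d\<in>D. \<forall>e\<in>E. ord e < ord d) \<and> acyc D \<and> spans n (D \<union> E)"

lemma spans_delete:
  assumes "spans n (insert e S)" "conn S (src e) (tgt e)" shows "spans n S"
  using assms unfolding spans_def conn_insert by (meson conn_sym conn_trans)

text \<open>Always removing the largest remaining edge makes NBC conditions and activities of the other edges
  independent of the removed edge.\<close>

lemma delcon_induct [consumes 1, case_names empty implied contradictory ordinary isthmus]:
  assumes st: "delcon_state n ord D E"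
    and empty: "\<And>D. delcon_state n ord D {} \<Longrightarrow> P D {}"
    and implied: "\<And>D E e. delcon_state n ord D (insert e E) \<Longrightarrow> e \<notin> E \<Longrightarrow> e \<notin> D \<Longrightarrow> \<forall>f\<in>E. ord f < ord e \<Longrightarrow>
       gspan D e \<Longrightarrow> P D (insert e E)"
    and contradictory: "\<And>D E e. delcon_state n ord D (insert e E) \<Longrightarrow> e \<notin> E \<Longrightarrow> e \<notin> D \<Longrightarrow> \<forall>f\<in>E. ord f < ord e \<Longrightarrow>
       conn D (src e) (tgt e) \<Longrightarrow> \<not> gspan D e \<Longrightarrow> P D E \<Longrightarrow> P D (insert e E)"
    and ordinary: "\<And>D E e. delcon_state n ord D (insert e E) \<Longrightarrow> e \<notin> E \<Longrightarrow> e \<notin> D \<Longrightarrow> \<forall>f\<in>E. ord f < ord e \<Longrightarrow>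
       \<not> conn D (src e) (tgt e) \<Longrightarrow> conn (D \<union> E) (src e) (tgt e) \<Longrightarrow> P D E \<Longrightarrow> P (insert e D) E \<Longrightarrow> P D (insert e E)"
    and isthmus: "\<And>D E e. delcon_state n ord D (insert e E) \<Longrightarrow> e \<notin> E \<Longrightarrow> e \<notin> D \<Longrightarrow> \<forall>f\<in>E. ord f < ord e \<Longrightarrow>
       \<not> conn (D \<union> E) (src e) (tgt e) \<Longrightarrow> P (insert e D) E \<Longrightarrow> P D (insert e E)"
  shows "P D E"
proof -
  have "finite E" using st by (simp add: delcon_state_def)
  then show ?thesis using st
  proof (induction E arbitrary: D rule: finite_ranking_induct[where f = ord])
    case empty
    then show ?case using assms(2) by blast
  next
    case (insert e E)
    show ?case
    proof (cases "e \<in> E")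
      case True
      then show ?thesis using insert by (simp add: insert_absorb)
    next
      case eE: False
      have less: "\<forall>f\<in>E. ord f < ord e"
      proof
        fix f assume f: "f \<in> E"
        then have "ord f \<noteq> ord e" using insert.prems eE by (auto simp: delcon_state_def inj_on_def)
        then show "ord f < ord e" using insert.hyps(2)[OF f] by simp
      qed
      have eD: "e \<notin> D" using insert.prems by (auto simp: delcon_state_def)
      have del: "delcon_state n ord D E" if "conn (D \<union> E) (src e) (tgt e)"
        using insert.prems spans_delete[of n e "D \<union> E"] that
        by (auto simp: delcon_state_def gedges_on_def loopless_def)
      have con: "delcon_state n ord (insert e D) E" if "\<not> conn D (src e) (tgt e)"
        using insert.prems acyc_insert[OF _ that] less
        by (auto simp: delcon_state_def gedges_on_def loopless_def)
      show ?thesis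
      proof (cases "gspan D e")
        case True
        then show ?thesis using implied insert.prems eE eD less by blast
      next
        case ng: False
        show ?thesis
        proof (cases "conn D (src e) (tgt e)")
          case True
          then have "conn (D \<union> E) (src e) (tgt e)" by (rule conn_mono) auto
          then have "P D E" using del insert.IH by blast
          then show ?thesis using contradictory insert.prems eE eD less True ng by blast
        next
          case nc: False
          then have 2: "P (insert e D) E" using con insert.IH by blast
          show ?thesis
          proof (cases "conn (D \<union> E) (src e) (tgt e)")
            case True
            then have "P D E" using del insert.IH by blast
            then show ?thesis using ordinary insert.prems eE eD less True nc 2 by blast
          next
            case False
            then show ?thesis using isthmus insert.prems eE eD less 2 by blast
          qed
        qed
      qed
    qed
  qed
qed

lemma delcon_state_nbpoly_insert:
  assumes "delcon_state n ord D (insert e E)" "e \<notin> E" "\<forall>f\<in>E. ord f < ord e"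
  shows "nbpoly n ord D (insert e E) y =
    (if gspan D e then 0
     else if conn (D \<union> E) (src e) (tgt e) then nbpoly n ord D E y + nbpoly n ord (insert e D) E y
     else y * nbpoly n ord (insert e D) E y)"
  by (rule nbpoly_insert) (use assms in \<open>auto simp: delcon_state_def gedges_on_def\<close>)

lemma abs_pgain_le:
  assumes "gpath D vs es" "finite D" "e \<notin> D"
  shows "\<bar>pgain vs es + dgain e v\<bar> \<le> (\<Sum>f\<in>insert e D. \<bar>gn f\<bar>)"
proof -
  have "\<bar>pgain vs es\<bar> \<le> (\<Sum>t<length es. \<bar>gn (es ! t)\<bar>)"
    unfolding pgain_def by (rule order_trans[OF sum_abs]) (intro sum_mono, auto simp: dgain_def)
  also have "\<dots> = (\<Sum>f\<leftarrow>es. \<bar>gn f\<bar>)" by (simp add: sum_list_sum_nth atLeast0LessThan)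
  also have "\<dots> = (\<Sum>f\<in>set es. \<bar>gn f\<bar>)" by (rule sum_list_distinct_conv_sum_set[OF gpath_distinct[OF assms(1)]])
  also have "\<dots> \<le> (\<Sum>f\<in>D. \<bar>gn f\<bar>)" by (rule sum_mono2) (use assms gpath_set in auto)
  finally have "\<bar>pgain vs es\<bar> \<le> (\<Sum>f\<in>D. \<bar>gn f\<bar>)" .
  moreover have "\<bar>dgain e v\<bar> = \<bar>gn e\<bar>" by (simp add: dgain_def)
  moreover have "(\<Sum>f\<in>insert e D. \<bar>gn f\<bar>) = \<bar>gn e\<bar> + (\<Sum>f\<in>D. \<bar>gn f\<bar>)" using assms by simp
  ultimately show ?thesis by linarith
qed

text \<open>The circle closed by \<open>e\<close> has nonzero gain, and since a path uses each edge
  at most once its absolute value is at most the sum of all absolute gains, hence below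
  \<open>q\<close>. It cannot be divisible by \<open>q\<close>.\<close>

lemma conn_coloring_conflict:
  assumes c: "conn D (src e) (tgt e)" and ng: "\<not> gspan D e" and ne: "src e \<noteq> tgt e"
    and D: "finite D" "e \<notin> D" and q: "(\<Sum>f\<in>insert e D. \<bar>gn f\<bar>) < q"
  shows "colorings n q (insert e D) E = {}"
proof (rule ccontr)
  assume "colorings n q (insert e D) E \<noteq> {}"
  then obtain x where x: "\<forall>f\<in>insert e D. sat_mod q x f" by (auto simp: colorings_def)
  obtain vs es where p: "gpath D vs es" "vs ! 0 = src e" "vs ! length es = tgt e" using conn_imp_gpath[OF c] by blast
  have ee: "ends e = {vs ! 0, vs ! length es}" using p by (simp add: ends_def)
  let ?g = "pgain vs es + dgain e (vs ! length es)"
  have "q dvd x (tgt e) - x (src e) - of_int (gn e) \<longleftrightarrow> q dvd of_int ?g"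
    by (rule path_edge_potential[OF p(1) ee ne, of "\<lambda>a. q dvd a"]) (use x in \<open>auto simp: sat_mod_def\<close>)
  then have "q dvd ?g" using x by (auto simp: sat_mod_def)
  moreover have "\<bar>?g\<bar> < q" using abs_pgain_le[OF p(1) D(1) D(2), of "vs ! length es"] q by linarith
  ultimately have "?g = 0" using dvd_imp_le_int[of ?g q] by force
  then show False using ng p(1) ee by (auto simp: gspan_def)
qed

lemma gspan_coloring:
  assumes g: "gspan D e" and ne: "src e \<noteq> tgt e"
  shows "colorings n q D (insert e E) = {}"
proof (rule ccontr)
  assume "colorings n q D (insert e E) \<noteq> {}"
  then obtain x where x: "\<forall>f\<in>D. sat_mod q x f" "\<not> sat_mod q x e" by (auto simp: colorings_def)
  obtain vs es where p: "gpath D vs es" "ends e = {vs ! 0, vs ! length es}" "pgain vs es + dgain e (vs ! length es) = 0"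
    using g by (auto simp: gspan_def)
  have "q dvd x (tgt e) - x (src e) - of_int (gn e) \<longleftrightarrow> q dvd of_int (pgain vs es + dgain e (vs ! length es))"
    by (rule path_edge_potential[OF p(1,2) ne, of "\<lambda>a. q dvd a"]) (use x in \<open>auto simp: sat_mod_def\<close>)
  then show False using x p(3) by (auto simp: sat_mod_def)
qed

text \<open>The sign \<open>(-1) ^ card D\<close> turns the subtraction in the recursion for
  colourings into the addition for bases. At the end \<open>D\<close> is a spanning tree with
  \<open>n - 1\<close> edges and \<open>q\<close> colourings, which fixes the constant.\<close>

lemma colorings_nbpoly:
  assumes "delcon_state n ord D E" "(\<Sum>f\<in>D \<union> E. \<bar>gn f\<bar>) < q" "1 \<le> n"
  shows "(-1) ^ card D * real (card (colorings n q D E)) = of_int q * (-1) ^ (n - 1) * nbpoly n ord D E (1 - of_int q)"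
  using assms
proof (induction rule: delcon_induct)
  case (empty D)
  have q: "0 < q" using empty.prems(1) by (meson abs_ge_zero order_le_less_trans sum_nonneg)
  have D: "finite D" "acyc D" "gedges_on n D" "spans n D" using empty by (auto simp: delcon_state_def)
  have "nbpoly n ord D {} (1 - of_int q) = 1" using D by (simp add: nbpoly_def nb_empty act_in_def)
  moreover have "card (colorings n q D {}) = nat q" by (rule card_colorings_spanning_tree[OF q D empty.prems(2)])
  moreover have "card D = n - 1" using card_spanning_tree[OF D empty.prems(2)] by simp
  ultimately show ?case using q by simp
next
  case (implied D E e)
  have "src e \<noteq> tgt e" using implied by (auto simp: delcon_state_def loopless_def)
  from gspan_coloring[OF implied.hyps(5) this] show ?case
    unfolding delcon_state_nbpoly_insert[OF implied.hyps(1,2,4)] using implied.hyps(5) by simp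
next
  case (contradictory D E e)
  have st: "finite D" "finite E" "src e \<noteq> tgt e" "\<forall>d\<in>D. ord e < ord d"
    using contradictory by (auto simp: delcon_state_def loopless_def)
  have le: "(\<Sum>f\<in>A. \<bar>gn f\<bar>) < q" if "A \<subseteq> D \<union> insert e E" for A
    using sum_mono2[of "D \<union> insert e E" A "\<lambda>f. \<bar>gn f\<bar>"] that st contradictory.prems(1) by force
  have c: "conn (D \<union> E) (src e) (tgt e)" using contradictory.hyps(5) by (rule conn_mono) auto
  have 0: "card (colorings n q (insert e D) E) = 0"
    using conn_coloring_conflict[OF contradictory.hyps(5,6) st(3) st(1) contradictory.hyps(3) le] by auto
  have IH: "(-1) ^ card D * real (card (colorings n q D E)) = of_int q * (-1) ^ (n - 1) * nbpoly n ord D E (1 - of_int q)"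
    by (rule contradictory.IH) (use le contradictory.prems in auto)
  show ?case
    unfolding delcon_state_nbpoly_insert[OF contradictory.hyps(1,2,4)]
    using contradictory.hyps(6) c nbpoly_contract_conn[OF st(4) contradictory.hyps(5)] IH
      colorings_insert[OF contradictory.hyps(3), of n q E] 0 by simp
next
  case (ordinary D E e)
  have st: "finite D" "finite E" "src e \<noteq> tgt e" using ordinary by (auto simp: delcon_state_def loopless_def)
  have le: "(\<Sum>f\<in>A. \<bar>gn f\<bar>) < q" if "A \<subseteq> D \<union> insert e E" for A
    using sum_mono2[of "D \<union> insert e E" A "\<lambda>f. \<bar>gn f\<bar>"] that st ordinary.prems(1) by force
  have IH1: "(-1) ^ card D * real (card (colorings n q D E)) = of_int q * (-1) ^ (n - 1) * nbpoly n ord D E (1 - of_int q)"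
    by (rule ordinary.IH(1)) (use le ordinary.prems in auto)
  have IH2: "(-1) ^ card (insert e D) * real (card (colorings n q (insert e D) E)) = of_int q * (-1) ^ (n - 1) * nbpoly n ord (insert e D) E (1 - of_int q)"
    by (rule ordinary.IH(2)) (use le ordinary.prems in auto)
  have ng: "\<not> gspan D e" using ordinary.hyps(5) gspan_conn by blast
  have N: "real (card (colorings n q D (insert e E))) = real (card (colorings n q D E)) - real (card (colorings n q (insert e D) E))"
    using colorings_insert[OF ordinary.hyps(3), of n q E] by simp
  have "(-1) ^ card D * real (card (colorings n q D (insert e E))) = of_int q * (-1) ^ (n - 1) * nbpoly n ord D E (1 - of_int q)
     + of_int q * (-1) ^ (n - 1) * nbpoly n ord (insert e D) E (1 - of_int q)"
    unfolding IH1[symmetric] IH2[symmetric] N using st ordinary.hyps(3) by (simp add: algebra_simps)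
  then show ?case
    unfolding delcon_state_nbpoly_insert[OF ordinary.hyps(1,2,4)] using ng ordinary.hyps(6) by (simp add: algebra_simps)
next
  case (isthmus D E e)
  have st: "finite D" "finite E" "src e \<noteq> tgt e" "gedges_on n (insert e (D \<union> E))"
    using isthmus by (auto simp: delcon_state_def loopless_def gedges_on_def)
  have q: "0 < q" using isthmus.prems(1) by (meson abs_ge_zero order_le_less_trans sum_nonneg)
  have IH: "(-1) ^ card (insert e D) * real (card (colorings n q (insert e D) E)) = of_int q * (-1) ^ (n - 1) * nbpoly n ord (insert e D) E (1 - of_int q)"
    by (rule isthmus.IH) (use isthmus.prems in auto)
  have ng: "\<not> gspan D e" using isthmus.hyps(5) gspan_conn conn_mono[of D _ _ "D \<union> E"] by blast
  have N: "real (card (colorings n q D (insert e E))) = real (card (colorings n q D E)) - real (card (colorings n q (insert e D) E))"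
    using colorings_insert[OF isthmus.hyps(3), of n q E] by simp
  have "real (card (colorings n q D E)) = of_int q * real (card (colorings n q (insert e D) E))"
    using card_colorings_isthmus[OF q st(4) isthmus.hyps(5)] q by simp
  \<comment> \<open>Deletion has \<open>q\<close> times as many colourings as contraction, so
    \<open>q - 1\<close> times remain; the additional contracted edge flips the sign, and
    \<open>y = 1 - q\<close> appears.\<close>
  then have "(-1) ^ card D * real (card (colorings n q D (insert e E)))
     = (1 - of_int q) * ((-1) ^ card (insert e D) * real (card (colorings n q (insert e D) E)))"
    unfolding N using st isthmus.hyps(3) by (simp add: algebra_simps)
  then show ?case
    unfolding delcon_state_nbpoly_insert[OF isthmus.hyps(1,2,4)] IH using ng isthmus.hyps(5) by (simp add: algebra_simps)
qed

lemma card_nbc_eq_nb: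
  assumes "loopless E" "gedges_on n E" "inj_on ord E"
  shows "{B. nbc_basis n E ord B} = nb n ord {} E"
    and "B \<in> nb n ord {} E \<Longrightarrow> activity n E ord B = act_in ord E B"
proof -
  show "{B. nbc_basis n E ord B} = nb n ord {} E"
    using nbc_basis_iff[OF assms(1,3)] by (auto simp: nb_def)
  assume B: "B \<in> nb n ord {} E"
  show "activity n E ord B = act_in ord E B"
    unfolding activity_def act_in_def
    by (intro arg_cong[where f = card]) (use B active_iff[OF assms(1,2)] in \<open>auto simp: nb_def\<close>)
qed

section \<open>Cells of the arrangement\<close>

definition ev :: "(nat \<Rightarrow> real) \<Rightarrow> gedge \<Rightarrow> real" where "ev x e = x (tgt e) - x (src e) - real_of_int (gn e)"
definition lv :: "(nat \<Rightarrow> real) \<Rightarrow> gedge \<Rightarrow> real" where "lv v e = v (tgt e) - v (src e)"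

definition cell :: "gedge set \<Rightarrow> gedge set \<Rightarrow> gedge set \<Rightarrow> (nat \<Rightarrow> real) set" where
  "cell D E S = {x. (\<forall>e\<in>D. ev x e = 0) \<and> (\<forall>e\<in>S. ev x e < 0) \<and> (\<forall>e\<in>E - S. ev x e > 0)}"

text \<open>The recession cone: the constraints of the cell made homogeneous and weak. Moving along
  such a direction preserves the strict inequalities of \<open>cell\<close>.\<close>

definition rdir :: "gedge set \<Rightarrow> gedge set \<Rightarrow> gedge set \<Rightarrow> (nat \<Rightarrow> real) set" where
  "rdir D E S = {v. (\<forall>e\<in>D. lv v e = 0) \<and> (\<forall>e\<in>S. lv v e \<le> 0) \<and> (\<forall>e\<in>E - S. lv v e \<ge> 0)}"

definition flat_on :: "nat \<Rightarrow> (nat \<Rightarrow> real) \<Rightarrow> bool" where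
  "flat_on n v \<longleftrightarrow> (\<forall>i\<in>{1..n}. \<forall>j\<in>{1..n}. v i = v j)"

text \<open>Boundedness modulo translation by constant vectors; this keeps the hyperplane of
  coordinate sum zero out of the recursion.\<close>

definition bdd_diffs :: "nat \<Rightarrow> (nat \<Rightarrow> real) set \<Rightarrow> bool" where
  "bdd_diffs n C \<longleftrightarrow> (\<exists>M. \<forall>x\<in>C. \<forall>i\<in>{1..n}. \<forall>j\<in>{1..n}. x j - x i \<le> M)"

definition bdd_cell :: "nat \<Rightarrow> (nat \<Rightarrow> real) set \<Rightarrow> bool" where
  "bdd_cell n C \<longleftrightarrow> C \<noteq> {} \<and> bdd_diffs n C"

definition bdd_signs :: "nat \<Rightarrow> gedge set \<Rightarrow> gedge set \<Rightarrow> gedge set set" where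
  "bdd_signs n D E = {S. S \<subseteq> E \<and> bdd_cell n (cell D E S)}"

lemma bdd_diffs_subset: "bdd_diffs n C \<Longrightarrow> C' \<subseteq> C \<Longrightarrow> bdd_diffs n C'"
  unfolding bdd_diffs_def by blast

lemma ev_add: "ev (\<lambda>i. x i + t * v i) e = ev x e + t * lv v e"
  by (simp add: ev_def lv_def algebra_simps)

lemma cell_add_rdir:
  assumes "x \<in> cell D E S" "v \<in> rdir D E S" "0 \<le> t"
  shows "(\<lambda>i. x i + t * v i) \<in> cell D E S"
  unfolding cell_def
proof (intro CollectI conjI ballI)
  fix e assume "e \<in> D"
  then show "ev (\<lambda>i. x i + t * v i) e = 0" using assms by (simp add: ev_add cell_def rdir_def)
next
  fix e assume e: "e \<in> S"
  have "t * lv v e \<le> 0" using assms e by (intro mult_nonneg_nonpos) (auto simp: rdir_def)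
  moreover have "ev x e < 0" using assms e by (auto simp: cell_def)
  ultimately show "ev (\<lambda>i. x i + t * v i) e < 0" by (simp add: ev_add)
next
  fix e assume e: "e \<in> E - S"
  have "0 \<le> t * lv v e" using assms e by (intro mult_nonneg_nonneg) (auto simp: rdir_def)
  moreover have "ev x e > 0" using assms e by (auto simp: cell_def)
  ultimately show "ev (\<lambda>i. x i + t * v i) e > 0" by (simp add: ev_add)
qed

lemma rdir_unbounded:
  assumes x: "x \<in> cell D E S" and v: "v \<in> rdir D E S" "\<not> flat_on n v"
  shows "\<not> bdd_diffs n (cell D E S)"
proof
  assume "bdd_diffs n (cell D E S)"
  then obtain M where M: "\<And>y i j. y \<in> cell D E S \<Longrightarrow> i \<in> {1..n} \<Longrightarrow> j \<in> {1..n} \<Longrightarrow> y j - y i \<le> M"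
    unfolding bdd_diffs_def by blast
  obtain i j where ij: "i \<in> {1..n}" "j \<in> {1..n}" "v i < v j"
    using v(2) unfolding flat_on_def by (metis linorder_neqE)
  define d where "d = v j - v i"
  define t where "t = (\<bar>M\<bar> + \<bar>x j - x i\<bar> + 1) / d"
  have d: "0 < d" using ij by (simp add: d_def)
  have t: "0 \<le> t" using d by (simp add: t_def)
  have "(x j + t * v j) - (x i + t * v i) \<le> M" using M[OF cell_add_rdir[OF x v(1) t] ij(1,2)] .
  moreover have "(x j + t * v j) - (x i + t * v i) = (x j - x i) + t * d" by (simp add: d_def algebra_simps)
  moreover have "t * d = \<bar>M\<bar> + \<bar>x j - x i\<bar> + 1" using d by (simp add: t_def)
  ultimately show False by linarith
qed

text \<open>If the difference constraints do not bound \<open>x j - x i\<close>, then \<open>j\<close> is not reachable from \<open>i\<close> along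
  them, and minus the indicator of the set reachable from \<open>i\<close> is a direction of recession.\<close>

lemma unbounded_rdir:
  assumes S: "S \<subseteq> E" and un: "\<not> bdd_diffs n (cell D E S)"
  shows "\<exists>v\<in>rdir D E S. \<not> flat_on n v"
proof -
  \<comment> \<open>An arc from \<open>a\<close> to \<open>b\<close> records that
    \<open>x b - x a\<close> is bounded above on the cell; an equation of \<open>D\<close> gives
    arcs both ways.\<close>
  define A where "A = {(src e, tgt e) | e. e \<in> D \<union> S} \<union> {(tgt e, src e) | e. e \<in> D \<union> (E - S)}"
  have step: "\<exists>M. \<forall>x\<in>cell D E S. x j - x i \<le> M" if ij: "(i, j) \<in> A" for i j
  proof -
    obtain e where e: "e \<in> D \<union> S \<and> i = src e \<and> j = tgt e \<or> e \<in> D \<union> (E - S) \<and> i = tgt e \<and> j = src e"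
      using ij unfolding A_def by blast
    have "x j - x i \<le> \<bar>real_of_int (gn e)\<bar>" if x: "x \<in> cell D E S" for x
    proof -
      have "e \<in> D \<union> S \<Longrightarrow> ev x e \<le> 0" "e \<in> D \<union> (E - S) \<Longrightarrow> 0 \<le> ev x e"
        using x by (auto simp: cell_def less_imp_le)
      then show ?thesis using e by (auto simp: ev_def)
    qed
    then show ?thesis by blast
  qed
  have reach: "\<exists>M. \<forall>x\<in>cell D E S. x j - x i \<le> M" if "(i, j) \<in> A\<^sup>*" for i j
    using that
  proof induction
    case base
    then show ?case by auto
  next
    case (step j k)
    obtain M where M: "\<forall>x\<in>cell D E S. x j - x i \<le> M" using step by auto
    obtain M' where M': "\<forall>x\<in>cell D E S. x k - x j \<le> M'" using \<open>(j, k) \<in> A\<close> \<open>\<And>i j. (i, j) \<in> A \<Longrightarrow> \<exists>M. \<forall>x\<in>cell D E S. x j - x i \<le> M\<close> by blast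
    have "x k - x i \<le> M + M'" if "x \<in> cell D E S" for x using M M' that by force
    then show ?case by blast
  qed
  have "\<exists>i\<in>{1..n}. \<exists>j\<in>{1..n}. (i, j) \<notin> A\<^sup>*"
  proof (rule ccontr)
    assume "\<not> ?thesis"
    then have "\<forall>i\<in>{1..n}. \<forall>j\<in>{1..n}. \<exists>M. \<forall>x\<in>cell D E S. x j - x i \<le> M" using reach by blast
    then obtain M where M: "\<And>i j x. i \<in> {1..n} \<Longrightarrow> j \<in> {1..n} \<Longrightarrow> x \<in> cell D E S \<Longrightarrow> x j - x i \<le> M i j" by metis
    define B where "B = (\<Sum>p\<in>{1..n} \<times> {1..n}. \<bar>M (fst p) (snd p)\<bar>)"
    have "M i j \<le> B" if "i \<in> {1..n}" "j \<in> {1..n}" for i j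
    proof -
      have "\<bar>M (fst (i, j)) (snd (i, j))\<bar> \<le> B" unfolding B_def by (rule member_le_sum) (use that in auto)
      then show ?thesis by simp
    qed
    then have "bdd_diffs n (cell D E S)" unfolding bdd_diffs_def using M by (meson order_trans)
    then show False using un by simp
  qed
  then obtain i j where ij: "i \<in> {1..n}" "j \<in> {1..n}" "(i, j) \<notin> A\<^sup>*" by blast
  define v where "v = (\<lambda>u. if (i, u) \<in> A\<^sup>* then -1 else (0::real))"
  have arc: "v b \<le> v a" if "(a, b) \<in> A" for a b
    using that by (auto simp: v_def intro: rtrancl.rtrancl_into_rtrancl)
  have "v \<in> rdir D E S"
    unfolding rdir_def lv_def
  proof (intro CollectI conjI ballI)
    fix e assume "e \<in> D"
    then have "(src e, tgt e) \<in> A" "(tgt e, src e) \<in> A" unfolding A_def by blast+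
    from arc[OF this(1)] arc[OF this(2)] show "v (tgt e) - v (src e) = 0" by linarith
  next
    fix e assume "e \<in> S"
    then have "(src e, tgt e) \<in> A" unfolding A_def by blast
    from arc[OF this] show "v (tgt e) - v (src e) \<le> 0" by linarith
  next
    fix e assume "e \<in> E - S"
    then have "(tgt e, src e) \<in> A" unfolding A_def by blast
    from arc[OF this] show "0 \<le> v (tgt e) - v (src e)" by linarith
  qed
  moreover have "v i \<noteq> v j" using ij by (simp add: v_def)
  ultimately show ?thesis using ij unfolding flat_on_def by blast
qed

lemma flat_on_spans:
  assumes "spans n S" "\<And>f. f \<in> S \<Longrightarrow> lv v f = 0"
  shows "flat_on n v"
  unfolding flat_on_def
proof (intro ballI)
  fix i j assume "i \<in> {1..n}" "j \<in> {1..n}"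
  then have "conn S i j" using assms(1) by (auto simp: spans_def)
  then show "v i = v j"
    by (rule conn_step_invariant[where P = "\<lambda>u. v i = v u"]) (use assms(2) in \<open>auto simp: lv_def\<close>)
qed

text \<open>The component of \<open>tgt e\<close> as a direction of movement: it leaves all edges of
  \<open>S\<close> unchanged and, if \<open>S\<close> does not join the ends of \<open>e\<close>,
  changes \<open>e\<close> at rate 1.\<close>

definition comp_ind :: "gedge set \<Rightarrow> gedge \<Rightarrow> nat \<Rightarrow> real" where
  "comp_ind S e u = (if conn S (tgt e) u then 1 else 0)"

lemma lv_comp_ind: "f \<in> S \<Longrightarrow> lv (comp_ind S e) f = 0"
  using conn_edge[of f S] unfolding comp_ind_def lv_def by (auto intro: conn_trans conn_sym)

lemma lv_comp_ind_self: "\<not> conn S (src e) (tgt e) \<Longrightarrow> lv (comp_ind S e) e = 1"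
  unfolding comp_ind_def lv_def using conn_sym[of S "tgt e" "src e"] by auto

lemma abs_lv_comp_ind: "\<bar>lv (comp_ind S e) f\<bar> \<le> 1"
  unfolding comp_ind_def lv_def by auto

text \<open>A newly added edge is a bridge, so shifting the component on one side of it satisfies
  its equation without disturbing the earlier ones.\<close>

lemma acyc_potential:
  assumes "finite D" "acyc D" shows "\<exists>x. \<forall>e\<in>D. ev x e = 0"
  using assms
proof (induction D)
  case (insert e D)
  have nc: "\<not> conn D (src e) (tgt e)" using insert by (auto simp: acyc_def)
  obtain x where x: "\<forall>f\<in>D. ev x f = 0" using insert acyc_subset by blast
  let ?y = "\<lambda>i. x i + (- ev x e) * comp_ind D e i"
  have "\<forall>f\<in>insert e D. ev ?y f = 0"
    unfolding ev_add using x lv_comp_ind lv_comp_ind_self[OF nc] by auto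
  then show ?case by blast
qed simp

section \<open>How a further hyperplane cuts a cell\<close>

lemma cell_insert:
  assumes "e \<notin> E" "S \<subseteq> E"
  shows "cell D (insert e E) (insert e S) = {x \<in> cell D E S. ev x e < 0}"
    and "cell D (insert e E) S = {x \<in> cell D E S. ev x e > 0}"
    and "cell (insert e D) E S = {x \<in> cell D E S. ev x e = 0}"
proof -
  have "insert e E - insert e S = E - S" "insert e E - S = insert e (E - S)" using assms by auto
  then show "cell D (insert e E) (insert e S) = {x \<in> cell D E S. ev x e < 0}"
    "cell D (insert e E) S = {x \<in> cell D E S. ev x e > 0}"
    "cell (insert e D) E S = {x \<in> cell D E S. ev x e = 0}" by (auto simp: cell_def)
qed

lemma rdir_insert:
  assumes "e \<notin> E" "S \<subseteq> E"
  shows "rdir D (insert e E) (insert e S) = {v \<in> rdir D E S. lv v e \<le> 0}"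
    and "rdir D (insert e E) S = {v \<in> rdir D E S. lv v e \<ge> 0}"
    and "rdir (insert e D) E S = {v \<in> rdir D E S. lv v e = 0}"
proof -
  have "insert e E - insert e S = E - S" "insert e E - S = insert e (E - S)" using assms by auto
  then show "rdir D (insert e E) (insert e S) = {v \<in> rdir D E S. lv v e \<le> 0}"
    "rdir D (insert e E) S = {v \<in> rdir D E S. lv v e \<ge> 0}"
    "rdir (insert e D) E S = {v \<in> rdir D E S. lv v e = 0}" by (auto simp: rdir_def)
qed

text \<open>Moving along \<open>comp_ind D e\<close> stays in the flat of \<open>D\<close>, changes
  \<open>e\<close> at rate 1 and every other edge at rate at most 1, so a short move to either side
  stays in the open cell.\<close>

lemma cell_perturb:
  assumes fin: "finite E" and nc: "\<not> conn D (src e) (tgt e)"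
    and x: "x \<in> cell D E S" "ev x e = 0" and S: "S \<subseteq> E"
  shows "\<exists>y\<in>cell D E S. ev y e < 0" and "\<exists>y\<in>cell D E S. ev y e > 0"
proof -
  let ?w = "comp_ind D e"
  \<comment> \<open>Half the least absolute value of an edge of \<open>E\<close> at
    \<open>x\<close>; the inserted 1 keeps the minimum defined for empty \<open>E\<close>.\<close>
  define \<epsilon> where "\<epsilon> = Min (insert 1 ((\<lambda>f. \<bar>ev x f\<bar>) ` E)) / 2"
  have nz: "ev x f \<noteq> 0" if "f \<in> E" for f
  proof -
    have "f \<in> S \<Longrightarrow> ev x f < 0" "f \<notin> S \<Longrightarrow> ev x f > 0" using x that by (auto simp: cell_def)
    then show ?thesis by (cases "f \<in> S") auto
  qed
  have m0: "0 < Min (insert 1 ((\<lambda>f. \<bar>ev x f\<bar>) ` E))" using fin nz by (subst Min_gr_iff) auto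
  have \<epsilon>: "0 < \<epsilon>" using m0 by (simp add: \<epsilon>_def)
  have le: "\<epsilon> < \<bar>ev x f\<bar>" if "f \<in> E" for f
  proof -
    have "Min (insert 1 ((\<lambda>f. \<bar>ev x f\<bar>) ` E)) \<le> \<bar>ev x f\<bar>" using fin that by (intro Min_le) auto
    then show ?thesis using m0 by (simp add: \<epsilon>_def)
  qed
  have mem: "(\<lambda>i. x i + t * ?w i) \<in> cell D E S" if t: "\<bar>t\<bar> = \<epsilon>" for t
  proof -
    have b: "\<bar>t * lv ?w f\<bar> < \<bar>ev x f\<bar>" if "f \<in> E" for f
    proof -
      have "\<bar>t * lv ?w f\<bar> \<le> \<epsilon> * 1" unfolding abs_mult t using abs_lv_comp_ind \<epsilon> by (intro mult_left_mono) auto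
      then show ?thesis using le[OF that] by simp
    qed
    show ?thesis unfolding cell_def
    proof (intro CollectI conjI ballI)
      fix f assume "f \<in> D" then show "ev (\<lambda>i. x i + t * ?w i) f = 0" using x by (simp add: ev_add cell_def lv_comp_ind)
    next
      fix f assume f: "f \<in> S"
      then have "ev x f < 0" using x by (auto simp: cell_def)
      moreover have "f \<in> E" using f S by auto
      ultimately show "ev (\<lambda>i. x i + t * ?w i) f < 0" unfolding ev_add using b[of f] by linarith
    next
      fix f assume f: "f \<in> E - S"
      then have "ev x f > 0" using x by (auto simp: cell_def)
      moreover have "\<bar>t * lv ?w f\<bar> < \<bar>ev x f\<bar>" using b[of f] f by blast
      ultimately show "ev (\<lambda>i. x i + t * ?w i) f > 0" unfolding ev_add by linarith
    qed
  qed
  have eq: "ev (\<lambda>i. x i + t * ?w i) e = t" for t using x(2) lv_comp_ind_self[OF nc] by (simp only: ev_add)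
  have "\<bar>- \<epsilon>\<bar> = \<epsilon>" "\<bar>\<epsilon>\<bar> = \<epsilon>" using \<epsilon> by auto
  note m = mem[OF this(1)] mem[OF this(2)]
  have "ev (\<lambda>i. x i + - \<epsilon> * ?w i) e < 0" "ev (\<lambda>i. x i + \<epsilon> * ?w i) e > 0" unfolding eq using \<epsilon> by simp_all
  then show "\<exists>y\<in>cell D E S. ev y e < 0" "\<exists>y\<in>cell D E S. ev y e > 0" using m by blast+
qed

lemma cell_between:
  assumes x: "x \<in> cell D E S" "ev x e < 0" and y: "y \<in> cell D E S" "ev y e > 0"
  shows "\<exists>z\<in>cell D E S. ev z e = 0"
proof -
  define t where "t = - ev x e / (ev y e - ev x e)"
  have p: "0 < ev y e - ev x e" using x y by simp
  have t: "0 < t" "t < 1" using x y p by (auto simp: t_def field_simps)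
  define z where "z = (\<lambda>i. (1 - t) * x i + t * y i)"
  have ez: "ev z f = (1 - t) * ev x f + t * ev y f" for f by (simp add: ev_def z_def algebra_simps)
  have "z \<in> cell D E S"
    unfolding cell_def
  proof (intro CollectI conjI ballI)
    fix f assume "f \<in> D" then show "ev z f = 0" using x y by (simp add: cell_def ez)
  next
    fix f assume "f \<in> S"
    then have "(1 - t) * ev x f < 0" "t * ev y f < 0" using x y t by (auto simp: cell_def mult_pos_neg)
    then show "ev z f < 0" unfolding ez by linarith
  next
    fix f assume "f \<in> E - S"
    then have "(1 - t) * ev x f > 0" "t * ev y f > 0" using x y t by (auto simp: cell_def)
    then show "ev z f > 0" unfolding ez by linarith
  qed
  moreover have "ev z e = 0"
  proof -
    have "ev z e = ev x e + t * (ev y e - ev x e)" by (simp add: ez algebra_simps)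
    then show ?thesis using p by (simp add: t_def)
  qed
  ultimately show ?thesis by blast
qed

text \<open>The positive combination of \<open>v\<close> and \<open>w\<close> that cancels on
  \<open>e\<close> is again a recession direction. On each edge both summands have the same weak
  sign, so if it were constant, \<open>v\<close> would vanish on all of \<open>D \<union> E\<close>;
  that set spans without \<open>e\<close>, so \<open>v\<close> would be constant.\<close>

lemma rdir_opposite:
  assumes v: "v \<in> rdir D E S" "lv v e > 0" and w: "w \<in> rdir D E S" "lv w e < 0"
    and nv: "\<not> flat_on n v" and sp: "spans n (D \<union> E)" and on: "gedges_on n (D \<union> E)"
  shows "\<exists>u\<in>rdir D E S. lv u e = 0 \<and> \<not> flat_on n u"
proof -
  define u where "u = (\<lambda>i. (- lv w e) * v i + lv v e * w i)"
  have lu: "lv u f = (- lv w e) * lv v f + lv v e * lv w f" for f by (simp add: lv_def u_def algebra_simps)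
  have "u \<in> rdir D E S"
    unfolding rdir_def
  proof (intro CollectI conjI ballI)
    fix f assume "f \<in> D" then show "lv u f = 0" using v w by (simp add: rdir_def lu)
  next
    fix f assume "f \<in> S"
    then have "(- lv w e) * lv v f \<le> 0" "lv v e * lv w f \<le> 0"
      using v w by (auto simp: rdir_def mult_le_0_iff zero_le_mult_iff)
    then show "lv u f \<le> 0" unfolding lu by linarith
  next
    fix f assume "f \<in> E - S"
    then have "0 \<le> (- lv w e) * lv v f" "0 \<le> lv v e * lv w f"
      using v w by (auto simp: rdir_def mult_le_0_iff zero_le_mult_iff)
    then show "0 \<le> lv u f" unfolding lu by linarith
  qed
  moreover have "lv u e = 0" by (simp add: lu)
  moreover have "\<not> flat_on n u"
  proof
    assume c: "flat_on n u"
    have "lv v f = 0" if f: "f \<in> D \<union> E" for f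
    proof -
      have "lv u f = 0" using c f on by (auto simp: flat_on_def gedges_on_def lv_def)
      then have s: "(- lv w e) * lv v f + lv v e * lv w f = 0" by (simp add: lu)
      have same: "lv v f \<le> 0 \<and> lv w f \<le> 0 \<or> lv v f \<ge> 0 \<and> lv w f \<ge> 0"
        using v w f by (cases "f \<in> S"; cases "f \<in> D") (auto simp: rdir_def)
      show ?thesis
      proof (rule ccontr)
        assume ne: "lv v f \<noteq> 0"
        from same show False
        proof
          assume a: "lv v f \<le> 0 \<and> lv w f \<le> 0"
          then have "(- lv w e) * lv v f < 0" using ne w by (intro mult_pos_neg) auto
          moreover have "lv v e * lv w f \<le> 0" using a v by (intro mult_nonneg_nonpos) auto
          ultimately show False using s by linarith
        next
          assume a: "lv v f \<ge> 0 \<and> lv w f \<ge> 0"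
          then have "(- lv w e) * lv v f > 0" using ne w by (intro mult_pos_pos) auto
          moreover have "lv v e * lv w f \<ge> 0" using a v by (intro mult_nonneg_nonneg) auto
          ultimately show False using s by linarith
        qed
      qed
    qed
    then show False using flat_on_spans[OF sp] nv by blast
  qed
  ultimately show ?thesis by blast
qed

text \<open>A bounded cell is either missed by the hyperplane or cut into two bounded halves with a
  bounded section. If an unbounded cell has a nonempty bounded section, exactly one half is bounded;
  in all other unbounded cases neither half nor the section counts. Each way both sides
  agree.\<close>

lemma bdd_cell_ordinary:
  assumes fin: "finite E" and e: "e \<notin> E" and S: "S \<subseteq> E" and nc: "\<not> conn D (src e) (tgt e)"
    and sp: "spans n (D \<union> E)" and on: "gedges_on n (D \<union> E)"
  shows "of_bool (bdd_cell n (cell D (insert e E) (insert e S))) + of_bool (bdd_cell n (cell D (insert e E) S))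
     = (of_bool (bdd_cell n (cell D E S)) + of_bool (bdd_cell n (cell (insert e D) E S)) :: nat)"
proof -
  let ?C = "cell D E S"
  let ?M = "cell D (insert e E) (insert e S)" and ?P = "cell D (insert e E) S" and ?Z = "cell (insert e D) E S"
  note ci = cell_insert[OF e S, of D] and ri = rdir_insert[OF e S, of D]
  have Z_imp: "?Z \<noteq> {} \<Longrightarrow> ?M \<noteq> {} \<and> ?P \<noteq> {}"
    using cell_perturb[OF fin nc _ _ S] unfolding ci by blast
  have MP_imp: "?M \<noteq> {} \<Longrightarrow> ?P \<noteq> {} \<Longrightarrow> ?Z \<noteq> {}"
    using cell_between unfolding ci by blast
  have split: "?C = ?M \<union> ?P \<union> ?Z" unfolding ci by auto
  show ?thesis
  proof (cases "bdd_diffs n ?C")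
    case True
    then have "bdd_diffs n ?M" "bdd_diffs n ?P" "bdd_diffs n ?Z" using split by (auto elim: bdd_diffs_subset)
    then show ?thesis using True Z_imp MP_imp split unfolding bdd_cell_def by (cases "?Z = {}"; cases "?M = {}"; cases "?P = {}") auto
  next
    case False
    then obtain v where v: "v \<in> rdir D E S" "\<not> flat_on n v" using unbounded_rdir[OF S] by blast
    show ?thesis
    proof (cases "?Z = {}")
      case True
      then have "?M = {} \<or> ?P = {}" using MP_imp by blast
      then have "(?M = {} \<and> ?P = ?C) \<or> (?P = {} \<and> ?M = ?C)" using split True by blast
      then show ?thesis using False True by (auto simp: bdd_cell_def)
    next
      case ne: False
      then obtain z m p where zmp: "z \<in> ?Z" "m \<in> ?M" "p \<in> ?P" using Z_imp by blast
      have uM: "\<not> bdd_diffs n ?M" if "u \<in> rdir D E S" "lv u e \<le> 0" "\<not> flat_on n u" for u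
        using rdir_unbounded[OF zmp(2)] that unfolding ri by blast
      have uP: "\<not> bdd_diffs n ?P" if "u \<in> rdir D E S" "lv u e \<ge> 0" "\<not> flat_on n u" for u
        using rdir_unbounded[OF zmp(3)] that unfolding ri by blast
      have uZ: "\<not> bdd_diffs n ?Z" if "u \<in> rdir D E S" "lv u e = 0" "\<not> flat_on n u" for u
        using rdir_unbounded[OF zmp(1)] that unfolding ri by blast
      show ?thesis
      proof (cases "bdd_diffs n ?Z")
        case bZ: False
        then obtain u where u: "u \<in> rdir (insert e D) E S" "\<not> flat_on n u" using unbounded_rdir[OF S] by blast
        then have "u \<in> rdir D E S" "lv u e = 0" unfolding ri by auto
        then have "\<not> bdd_diffs n ?M" "\<not> bdd_diffs n ?P" using uM[of u] uP[of u] u(2) by simp_all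
        then show ?thesis using False bZ by (simp add: bdd_cell_def)
      next
        case bZ: True
        \<comment> \<open>A bounded section has no nonconstant recession direction parallel to
          \<open>e\<close>, so \<open>v\<close> leaves strictly to one side. Another one leaving to
          the opposite side would combine with it by \<open>rdir_opposite\<close> to a parallel one,
          so the opposite half is bounded.\<close>
        have no0: "\<not> (\<exists>u\<in>rdir D E S. lv u e = 0 \<and> \<not> flat_on n u)" using uZ bZ by blast
        then have "lv v e \<noteq> 0" using v by blast
        then consider "lv v e > 0" | "lv v e < 0" by linarith
        then show ?thesis
        proof cases
          case 1
          have "bdd_diffs n ?M"
          proof (rule ccontr)
            assume "\<not> bdd_diffs n ?M"
            then obtain w where w: "w \<in> rdir D (insert e E) (insert e S)" "\<not> flat_on n w"
              using unbounded_rdir[of "insert e S" "insert e E"] S by blast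
            then have w': "w \<in> rdir D E S" "lv w e \<le> 0" unfolding ri by auto
            then have "lv w e < 0" using no0 w(2) by fastforce
            then show False using rdir_opposite[OF v(1) 1 w'(1) _ v(2) sp on] no0 by blast
          qed
          moreover have "\<not> bdd_diffs n ?P" using uP v 1 by auto
          ultimately show ?thesis using False bZ ne zmp by (auto simp: bdd_cell_def)
        next
          case 2
          have "bdd_diffs n ?P"
          proof (rule ccontr)
            assume "\<not> bdd_diffs n ?P"
            then obtain w where w: "w \<in> rdir D (insert e E) S" "\<not> flat_on n w"
              using unbounded_rdir[of S "insert e E"] S by blast
            then have w': "w \<in> rdir D E S" "lv w e \<ge> 0" unfolding ri by auto
            then have "lv w e > 0" using no0 w(2) by fastforce
            then show False using rdir_opposite[OF w'(1) _ v(1) 2 w(2) sp on] no0 by blast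
          qed
          moreover have "\<not> bdd_diffs n ?M" using uM v 2 by auto
          ultimately show ?thesis using False bZ ne zmp by (auto simp: bdd_cell_def)
        qed
      qed
    qed
  qed
qed

lemma card_bdd_signs: "finite E \<Longrightarrow> card (bdd_signs n D E) = (\<Sum>S\<in>Pow E. of_bool (bdd_cell n (cell D E S)))"
proof -
  assume "finite E"
  moreover have "bdd_signs n D E = {S \<in> Pow E. bdd_cell n (cell D E S)}" by (auto simp: bdd_signs_def)
  ultimately show ?thesis by (simp add: Int_def)
qed

lemma card_bdd_signs_insert:
  assumes fin: "finite E" and e: "e \<notin> E"
  shows "card (bdd_signs n D (insert e E)) = (\<Sum>S\<in>Pow E. of_bool (bdd_cell n (cell D (insert e E) (insert e S)))
       + of_bool (bdd_cell n (cell D (insert e E) S)))"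
proof -
  have "card (bdd_signs n D (insert e E)) = (\<Sum>S\<in>Pow E \<union> insert e ` Pow E. of_bool (bdd_cell n (cell D (insert e E) S)))"
    using fin by (simp only: card_bdd_signs finite_insert Pow_insert)
  also have "\<dots> = (\<Sum>S\<in>Pow E. of_bool (bdd_cell n (cell D (insert e E) S))) + (\<Sum>S\<in>insert e ` Pow E. of_bool (bdd_cell n (cell D (insert e E) S)))"
    by (rule sum.union_disjoint) (use fin e in auto)
  also have "(\<Sum>S\<in>insert e ` Pow E. of_bool (bdd_cell n (cell D (insert e E) S))) = (\<Sum>S\<in>Pow E. of_bool (bdd_cell n (cell D (insert e E) (insert e S))) :: nat)"
    by (subst sum.reindex) (use e in \<open>auto simp: inj_on_def\<close>)
  finally show ?thesis by (simp only: sum.distrib add.commute)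
qed

text \<open>On the flat of \<open>D\<close> the difference of the ends of \<open>e\<close> is the
  gain of a connecting path, so the hyperplane of \<open>e\<close> is parallel to the flat, and
  contains it only in the balanced case.\<close>

lemma ev_conn_constant:
  assumes c: "conn D (src e) (tgt e)" and ne: "src e \<noteq> tgt e"
  shows "\<exists>c. (c = 0 \<longrightarrow> gspan D e) \<and> (\<forall>x. (\<forall>f\<in>D. ev x f = 0) \<longrightarrow> ev x e = c)"
proof -
  obtain vs es where p: "gpath D vs es" "vs ! 0 = src e" "vs ! length es = tgt e" using conn_imp_gpath[OF c] by blast
  have ee: "ends e = {vs ! 0, vs ! length es}" using p by (simp add: ends_def)
  let ?g = "pgain vs es + dgain e (vs ! length es)"
  have g: "?g = pgain vs es - gn e" using p ne by (simp add: dgain_def)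
  have "ev x e = real_of_int ?g" if x: "\<forall>f\<in>D. ev x f = 0" for x
  proof -
    have "x (vs ! length es) - x (vs ! 0) - of_int (pgain vs es) = 0"
      by (rule gpath_potential[OF p(1), of "\<lambda>a. a = 0"]) (use x in \<open>auto simp: ev_def\<close>)
    then show ?thesis unfolding g using p by (simp add: ev_def)
  qed
  moreover have "real_of_int ?g = 0 \<longrightarrow> gspan D e" using p(1) ee unfolding gspan_def of_int_eq_0_iff by blast
  ultimately show ?thesis by blast
qed

lemma gspan_ev:
  assumes g: "gspan D e" and ne: "src e \<noteq> tgt e" and x: "\<forall>f\<in>D. ev x f = 0"
  shows "ev x e = 0"
proof -
  obtain vs es where p: "gpath D vs es" "ends e = {vs ! 0, vs ! length es}" "pgain vs es + dgain e (vs ! length es) = 0"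
    using g by (auto simp: gspan_def)
  have "x (tgt e) - x (src e) - of_int (gn e) = 0 \<longleftrightarrow> (of_int (pgain vs es + dgain e (vs ! length es)) :: real) = 0"
    by (rule path_edge_potential[OF p(1,2) ne, of "\<lambda>a. a = 0"]) (use x in \<open>auto simp: ev_def\<close>)
  then show ?thesis using p(3) by (simp add: ev_def)
qed

text \<open>Bounded cells obey the recursion for \<open>nbpoly\<close> at \<open>y = 0\<close>: an
  isthmus makes every cell unbounded, an implied edge leaves no cell, a contradictory one has
  constant sign. At the end the flat of a spanning tree is one cell, bounded modulo
  constants.\<close>

lemma bdd_signs_nbpoly:
  assumes "delcon_state n ord D E"
  shows "real (card (bdd_signs n D E)) = nbpoly n ord D E 0"
  using assms
proof (induction rule: delcon_induct)
  case (empty D)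
  have D: "finite D" "acyc D" "spans n D" using empty by (auto simp: delcon_state_def)
  have "nbpoly n ord D {} 0 = 1" using D by (simp add: nbpoly_def nb_empty act_in_def)
  moreover have "bdd_cell n (cell D {} {})"
    unfolding bdd_cell_def
  proof
    show "cell D {} {} \<noteq> {}" using acyc_potential[OF D(1,2)] by (auto simp: cell_def)
    show "bdd_diffs n (cell D {} {})"
    proof (rule ccontr)
      assume "\<not> ?thesis"
      then obtain v where "v \<in> rdir D {} {}" "\<not> flat_on n v" using unbounded_rdir[of "{}" "{}"] by blast
      then show False using flat_on_spans[OF D(3), of v] by (auto simp: rdir_def)
    qed
  qed
  ultimately show ?case by (simp add: card_bdd_signs)
next
  case (implied D E e)
  have st: "finite E" "src e \<noteq> tgt e" using implied by (auto simp: delcon_state_def loopless_def)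
  have "\<not> bdd_cell n (cell D (insert e E) (insert e S))" "\<not> bdd_cell n (cell D (insert e E) S)" if "S \<in> Pow E" for S
    using gspan_ev[OF implied.hyps(5) st(2)] that unfolding bdd_cell_def cell_insert[OF implied.hyps(2) PowD[OF that]]
    by (auto simp: cell_def)
  then have "card (bdd_signs n D (insert e E)) = 0"
    unfolding card_bdd_signs_insert[OF st(1) implied.hyps(2)] by (intro sum.neutral) auto
  then show ?case unfolding delcon_state_nbpoly_insert[OF implied.hyps(1,2,4)] using implied.hyps(5) by simp
next
  case (contradictory D E e)
  have st: "finite E" "src e \<noteq> tgt e" "\<forall>d\<in>D. ord e < ord d" using contradictory by (auto simp: delcon_state_def loopless_def)
  have c: "conn (D \<union> E) (src e) (tgt e)" using contradictory.hyps(5) by (rule conn_mono) auto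
  obtain k where k: "k \<noteq> 0" "\<And>x. \<forall>f\<in>D. ev x f = 0 \<Longrightarrow> ev x e = k"
    using ev_conn_constant[OF contradictory.hyps(5) st(2)] contradictory.hyps(6) by blast
  have "of_bool (bdd_cell n (cell D (insert e E) (insert e S))) + of_bool (bdd_cell n (cell D (insert e E) S))
      = (of_bool (bdd_cell n (cell D E S)) :: nat)" if S: "S \<in> Pow E" for S
  proof -
    have ek: "ev x e = k" if "x \<in> cell D E S" for x using k(2) that by (auto simp: cell_def)
    then have "{x \<in> cell D E S. ev x e < 0} = (if k < 0 then cell D E S else {})"
      "{x \<in> cell D E S. ev x e > 0} = (if k > 0 then cell D E S else {})" by auto
    then show ?thesis unfolding cell_insert[OF contradictory.hyps(2) PowD[OF S]] using k(1) by (auto simp: bdd_cell_def)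
  qed
  then have "card (bdd_signs n D (insert e E)) = card (bdd_signs n D E)"
    unfolding card_bdd_signs_insert[OF st(1) contradictory.hyps(2)] card_bdd_signs[OF st(1)] by (intro sum.cong refl)
  then show ?case
    unfolding delcon_state_nbpoly_insert[OF contradictory.hyps(1,2,4)]
    using contradictory.hyps(6) c nbpoly_contract_conn[OF st(3) contradictory.hyps(5)] contradictory.IH by simp
next
  case (ordinary D E e)
  have st: "finite E" "gedges_on n (D \<union> E)" "spans n (D \<union> E)"
    using ordinary spans_delete[of n e "D \<union> E"] by (auto simp: delcon_state_def gedges_on_def)
  have ng: "\<not> gspan D e" using ordinary.hyps(5) gspan_conn by blast
  have "card (bdd_signs n D (insert e E)) = card (bdd_signs n D E) + card (bdd_signs n (insert e D) E)"
    unfolding card_bdd_signs_insert[OF st(1) ordinary.hyps(2)] card_bdd_signs[OF st(1)] sum.distrib[symmetric]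
    by (intro sum.cong refl bdd_cell_ordinary) (use st ordinary.hyps in auto)
  then show ?case
    unfolding delcon_state_nbpoly_insert[OF ordinary.hyps(1,2,4)] using ng ordinary.hyps(6) ordinary.IH by simp
next
  case (isthmus D E e)
  have st: "finite E" "src e \<in> {1..n}" "tgt e \<in> {1..n}" using isthmus by (auto simp: delcon_state_def gedges_on_def)
  have ng: "\<not> gspan D e" using isthmus.hyps(5) gspan_conn conn_mono[of D _ _ "D \<union> E"] by blast
  \<comment> \<open>The two sides of the isthmus can be moved apart or together freely; the sign of
    the direction is chosen according to the side of the new hyperplane.\<close>
  let ?w = "comp_ind (D \<union> E) e"
  have lw: "lv ?w f = 0" if "f \<in> D \<union> E" for f using that by (rule lv_comp_ind)
  have lwe: "lv ?w e = 1" by (rule lv_comp_ind_self[OF isthmus.hyps(5)])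
  have neg: "lv (\<lambda>i. - ?w i) f = - lv ?w f" for f by (simp add: lv_def)
  have nc: "\<not> flat_on n ?w" "\<not> flat_on n (\<lambda>i. - ?w i)"
  proof -
    have "?w (tgt e) \<noteq> ?w (src e)" "- ?w (tgt e) \<noteq> - ?w (src e)" using lwe unfolding lv_def by linarith+
    then show "\<not> flat_on n ?w" "\<not> flat_on n (\<lambda>i. - ?w i)" using st(2,3) unfolding flat_on_def by blast+
  qed
  have "\<not> bdd_cell n (cell D (insert e E) (insert e S))" "\<not> bdd_cell n (cell D (insert e E) S)" if S: "S \<in> Pow E" for S
  proof -
    have "?w \<in> rdir D (insert e E) S" "(\<lambda>i. - ?w i) \<in> rdir D (insert e E) (insert e S)"
      unfolding rdir_insert[OF isthmus.hyps(2) PowD[OF S]] using lw lwe S by (auto simp: rdir_def neg)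
    then show "\<not> bdd_cell n (cell D (insert e E) (insert e S))" "\<not> bdd_cell n (cell D (insert e E) S)"
      using rdir_unbounded nc unfolding bdd_cell_def by blast+
  qed
  then have "card (bdd_signs n D (insert e E)) = 0"
    unfolding card_bdd_signs_insert[OF st(1) isthmus.hyps(2)] by (intro sum.neutral) auto
  then show ?case unfolding delcon_state_nbpoly_insert[OF isthmus.hyps(1,2,4)] using ng isthmus.hyps(5) by simp
qed

section \<open>Regions as connected components\<close>

definition pull :: "(nat \<Rightarrow> 'n::finite) \<Rightarrow> real ^ 'n \<Rightarrow> nat \<Rightarrow> real" where
  "pull idx x i = x $ idx i"

definition region :: "(nat \<Rightarrow> 'n::finite) \<Rightarrow> gedge set \<Rightarrow> gedge set \<Rightarrow> (real ^ 'n) set" where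
  "region idx E S = {x \<in> sum_zero_space. pull idx x \<in> cell {} E S}"

lemma mem_hyperplanes: "x \<in> \<Union> (arr_hyperplanes idx E) \<longleftrightarrow> (\<exists>e\<in>E. ev (pull idx x) e = 0)"
proof
  assume "x \<in> \<Union> (arr_hyperplanes idx E)"
  then obtain i j g where "(i, j, g) \<in> E" "x $ idx j - x $ idx i = of_int g" by (auto simp: arr_hyperplanes_def)
  then show "\<exists>e\<in>E. ev (pull idx x) e = 0" by (intro bexI[of _ "(i, j, g)"]) (auto simp: ev_def pull_def)
next
  assume "\<exists>e\<in>E. ev (pull idx x) e = 0"
  then obtain i j g where "(i, j, g) \<in> E" "x $ idx j - x $ idx i = of_int g" by (auto simp: ev_def pull_def)
  then show "x \<in> \<Union> (arr_hyperplanes idx E)" unfolding arr_hyperplanes_def by blast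
qed

lemma ev_pull_affine:
  "ev (pull idx ((1 - t) *\<^sub>R x + t *\<^sub>R y)) e = (1 - t) * ev (pull idx x) e + t * ev (pull idx y) e"
  by (simp add: ev_def pull_def algebra_simps)

lemma convex_region: "convex (region idx E S)"
  unfolding convex_alt
proof (intro ballI allI impI)
  fix x y t assume x: "x \<in> region idx E S" and y: "y \<in> region idx E S" and t: "0 \<le> t \<and> t \<le> (1::real)"
  let ?z = "(1 - t) *\<^sub>R x + t *\<^sub>R y"
  have "?z \<in> sum_zero_space"
    using x y by (simp add: region_def sum_zero_space_def sum.distrib sum_distrib_left[symmetric])
  moreover have "ev (pull idx ?z) e < 0" if "ev (pull idx x) e < 0" "ev (pull idx y) e < 0" for e
    unfolding ev_pull_affine using that t
    by (intro convex_bound_lt) auto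
  moreover have "ev (pull idx ?z) e > 0" if "ev (pull idx x) e > 0" "ev (pull idx y) e > 0" for e
  proof -
    have "(1 - t) * - ev (pull idx x) e + t * - ev (pull idx y) e < 0"
      using that t by (intro convex_bound_lt) auto
    then show ?thesis unfolding ev_pull_affine by simp
  qed
  ultimately show "?z \<in> region idx E S" using x y by (auto simp: region_def cell_def)
qed

lemma continuous_ev_pull: "continuous_on A (\<lambda>x. ev (pull idx x) e)"
  unfolding ev_def pull_def by (intro continuous_intros)

text \<open>A set given by fixed signs is convex, hence connected. Conversely, on a connected set
  that avoids the hyperplanes no \<open>ev\<close> can change sign, by the intermediate value
  property.\<close>

lemma component_eq_region:
  fixes x :: "real ^ 'n::finite"
  assumes x: "x \<in> sum_zero_space - \<Union> (arr_hyperplanes idx E)"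
  shows "connected_component_set (sum_zero_space - \<Union> (arr_hyperplanes idx E)) x
     = region idx E {e \<in> E. ev (pull idx x) e < 0}" (is "connected_component_set ?W x = region idx E ?S")
proof
  have nz: "ev (pull idx z) e \<noteq> 0" if "z \<in> ?W" "e \<in> E" for z e
    using that mem_hyperplanes[of z idx E] by blast
  have xR: "x \<in> region idx E ?S"
  proof -
    have "ev (pull idx x) e > 0" if "e \<in> E - ?S" for e using nz[OF x, of e] that by force
    then show ?thesis using x by (auto simp: region_def cell_def)
  qed
  have sub: "region idx E ?S \<subseteq> ?W"
  proof
    fix z assume z: "z \<in> region idx E ?S"
    have "ev (pull idx z) e \<noteq> 0" if "e \<in> E" for e
    proof (cases "e \<in> ?S")
      case True
      then have "ev (pull idx z) e < 0" using z unfolding region_def cell_def by blast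
      then show ?thesis by simp
    next
      case False
      then have "ev (pull idx z) e > 0" using z that unfolding region_def cell_def by blast
      then show ?thesis by simp
    qed
    then show "z \<in> ?W" using z mem_hyperplanes[of z idx E] by (auto simp: region_def)
  qed
  show "region idx E ?S \<subseteq> connected_component_set ?W x"
    by (rule connected_component_maximal[OF xR convex_connected[OF convex_region] sub])
  show "connected_component_set ?W x \<subseteq> region idx E ?S"
  proof
    fix y assume "y \<in> connected_component_set ?W x"
    then obtain T where T: "connected T" "T \<subseteq> ?W" "x \<in> T" "y \<in> T" by (auto simp: connected_component_def)
    have con: "connected ((\<lambda>z. ev (pull idx z) e) ` T)" for e
      by (rule connected_continuous_image[OF continuous_ev_pull T(1)])
    have no: "0 \<notin> (\<lambda>z. ev (pull idx z) e) ` T" if "e \<in> E" for e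
    proof
      assume "0 \<in> (\<lambda>z. ev (pull idx z) e) ` T"
      then obtain z where "z \<in> T" "ev (pull idx z) e = 0" by auto
      then show False using nz[of z e] T that by blast
    qed
    have same: "ev (pull idx y) e < 0 \<longleftrightarrow> ev (pull idx x) e < 0" if e: "e \<in> E" for e
    proof (rule ccontr)
      let ?a = "ev (pull idx x) e" and ?b = "ev (pull idx y) e"
      assume "\<not> ?thesis"
      then have "?a \<le> 0 \<and> 0 \<le> ?b \<or> ?b \<le> 0 \<and> 0 \<le> ?a" by linarith
      moreover have "{?a..?b} \<subseteq> (\<lambda>z. ev (pull idx z) e) ` T" "{?b..?a} \<subseteq> (\<lambda>z. ev (pull idx z) e) ` T"
        by (intro connected_contains_Icc[OF con] imageI T)+
      ultimately show False using no[OF e] by auto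
    qed
    have yW: "y \<in> ?W" using T by blast
    have "ev (pull idx y) e > 0" if "e \<in> E - ?S" for e
      using that same[of e] nz[OF yW, of e] by force
    then show "y \<in> region idx E ?S" using yW same by (auto simp: region_def cell_def)
  qed
qed

lemma region_signs:
  assumes "x \<in> region idx E S" "S \<subseteq> E"
  shows "S = {e \<in> E. ev (pull idx x) e < 0}" and "x \<in> sum_zero_space - \<Union> (arr_hyperplanes idx E)"
proof -
  have S: "ev (pull idx x) e < 0" if "e \<in> S" for e using assms that unfolding region_def cell_def by blast
  have nS: "ev (pull idx x) e > 0" if "e \<in> E - S" for e using assms that unfolding region_def cell_def by blast
  show "S = {e \<in> E. ev (pull idx x) e < 0}"
  proof (intro set_eqI iffI)
    fix e assume "e \<in> S" then show "e \<in> {e \<in> E. ev (pull idx x) e < 0}" using S assms(2) by blast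
  next
    fix e assume e: "e \<in> {e \<in> E. ev (pull idx x) e < 0}"
    show "e \<in> S" proof (rule ccontr)
      assume "e \<notin> S" then show False using nS[of e] e by auto
    qed
  qed
  have "ev (pull idx x) e \<noteq> 0" if "e \<in> E" for e using S[of e] nS[of e] that by (cases "e \<in> S") auto
  then show "x \<in> sum_zero_space - \<Union> (arr_hyperplanes idx E)"
    using assms(1) mem_hyperplanes[of x idx E] by (auto simp: region_def)
qed

lemma arr_regions_eq:
  "arr_regions sum_zero_space (arr_hyperplanes idx E) = region idx E ` {S. S \<subseteq> E \<and> region idx E S \<noteq> {}}"
proof (intro equalityI subsetI)
  fix R assume "R \<in> arr_regions sum_zero_space (arr_hyperplanes idx E)"
  then obtain x where x: "x \<in> sum_zero_space - \<Union> (arr_hyperplanes idx E)"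
    and R: "R = connected_component_set (sum_zero_space - \<Union> (arr_hyperplanes idx E)) x" by (auto simp: arr_regions_def)
  have "x \<in> R" using x R by (simp add: connected_component_refl_eq)
  then show "R \<in> region idx E ` {S. S \<subseteq> E \<and> region idx E S \<noteq> {}}"
    using R component_eq_region[OF x] by auto
next
  fix R assume "R \<in> region idx E ` {S. S \<subseteq> E \<and> region idx E S \<noteq> {}}"
  then obtain S x where S: "S \<subseteq> E" "R = region idx E S" "x \<in> region idx E S" by auto
  have "R = connected_component_set (sum_zero_space - \<Union> (arr_hyperplanes idx E)) x"
    using component_eq_region[OF region_signs(2)[OF S(3,1)]] region_signs(1)[OF S(3,1)] S(2) by simp
  then show "R \<in> arr_regions sum_zero_space (arr_hyperplanes idx E)"
    using region_signs(2)[OF S(3,1)] unfolding arr_regions_def by blast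
qed

lemma inj_on_region: "inj_on (region idx E) {S. S \<subseteq> E \<and> region idx E S \<noteq> {}}"
proof (rule inj_onI)
  fix S T assume S: "S \<in> {S. S \<subseteq> E \<and> region idx E S \<noteq> {}}" and T: "T \<in> {S. S \<subseteq> E \<and> region idx E S \<noteq> {}}"
    and eq: "region idx E S = region idx E T"
  then obtain x where "x \<in> region idx E S" "x \<in> region idx E T" by auto
  then show "S = T" using region_signs(1)[of x idx E S] region_signs(1)[of x idx E T] S T by simp
qed

text \<open>Membership in a cell depends on differences only, so any point can be translated into
  the space of coordinate sum zero.\<close>

lemma cell_lift:
  fixes idx :: "nat \<Rightarrow> 'n::finite"
  assumes bij: "bij_betw idx {1..n} UNIV" and on: "gedges_on n E" and y: "y \<in> cell {} E S" and S: "S \<subseteq> E"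
  shows "\<exists>x\<in>region idx E S. \<forall>i\<in>{1..n}. \<forall>j\<in>{1..n}. pull idx x j - pull idx x i = y j - y i"
proof -
  define J where "J = inv_into {1..n} idx"
  have J: "J (idx i) = i" if "i \<in> {1..n}" for i
    unfolding J_def using bij that by (simp add: bij_betw_def inv_into_f_f)
  \<comment> \<open>The mean of the coordinates; subtracting it makes the sum zero.\<close>
  define m where "m = (\<Sum>k\<in>UNIV. y (J k)) / real CARD('n)"
  define x :: "real ^ 'n" where "x = (\<chi> k. y (J k) - m)"
  have px: "pull idx x i = y i - m" if "i \<in> {1..n}" for i using J[OF that] by (simp add: pull_def x_def)
  have "x \<in> sum_zero_space" by (simp add: sum_zero_space_def x_def sum_subtractf m_def)
  moreover have "ev (pull idx x) e = ev y e" if "e \<in> E" for e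
  proof -
    have "src e \<in> {1..n}" "tgt e \<in> {1..n}" using on that by (auto simp: gedges_on_def)
    then show ?thesis by (simp add: ev_def px)
  qed
  then have "pull idx x \<in> cell {} E S" using y S unfolding cell_def by (auto simp: subset_iff)
  ultimately have "x \<in> region idx E S" by (simp add: region_def)
  then show ?thesis using px by (intro bexI[of _ x]) auto
qed

lemma region_bounded_iff:
  fixes idx :: "nat \<Rightarrow> 'n::finite"
  assumes bij: "bij_betw idx {1..n} UNIV" and on: "gedges_on n E" and S: "S \<subseteq> E"
  shows "bounded (region idx E S) \<longleftrightarrow> bdd_diffs n (cell {} E S)"
proof
  assume "bounded (region idx E S)"
  then obtain B where B: "\<And>x. x \<in> region idx E S \<Longrightarrow> norm x \<le> B" by (auto simp: bounded_iff)
  show "bdd_diffs n (cell {} E S)"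
    unfolding bdd_diffs_def
  proof (intro exI[of _ "2 * B"] ballI)
    fix y i j assume y: "y \<in> cell {} E S" and ij: "i \<in> {1..n}" "j \<in> {1..n}"
    obtain x where x: "x \<in> region idx E S" "pull idx x j - pull idx x i = y j - y i"
      using cell_lift[OF bij on y S] ij by blast
    have "\<bar>x $ idx j\<bar> \<le> B" "\<bar>x $ idx i\<bar> \<le> B"
      using component_le_norm_cart[of x] B[OF x(1)] by (meson order_trans)+
    then show "y j - y i \<le> 2 * B" using x(2) by (simp add: pull_def)
  qed
next
  assume "bdd_diffs n (cell {} E S)"
  then obtain M where M: "\<And>y i j. y \<in> cell {} E S \<Longrightarrow> i \<in> {1..n} \<Longrightarrow> j \<in> {1..n} \<Longrightarrow> y j - y i \<le> M"
    unfolding bdd_diffs_def by blast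
  have "norm x \<le> real CARD('n) * M" if x: "x \<in> region idx E S" for x
  proof -
    have d: "x $ k - x $ l \<le> M" for k l
    proof -
      obtain i j where "i \<in> {1..n}" "j \<in> {1..n}" "idx i = l" "idx j = k"
        using bij by (metis UNIV_I bij_betw_imp_surj_on imageE)
      then show ?thesis using M[of "pull idx x" i j] x by (auto simp: region_def pull_def)
    qed
    have z: "(\<Sum>l\<in>UNIV. x $ l) = 0" using x by (simp add: region_def sum_zero_space_def)
    have "\<bar>x $ k\<bar> \<le> M" for k
    proof -
      \<comment> \<open>With coordinate sum zero, a coordinate is the average of its differences to
        all coordinates, so bounds on differences bound it.\<close>
      have "real CARD('n) * x $ k = (\<Sum>l\<in>UNIV. x $ k - x $ l)" by (simp add: sum_subtractf z)
      also have "\<dots> \<le> (\<Sum>l\<in>(UNIV :: 'n set). M)" by (intro sum_mono d)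
      finally have 1: "real CARD('n) * x $ k \<le> real CARD('n) * M" by simp
      have "real CARD('n) * - x $ k = (\<Sum>l\<in>UNIV. x $ l - x $ k)" by (simp add: sum_subtractf z)
      also have "\<dots> \<le> (\<Sum>l\<in>(UNIV :: 'n set). M)" by (intro sum_mono d)
      finally have 2: "real CARD('n) * - x $ k \<le> real CARD('n) * M" by simp
      have "0 < real CARD('n)" by simp
      from mult_left_le_imp_le[OF 1 this] mult_left_le_imp_le[OF 2 this] show ?thesis by simp
    qed
    then have "(\<Sum>k\<in>UNIV. \<bar>x $ k\<bar>) \<le> (\<Sum>k\<in>(UNIV :: 'n set). M)" by (intro sum_mono)
    then show ?thesis using norm_le_l1_cart[of x] by simp
  qed
  then show "bounded (region idx E S)" unfolding bounded_iff by blast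
qed

lemma num_bounded_regions_eq:
  fixes idx :: "nat \<Rightarrow> 'n::finite"
  assumes bij: "bij_betw idx {1..n} UNIV" and on: "gedges_on n E"
  shows "num_bounded_regions idx E = card (bdd_signs n {} E)"
proof -
  have ne: "region idx E S \<noteq> {} \<longleftrightarrow> cell {} E S \<noteq> {}" if "S \<subseteq> E" for S
    using cell_lift[OF bij on _ that] by (auto simp: region_def)
  have eq: "{R \<in> arr_regions (sum_zero_space :: (real ^ 'n) set) (arr_hyperplanes idx E). bounded R}
      = region idx E ` bdd_signs n {} E"
  proof -
    have "bdd_signs n {} E = {S \<in> {S. S \<subseteq> E \<and> region idx E S \<noteq> {}}. bounded (region idx E S)}"
      unfolding bdd_signs_def bdd_cell_def using ne region_bounded_iff[OF bij on] by blast
    then show ?thesis unfolding arr_regions_eq by blast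
  qed
  have "inj_on (region idx E) (bdd_signs n {} E)"
    by (rule inj_on_subset[OF inj_on_region]) (use ne in \<open>auto simp: bdd_signs_def bdd_cell_def\<close>)
  then show ?thesis unfolding num_bounded_regions_def eq by (rule card_image)
qed

section \<open>Comparison of the polynomials\<close>

text \<open>The generating polynomials of \<open>f\<close> and \<open>g\<close> agree at the
  infinitely many points \<open>1 - q\<close>, so their coefficients, which are the counts,
  agree.\<close>

lemma card_eq_of_power_sums:
  fixes f :: "'a \<Rightarrow> nat" and g :: "'b \<Rightarrow> nat"
  assumes fin: "finite A" "finite B"
    and eq: "\<And>q::int. Q \<le> q \<Longrightarrow> (\<Sum>a\<in>A. (1 - real_of_int q) ^ f a) = (\<Sum>b\<in>B. (1 - real_of_int q) ^ g b)"
  shows "card {a \<in> A. f a = k} = card {b \<in> B. g b = k}"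
proof -
  define P where "P = (\<Sum>a\<in>A. monom (1::real) (f a))"
  define R where "R = (\<Sum>b\<in>B. monom (1::real) (g b))"
  have pv: "poly P y = (\<Sum>a\<in>A. y ^ f a)" "poly R y = (\<Sum>b\<in>B. y ^ g b)" for y
    by (simp_all add: P_def R_def poly_sum poly_monom)
  have "P - R = 0"
  proof (rule ccontr)
    assume "P - R \<noteq> 0"
    then have "finite {y. poly (P - R) y = 0}" by (rule poly_roots_finite)
    moreover have "(\<lambda>q::int. 1 - real_of_int q) ` {Q..} \<subseteq> {y. poly (P - R) y = 0}"
      using eq by (auto simp: pv)
    ultimately have "finite ((\<lambda>q::int. 1 - real_of_int q) ` {Q..})" by (rule finite_subset[rotated])
    then have "finite {Q..}" by (rule finite_imageD) (auto simp: inj_on_def)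
    then show False by (simp add: infinite_Ici)
  qed
  then have "coeff P k = coeff R k" by simp
  moreover have "coeff P k = real (card {a \<in> A. f a = k})" "coeff R k = real (card {b \<in> B. g b = k})"
    using fin by (simp_all add: P_def R_def coeff_sum coeff_monom if_distrib sum.If_cases Int_def conj_commute)
  ultimately show ?thesis by simp
qed

lemma finite_gain_edges: "finite (gain_edges n a b)"
  by (rule finite_subset[of _ "{1..n} \<times> {1..n} \<times> {a..b}"]) (auto simp: gain_edges_def)

lemma loopless_gain_edges: "loopless (gain_edges n a b)"
  by (auto simp: loopless_def gain_edges_def)

lemma spans_gain_edges:
  assumes "a \<le> 0" "0 \<le> b" shows "spans n (gain_edges n a b)"
  unfolding spans_def
proof (intro ballI)
  fix u v assume uv: "u \<in> {1..n}" "v \<in> {1..n}"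
  have *: "conn (gain_edges n a b) s t" if "s \<in> {1..n}" "t \<in> {1..n}" "s < t" for s t
    using conn_edge[of "(s, t, 0)" "gain_edges n a b"] that assms by (auto simp: mem_gain_edges)
  show "conn (gain_edges n a b) u v" using *[of u v] *[of v u] uv conn_sym by (cases u v rule: linorder_cases) auto
qed

lemma delcon_state_gain_edges:
  assumes "a \<le> 0" "0 \<le> b" "inj_on ord (gain_edges n a b)"
  shows "delcon_state n ord {} (gain_edges n a b)"
  using assms spans_gain_edges finite_gain_edges loopless_gain_edges gedges_on_gain_edges
  by (auto simp: delcon_state_def acyc_def)

lemma finite_decreasing_trees: "finite {T. decreasing_tree n k1 k2 T}"
  by (rule finite_subset[of _ "Pow ({1..n} \<times> {1..n} \<times> {1..k1 + k2})"])
     (auto simp: decreasing_tree_def colored_rooted_tree_def)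

theorem theorem4p3:
  fixes n k1 k2 \<alpha> :: nat and ord :: "gedge \<Rightarrow> nat" and idx :: "nat \<Rightarrow> 'n::finite"
  assumes "2 \<le> n" and "\<alpha> \<le> n - 1"
    and "inj_on ord (gain_edges n (- int k2) (int k1 + int k2))"
    and "bij_betw idx {1..n} (UNIV :: 'n set)"
  shows "card {B. nbc_basis n (gain_edges n (- int k2) (int k1 + int k2)) ord B \<and>
                  activity n (gain_edges n (- int k2) (int k1 + int k2)) ord B = \<alpha>}
         = card {T. decreasing_tree n (k1 + 1) k2 T \<and> n_root_color1_edges n T = \<alpha>}
       \<and> num_bounded_regions idx (gain_edges n (- int k2) (int k1 + int k2))
         = card {T. decreasing_tree n (k1 + 1) k2 T \<and> n_root_color1_edges n T = 0}"
proof -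
  let ?E = "gain_edges n (- int k2) (int k1 + int k2)"
  let ?Tr = "{T. decreasing_tree n (k1 + 1) k2 T}"
  obtain j where n: "n = Suc j" and j: "1 \<le> j" using assms(1) by (cases n) auto
  have st: "delcon_state n ord {} ?E" by (rule delcon_state_gain_edges) (use assms(3) in auto)
  have fin: "finite (nb n ord {} ?E)" by (rule finite_nb) (auto simp: finite_gain_edges)
  note nbc = card_nbc_eq_nb[OF loopless_gain_edges gedges_on_gain_edges assms(3)]
  \<comment> \<open>The first bound keeps the binomial coefficients polynomial in
    \<open>card_gain_colorings\<close>; the second exceeds the gain of every circle, as
    \<open>colorings_nbpoly\<close> requires.\<close>
  define Q where "Q = max (int (n * k2 + n * k1 + 1)) ((\<Sum>f\<in>?E. \<bar>gn f\<bar>) + 1)"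
  have poly_eq: "(\<Sum>B\<in>nb n ord {} ?E. (1 - real_of_int q) ^ act_in ord ?E B)
      = (\<Sum>T\<in>?Tr. (1 - real_of_int q) ^ n_root_color1_edges n T)" if q: "Q \<le> q" for q
  proof -
    have q1: "int (n * k2 + n * k1 + 1) \<le> q" and q2: "(\<Sum>f\<in>{} \<union> ?E. \<bar>gn f\<bar>) < q"
      using q by (auto simp: Q_def)
    have "0 < int (n * k2 + n * k1 + 1)" by (simp only: of_nat_0_less_iff)
    then have "real_of_int q \<noteq> 0" using q1 by linarith
    moreover have "real_of_int q * ((- 1) ^ j * nbpoly n ord {} ?E (1 - real_of_int q))
      = real_of_int q * ((- 1) ^ j * (\<Sum>T\<in>?Tr. (1 - real_of_int q) ^ n_root_color1_edges n T))"
    proof -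
      have "real_of_int q * ((- 1) ^ j * nbpoly n ord {} ?E (1 - real_of_int q)) = real (card (colorings n q {} ?E))"
        using colorings_nbpoly[OF st q2] n by (simp add: mult.assoc)
      then show ?thesis unfolding decreasing_tree_polynomial[OF n] card_gain_colorings[OF n j q1] .
    qed
    ultimately show ?thesis by (simp add: nbpoly_def)
  qed
  have count: "card {B \<in> nb n ord {} ?E. act_in ord ?E B = k} = card {T \<in> ?Tr. n_root_color1_edges n T = k}" for k
    by (rule card_eq_of_power_sums[OF fin finite_decreasing_trees poly_eq])
  have "{B. nbc_basis n ?E ord B \<and> activity n ?E ord B = \<alpha>} = {B \<in> nb n ord {} ?E. act_in ord ?E B = \<alpha>}"
  proof (rule Collect_cong)
    fix B
    have "nbc_basis n ?E ord B \<longleftrightarrow> B \<in> nb n ord {} ?E"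
      using arg_cong[OF nbc(1), of "\<lambda>X. B \<in> X"] by simp
    then show "nbc_basis n ?E ord B \<and> activity n ?E ord B = \<alpha> \<longleftrightarrow> B \<in> nb n ord {} ?E \<and> act_in ord ?E B = \<alpha>"
      using nbc(2)[of B] by metis
  qed
  then have 1: "card {B. nbc_basis n ?E ord B \<and> activity n ?E ord B = \<alpha>}
       = card {T. decreasing_tree n (k1 + 1) k2 T \<and> n_root_color1_edges n T = \<alpha>}"
    using count[of \<alpha>] by simp
  \<comment> \<open>Since \<open>0 ^ 0 = 1\<close>, the value at 0 counts the bases without active
    edges.\<close>
  have "nbpoly n ord {} ?E 0 = (\<Sum>B\<in>nb n ord {} ?E. of_bool (act_in ord ?E B = 0))"
    unfolding nbpoly_def by (intro sum.cong) (auto simp: power_0_left)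
  also have "\<dots> = real (card {B \<in> nb n ord {} ?E. act_in ord ?E B = 0})" by (rule sum_of_bool_card[OF fin])
  finally have "card (bdd_signs n {} ?E) = card {B \<in> nb n ord {} ?E. act_in ord ?E B = 0}"
    using bdd_signs_nbpoly[OF st] by simp
  then have 2: "num_bounded_regions idx ?E = card {T. decreasing_tree n (k1 + 1) k2 T \<and> n_root_color1_edges n T = 0}"
    using num_bounded_regions_eq[OF assms(4) gedges_on_gain_edges] count[of 0] by simp
  show ?thesis using 1 2 by blast
qed

end
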